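(* Every special type may be written as a sum of an indecomposable nilpotent special type and a (possibly empty) sum of indecomposable types. This decomposition is unique up to reordering of the indecomposable type summands.
   Context: All vector spaces are real and finite dimensional. Types. A pair $(\xi,W;\gamma)$ consists of a nonzero vector space $W$, a nondegenerate symmetric bilinear form $\gamma$ on $W$, and a linear map $\xi:W\to W$ with $\gamma(\xi u,v)+\gamma(u,\xi v)=0$ for all $u,v\in W$. Two pairs are equivalent if there is a bijective linear map between the spaces which preserves the forms and intertwines the linear maps. An equivalence class of pairs is a type. If $W=W_1\oplus W_2$ with $W_1,W_2$ nonzero, $\xi$-invariant, $\gamma$-orthogonal and $\gamma|W_i$ nondegenerate, then the type of $(\xi,W;\gamma)$ is the sum of the types of $(\xi|W_1,W_1;\gamma|W_1)$ and $(\xi|W_2,W_2;\gamma|W_2)$. A type is indecomposable if it is not the sum of two types. Special types. A triple $(V,\xi,v^0;\gamma)$ consists of a vector space $V$, a nonzero vector $v^0\in V$, a symmetric bilinear form $\gamma$ on $V$ with $\ker\gamma=\mathrm{span}\{v^0\}$, and a linear map $\xi:V\to V$ with $\xi v^0=0$ and $\gamma(\xi u,v)+\gamma(u,\xi v)=0$ for all $u,v\in V$. Triples $(V,\xi,v^0;\gamma)$ and $(V',\xi',(v')^0;\gamma')$ are equivalent if there is a bijective linear map $P:V\to V'$ with $Pv^0=(v')^0$, $\gamma'(Pu,Pv)=\gamma(u,v)$ for all $u,v\in V$, and $\xi'\circ P=P\circ\xi$. An equivalence class of triples is a special type; it is nilpotent if $\xi$ is nilpotent for a representing triple. If $V=W_1\oplus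 W_2$ with $W_1,W_2$ $\xi$-invariant and $\gamma$-orthogonal, $v^0\in W_1$, $\ker(\gamma|W_1)=\mathrm{span}\{v^0\}$, and $W_2\ne0$, then the special type of $(V,\xi,v^0;\gamma)$ is the sum of the special type of $(W_1,\xi|W_1,v^0;\gamma|W_1)$ and the type of $(\xi|W_2,W_2;\gamma|W_2)$. A special type is indecomposable if it cannot be written as the sum of a special type and a type. *)

theory Defs
  imports Complex_Main "HOL-Library.Multiset"
begin

text \<open>
  Finite dimensional real vector spaces are finite dimensional subspaces of an arbitrary ambient
  real vector space \<open>'a\<close> (possibly the whole of it). Maps and forms are total functions of which
  only the restriction to the carrier matters: equivalence below never looks outside the carrier,
  so restricting a map or a form to a subspace amounts to changing the carrier alone.
\<close>

definition fin_dim_space :: "'a::real_vector set \<Rightarrow> bool" where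
  "fin_dim_space V \<longleftrightarrow> subspace V \<and> (\<exists>B. finite B \<and> span B = V)"

definition linear_on ::
  "'a::real_vector set \<Rightarrow> 'b::real_vector set \<Rightarrow> ('a \<Rightarrow> 'b) \<Rightarrow> bool" where
  "linear_on V W f \<longleftrightarrow>
     (\<forall>u\<in>V. f u \<in> W) \<and>
     (\<forall>u\<in>V. \<forall>v\<in>V. f (u + v) = f u + f v) \<and>
     (\<forall>c. \<forall>u\<in>V. f (c *\<^sub>R u) = c *\<^sub>R f u)"

definition sym_bilinear_on :: "'a::real_vector set \<Rightarrow> ('a \<Rightarrow> 'a \<Rightarrow> real) \<Rightarrow> bool" where
  "sym_bilinear_on V \<gamma> \<longleftrightarrow>
     (\<forall>u\<in>V. linear_on V UNIV (\<lambda>v. \<gamma> u v)) \<and>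
     (\<forall>v\<in>V. linear_on V UNIV (\<lambda>u. \<gamma> u v)) \<and>
     (\<forall>u\<in>V. \<forall>v\<in>V. \<gamma> u v = \<gamma> v u)"

definition form_kernel :: "'a set \<Rightarrow> ('a \<Rightarrow> 'a \<Rightarrow> real) \<Rightarrow> 'a set" where
  "form_kernel V \<gamma> = {u \<in> V. \<forall>v\<in>V. \<gamma> u v = 0}"

definition nondegenerate_on :: "'a::real_vector set \<Rightarrow> ('a \<Rightarrow> 'a \<Rightarrow> real) \<Rightarrow> bool" where
  "nondegenerate_on V \<gamma> \<longleftrightarrow> form_kernel V \<gamma> = {0}"

definition skew_on :: "'a set \<Rightarrow> ('a \<Rightarrow> 'a \<Rightarrow> real) \<Rightarrow> ('a \<Rightarrow> 'a) \<Rightarrow> bool" where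
  "skew_on V \<gamma> \<xi> \<longleftrightarrow> (\<forall>u\<in>V. \<forall>v\<in>V. \<gamma> (\<xi> u) v + \<gamma> u (\<xi> v) = 0)"

definition invariant_under :: "('a \<Rightarrow> 'a) \<Rightarrow> 'a set \<Rightarrow> bool" where
  "invariant_under \<xi> V \<longleftrightarrow> \<xi> ` V \<subseteq> V"

definition orthogonal_sum ::
  "('a::real_vector \<Rightarrow> 'a \<Rightarrow> real) \<Rightarrow> 'a set \<Rightarrow> 'a set \<Rightarrow> 'a set \<Rightarrow> bool" where
  "orthogonal_sum \<gamma> V W1 W2 \<longleftrightarrow>
     subspace W1 \<and> subspace W2 \<and>
     V = {x + y | x y. x \<in> W1 \<and> y \<in> W2} \<and> W1 \<inter> W2 = {0} \<and>
     (\<forall>x\<in>W1. \<forall>y\<in>W2. \<gamma> x y = 0)"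

definition isometry_between ::
  "'a::real_vector set \<Rightarrow> ('a \<Rightarrow> 'a) \<Rightarrow> ('a \<Rightarrow> 'a \<Rightarrow> real) \<Rightarrow>
   'a set \<Rightarrow> ('a \<Rightarrow> 'a) \<Rightarrow> ('a \<Rightarrow> 'a \<Rightarrow> real) \<Rightarrow> ('a \<Rightarrow> 'a) \<Rightarrow> bool" where
  "isometry_between V \<xi> \<gamma> V' \<xi>' \<gamma>' P \<longleftrightarrow>
     linear_on V V' P \<and> bij_betw P V V' \<and>
     (\<forall>u\<in>V. \<forall>v\<in>V. \<gamma>' (P u) (P v) = \<gamma> u v) \<and>
     (\<forall>u\<in>V. \<xi>' (P u) = P (\<xi> u))"


subsection \<open>Pairs and types\<close>

type_synonym 'a pair = "('a \<Rightarrow> 'a) \<times> 'a set \<times> ('a \<Rightarrow> 'a \<Rightarrow> real)"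

definition pairs :: "'a::real_vector pair set" where
  "pairs = {(\<xi>, W, \<gamma>).
     fin_dim_space W \<and> W \<noteq> {0} \<and>
     sym_bilinear_on W \<gamma> \<and> nondegenerate_on W \<gamma> \<and>
     linear_on W W \<xi> \<and> skew_on W \<gamma> \<xi>}"

definition pair_equiv :: "('a::real_vector pair \<times> 'a pair) set" where
  "pair_equiv = {((\<xi>, W, \<gamma>), (\<xi>', W', \<gamma>')).
     (\<xi>, W, \<gamma>) \<in> pairs \<and> (\<xi>', W', \<gamma>') \<in> pairs \<and>
     (\<exists>P. isometry_between W \<xi> \<gamma> W' \<xi>' \<gamma>' P)}"

definition pair_types :: "'a::real_vector pair set set" where
  "pair_types = pairs // pair_equiv"

definition type_of :: "'a::real_vector pair \<Rightarrow> 'a pair set" where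
  "type_of p = pair_equiv `` {p}"

text \<open>\<open>is_type_sum \<tau> \<tau>1 \<tau>2\<close>: the type \<open>\<tau>\<close> is the sum of the types \<open>\<tau>1\<close> and \<open>\<tau>2\<close>.\<close>

definition is_type_sum ::
  "'a::real_vector pair set \<Rightarrow> 'a pair set \<Rightarrow> 'a pair set \<Rightarrow> bool" where
  "is_type_sum \<tau> \<tau>1 \<tau>2 \<longleftrightarrow>
     (\<exists>\<xi> W \<gamma> W1 W2.
        (\<xi>, W, \<gamma>) \<in> pairs \<and>
        orthogonal_sum \<gamma> W W1 W2 \<and> W1 \<noteq> {0} \<and> W2 \<noteq> {0} \<and>
        invariant_under \<xi> W1 \<and> invariant_under \<xi> W2 \<and>
        nondegenerate_on W1 \<gamma> \<and> nondegenerate_on W2 \<gamma> \<and>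
        \<tau> = type_of (\<xi>, W, \<gamma>) \<and>
        \<tau>1 = type_of (\<xi>, W1, \<gamma>) \<and> \<tau>2 = type_of (\<xi>, W2, \<gamma>))"

definition indecomposable_type :: "'a::real_vector pair set \<Rightarrow> bool" where
  "indecomposable_type \<tau> \<longleftrightarrow> \<tau> \<in> pair_types \<and> \<not> (\<exists>\<tau>1 \<tau>2. is_type_sum \<tau> \<tau>1 \<tau>2)"

text \<open>Sums of nonempty lists of types; there is no zero type to serve as an empty sum.\<close>

fun is_type_sum_list :: "'a::real_vector pair set \<Rightarrow> 'a pair set list \<Rightarrow> bool" where
  "is_type_sum_list \<tau> [] \<longleftrightarrow> False"
| "is_type_sum_list \<tau> [\<tau>1] \<longleftrightarrow> \<tau> \<in> pair_types \<and> \<tau> = \<tau>1"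
| "is_type_sum_list \<tau> (\<tau>1 # \<tau>2 # \<tau>s) \<longleftrightarrow>
     (\<exists>\<sigma>. is_type_sum \<tau> \<tau>1 \<sigma> \<and> is_type_sum_list \<sigma> (\<tau>2 # \<tau>s))"


subsection \<open>Triples and special types\<close>

type_synonym 'a triple = "'a set \<times> ('a \<Rightarrow> 'a) \<times> 'a \<times> ('a \<Rightarrow> 'a \<Rightarrow> real)"

definition triples :: "'a::real_vector triple set" where
  "triples = {(V, \<xi>, v0, \<gamma>).
     fin_dim_space V \<and> v0 \<in> V \<and> v0 \<noteq> 0 \<and>
     sym_bilinear_on V \<gamma> \<and> form_kernel V \<gamma> = span {v0} \<and>
     linear_on V V \<xi> \<and> \<xi> v0 = 0 \<and> skew_on V \<gamma> \<xi>}"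

definition triple_equiv :: "('a::real_vector triple \<times> 'a triple) set" where
  "triple_equiv = {((V, \<xi>, v0, \<gamma>), (V', \<xi>', v0', \<gamma>')).
     (V, \<xi>, v0, \<gamma>) \<in> triples \<and> (V', \<xi>', v0', \<gamma>') \<in> triples \<and>
     (\<exists>P. isometry_between V \<xi> \<gamma> V' \<xi>' \<gamma>' P \<and> P v0 = v0')}"

definition special_types :: "'a::real_vector triple set set" where
  "special_types = triples // triple_equiv"

definition special_type_of :: "'a::real_vector triple \<Rightarrow> 'a triple set" where
  "special_type_of t = triple_equiv `` {t}"

definition nilpotent_special_type :: "'a::real_vector triple set \<Rightarrow> bool" where
  "nilpotent_special_type \<Delta> \<longleftrightarrow>
     \<Delta> \<in> special_types \<and>
     (\<exists>V \<xi> v0 \<gamma>. (V, \<xi>, v0, \<gamma>) \<in> \<Delta> \<and> (\<exists>n. \<forall>u\<in>V. (\<xi> ^^ n) u = 0))"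

text \<open>
  \<open>is_special_sum \<Delta> \<Delta>' \<tau>\<close>: the special type \<open>\<Delta>\<close> is the sum of the special type \<open>\<Delta>'\<close> and the
  type \<open>\<tau>\<close>. Nondegeneracy of \<open>\<gamma>\<close> on \<open>W2\<close> is automatic, as a vector of \<open>W2\<close> orthogonal to \<open>W2\<close>
  lies in the kernel of \<open>\<gamma>\<close>, hence in \<open>W1\<close>.
\<close>

definition is_special_sum ::
  "'a::real_vector triple set \<Rightarrow> 'a triple set \<Rightarrow> 'a pair set \<Rightarrow> bool" where
  "is_special_sum \<Delta> \<Delta>' \<tau> \<longleftrightarrow>
     (\<exists>V \<xi> v0 \<gamma> W1 W2.
        (V, \<xi>, v0, \<gamma>) \<in> triples \<and>
        orthogonal_sum \<gamma> V W1 W2 \<and>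
        invariant_under \<xi> W1 \<and> invariant_under \<xi> W2 \<and>
        v0 \<in> W1 \<and> form_kernel W1 \<gamma> = span {v0} \<and> W2 \<noteq> {0} \<and>
        \<Delta> = special_type_of (V, \<xi>, v0, \<gamma>) \<and>
        \<Delta>' = special_type_of (W1, \<xi>, v0, \<gamma>) \<and>
        \<tau> = type_of (\<xi>, W2, \<gamma>))"

definition indecomposable_special_type :: "'a::real_vector triple set \<Rightarrow> bool" where
  "indecomposable_special_type \<Delta> \<longleftrightarrow>
     \<Delta> \<in> special_types \<and> \<not> (\<exists>\<Delta>' \<tau>. is_special_sum \<Delta> \<Delta>' \<tau>)"

definition is_special_sum_list ::
  "'a::real_vector triple set \<Rightarrow> 'a triple set \<Rightarrow> 'a pair set list \<Rightarrow> bool" where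
  "is_special_sum_list \<Delta> \<Delta>0 \<tau>s \<longleftrightarrow>
     (if \<tau>s = [] then \<Delta> = \<Delta>0
      else (\<exists>\<tau>. is_type_sum_list \<tau> \<tau>s \<and> is_special_sum \<Delta> \<Delta>0 \<tau>))"

definition indecomposable_decomposition ::
  "'a::real_vector triple set \<Rightarrow> 'a triple set \<Rightarrow> 'a pair set list \<Rightarrow> bool" where
  "indecomposable_decomposition \<Delta> \<Delta>0 \<tau>s \<longleftrightarrow>
     indecomposable_special_type \<Delta>0 \<and> nilpotent_special_type \<Delta>0 \<and>
     (\<forall>\<tau>\<in>set \<tau>s. indecomposable_type \<tau>) \<and>
     is_special_sum_list \<Delta> \<Delta>0 \<tau>s"

end

theory Submission
  imports Defs "HOL-Computational_Algebra.Fundamental_Theorem_Algebra"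
begin

text \<open>
  Existence: split off summands of minimal dimension; by the Fitting decomposition of \<open>\<xi>\<close>, which is
  orthogonal because \<open>\<xi>\<close> is skew, an indecomposable special type is nilpotent.

  Uniqueness: let \<open>V = W1 + W2 = U1 + U2\<close> be two orthogonal \<open>\<xi>\<close>-invariant decompositions, with
  projections \<open>q\<close> onto \<open>W1\<close> and \<open>p\<close> onto \<open>U1\<close>. Then \<open>B = q p\<close> is a self-adjoint endomorphism of
  \<open>W1\<close> commuting with \<open>\<xi>\<close>. If \<open>B\<close> has a square root \<open>C\<close> among its polynomials such that \<open>C\<close> and
  \<open>1 + C\<close> are invertible, and \<open>p\<close> maps \<open>W1\<close> onto \<open>U1\<close>, then \<open>p C\<^sup>-\<^sup>1\<close> is an isometry from \<open>W1\<close> to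
  \<open>U1\<close>, and it extends to a reflection of \<open>V\<close>, which induces an isometry from \<open>W2\<close> to \<open>U2\<close>. Fitting
  decompositions show that self-adjoint endomorphisms of an indecomposable space commuting with \<open>\<xi>\<close>
  are nilpotent or invertible, and that the square root exists unless \<open>B\<close> is the sum of a
  nonpositive scalar and a nilpotent map. For types, \<open>U1\<close> runs through the summands of a second
  decomposition; the maps \<open>B\<close> add up to the identity of \<open>W1\<close>, so by comparing traces one of them
  has a square root, and one concludes by induction. For special types with \<open>W1\<close> and \<open>U1\<close>
  indecomposable, \<open>B\<close> fixes \<open>v\<^sup>0\<close>, so \<open>B - 1\<close> is nilpotent.
\<close>

section \<open>Linear maps on subspaces\<close>

text \<open>The isometry comes from a polar decomposition: for \<open>x\<close>, \<open>y\<close> in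
  \<open>W1\<close> one has \<open>\<gamma> (p x) (p y) = \<gamma> (B x) y\<close>, so a root of
  \<open>B\<close> measures how far \<open>p\<close> is from preserving the form. On the vectors
  \<open>x + p (C\<^sup>-\<^sup>1 x)\<close> the form is \<open>2 \<gamma> ((1 + C) x) y\<close>;
  invertibility of \<open>1 + C\<close> is what makes the orthogonal projection behind the
  reflection exist.

  The obstacle is a sign. If \<open>B\<close> is merely invertible, \<open>p\<close> still
  identifies the two summands as spaces with an endomorphism, but it may spoil the form: for
  \<open>B = -1\<close> it reverses it, and a space and its copy with the opposite form may have
  different types. So the partner of \<open>W1\<close> is not chosen by invertibility alone;
  positivity of the trace of the identity provides one for which \<open>B\<close> has no eigenvalue
  \<open>c <= 0\<close>. Non-real eigenvalues do no harm, as they always have square roots that are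
  real polynomials in \<open>B\<close>.\<close>

lemma linear_onD:
  assumes "linear_on V W f"
  shows "u \<in> V \<Longrightarrow> f u \<in> W"
    and "u \<in> V \<Longrightarrow> v \<in> V \<Longrightarrow> f (u + v) = f u + f v"
    and "u \<in> V \<Longrightarrow> f (c *\<^sub>R u) = c *\<^sub>R f u"
  using assms by (auto simp: linear_on_def)

lemma linear_on_0:
  assumes "linear_on V W f" "subspace V"
  shows "f 0 = 0"
  using linear_onD(3)[OF assms(1) subspace_0[OF assms(2)], of 0] by simp

lemma linear_on_diff:
  assumes "linear_on V W f" "subspace V" "u \<in> V" "v \<in> V"
  shows "f (u - v) = f u - f v"
proof -
  have "f (u + (- 1) *\<^sub>R v) = f u + (- 1) *\<^sub>R f v"
    using assms linear_onD[OF assms(1)] subspace_scale[OF assms(2)] by metis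
  then show ?thesis by simp
qed

lemma linear_on_sum:
  assumes "linear_on V W f" "subspace V" "\<And>i. i \<in> I \<Longrightarrow> g i \<in> V"
  shows "f (\<Sum>i\<in>I. g i) = (\<Sum>i\<in>I. f (g i))"
  using assms(3)
proof (induction I rule: infinite_finite_induct)
  case (insert i I)
  have "(\<Sum>i\<in>I. g i) \<in> V"
    using insert.prems by (intro subspace_sum assms(2)) simp
  then show ?case using insert linear_onD(2)[OF assms(1)] by simp
qed (auto simp: linear_on_0[OF assms(1,2)])

lemma linear_on_subset:
  "linear_on V W f \<Longrightarrow> V' \<subseteq> V \<Longrightarrow> W \<subseteq> W' \<Longrightarrow> linear_on V' W' f"
  unfolding linear_on_def by blast

lemma linear_on_range:
  "linear_on V W f \<Longrightarrow> f ` V \<subseteq> W' \<Longrightarrow> linear_on V W' f"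
  by (auto simp: linear_on_def)

lemma linear_on_comp:
  "linear_on V W f \<Longrightarrow> linear_on W X g \<Longrightarrow> linear_on V X (\<lambda>x. g (f x))"
  by (auto simp: linear_on_def)

lemma linear_on_plus:
  assumes "linear_on V W f" "linear_on V W g" "subspace W"
  shows "linear_on V W (\<lambda>x. f x + g x)"
  unfolding linear_on_def
  by (simp add: linear_onD[OF assms(1)] linear_onD[OF assms(2)] subspace_add[OF assms(3)] algebra_simps)

lemma linear_on_minus:
  assumes "linear_on V W f" "linear_on V W g" "subspace W"
  shows "linear_on V W (\<lambda>x. f x - g x)"
  unfolding linear_on_def
  by (simp add: linear_onD[OF assms(1)] linear_onD[OF assms(2)] subspace_diff[OF assms(3)] algebra_simps)

lemma linear_on_ident: "V \<subseteq> W \<Longrightarrow> linear_on V W (\<lambda>x. x)"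
  unfolding linear_on_def by blast

lemma subspace_image_on:
  assumes "linear_on V W f" "subspace V"
  shows "subspace (f ` V)"
proof (rule subspaceI)
  show "0 \<in> f ` V"
    using linear_on_0[OF assms] subspace_0[OF assms(2)] by (metis imageI)
  show "x + y \<in> f ` V" if "x \<in> f ` V" "y \<in> f ` V" for x y
    using that linear_onD(2)[OF assms(1)] subspace_add[OF assms(2)]
    by (auto simp: image_iff) metis
  show "c *\<^sub>R x \<in> f ` V" if "x \<in> f ` V" for c x
    using that linear_onD(3)[OF assms(1)] subspace_scale[OF assms(2)]
    by (auto simp: image_iff) metis
qed

lemma subspace_kernel_on:
  assumes "linear_on V W f" "subspace V"
  shows "subspace {x \<in> V. f x = 0}"
  using assms linear_on_0[OF assms] linear_onD[OF assms(1)]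
  by (auto simp: subspace_def)

section \<open>Bases and dimension of carriers\<close>

lemma fin_dim_space_obtain_basis:
  assumes "fin_dim_space V"
  obtains B where "finite B" "independent B" "span B = V" "card B = dim V"
proof -
  from assms obtain A where A: "subspace V" "finite A" "span A = V"
    by (auto simp: fin_dim_space_def)
  obtain B where B: "B \<subseteq> V" "independent B" "V \<subseteq> span B" "card B = dim V"
    using basis_exists by blast
  then have "finite B" using independent_span_bound[of A B] A by auto
  moreover have "span B = V" using B A by (simp add: span_minimal subset_antisym)
  ultimately show thesis using B that by blast
qed

lemma fin_dim_space_subset:
  assumes "fin_dim_space V" "subspace W" "W \<subseteq> V"
  shows "fin_dim_space W"
proof -
  obtain A where A: "finite A" "span A = V"
    using assms by (auto simp: fin_dim_space_def)
  obtain B where B: "B \<subseteq> W" "independent B" "W \<subseteq> span B"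
    using maximal_independent_subset[of W] by blast
  then have "finite B" using independent_span_bound[of A B] A assms(3) by auto
  moreover have "span B = W" using B assms(2) by (simp add: span_minimal subset_antisym)
  ultimately show ?thesis using assms(2) unfolding fin_dim_space_def by blast
qed

lemma dim_less:
  assumes "fin_dim_space V" "subspace W" "W \<subset> V"
  shows "dim W < dim V"
proof -
  obtain B where B: "finite B" "independent B" "span B = W" "card B = dim W"
    using fin_dim_space_obtain_basis[OF fin_dim_space_subset[OF assms(1,2)]] assms(3) by blast
  obtain C where C: "finite C" "independent C" "span C = V" "card C = dim V"
    using fin_dim_space_obtain_basis[OF assms(1)] by blast
  obtain x where x: "x \<in> V" "x \<notin> W" using assms by blast
  have "independent (insert x B)" using B x by (simp add: independent_insert)
  moreover have "insert x B \<subseteq> span C" using x B C assms span_superset by fastforce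
  ultimately have "card (insert x B) \<le> card C" using independent_span_bound C by blast
  moreover have "x \<notin> B" using x B span_superset by blast
  ultimately show ?thesis using B C by simp
qed

section \<open>Polynomials in an endomorphism\<close>

text \<open>Evaluation of \<open>p\<close> at the endomorphism \<open>f\<close>. It is written with
  iterates because \<open>f\<close> is a total function that is linear only on a carrier;
  compatibility with products therefore needs the locale \<open>endo\<close>.\<close>

definition papp :: "real poly \<Rightarrow> ('a::real_vector \<Rightarrow> 'a) \<Rightarrow> 'a \<Rightarrow> 'a" where
  "papp p f x = (\<Sum>i\<le>degree p. coeff p i *\<^sub>R (f ^^ i) x)"

lemma papp_atMost:
  assumes "degree p \<le> n"
  shows "papp p f x = (\<Sum>i\<le>n. coeff p i *\<^sub>R (f ^^ i) x)"
  unfolding papp_def using assms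
  by (intro sum.mono_neutral_left) (auto simp: coeff_eq_0)

lemma papp_0 [simp]: "papp 0 f x = 0"
  by (simp add: papp_def)

lemma papp_1 [simp]: "papp 1 f x = x"
  by (simp add: papp_def)

lemma papp_add: "papp (p + q) f x = papp p f x + papp q f x"
proof -
  let ?n = "max (degree p) (degree q)"
  have "degree (p + q) \<le> ?n" by (rule degree_add_le_max)
  then show ?thesis
    by (simp add: papp_atMost[of _ ?n] scaleR_add_left sum.distrib)
qed

lemma papp_smult: "papp (smult c p) f x = c *\<^sub>R papp p f x"
  using degree_smult_le[of c p]
  by (simp add: papp_atMost[of _ "degree p"] scaleR_sum_right)

lemma papp_minus: "papp (- p) f x = - papp p f x"
  using papp_smult[of "-1" p] by simp

lemma papp_diff: "papp (p - q) f x = papp p f x - papp q f x"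
  using papp_add[of p "- q"] by (simp add: papp_minus)

lemma papp_monom: "papp (monom c n) f x = c *\<^sub>R (f ^^ n) x"
proof -
  have "papp (monom c n) f x = (\<Sum>i\<le>n. if i = n then c *\<^sub>R (f ^^ n) x else 0)"
    unfolding papp_atMost[OF degree_monom_le] by (intro sum.cong) auto
  then show ?thesis by simp
qed

lemma papp_sum: "papp (\<Sum>i\<in>I. g i) f x = (\<Sum>i\<in>I. papp (g i) f x)"
  by (induction I rule: infinite_finite_induct) (auto simp: papp_add)

locale endo =
  fixes V :: "'a::real_vector set" and f :: "'a \<Rightarrow> 'a"
  assumes sub: "subspace V" and lin: "linear_on V V f"
begin

lemma funpow_in: "x \<in> V \<Longrightarrow> (f ^^ n) x \<in> V"
  by (induction n) (auto intro: linear_onD(1)[OF lin])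

lemma papp_in: "x \<in> V \<Longrightarrow> papp p f x \<in> V"
  unfolding papp_def by (intro subspace_sum sub subspace_scale funpow_in)

text \<open>Horner's rule, the recursion behind the inductions on polynomials below.\<close>

lemma papp_pCons:
  assumes "x \<in> V"
  shows "papp (pCons a p) f x = a *\<^sub>R x + f (papp p f x)"
proof -
  have "papp (pCons a p) f x =
      (\<Sum>i\<le>Suc (degree p). coeff (pCons a p) i *\<^sub>R (f ^^ i) x)"
    by (rule papp_atMost[OF degree_pCons_le])
  also have "\<dots> = a *\<^sub>R x + (\<Sum>i\<le>degree p. coeff p i *\<^sub>R f ((f ^^ i) x))"
    by (subst sum.atMost_Suc_shift) simp
  also have "(\<Sum>i\<le>degree p. coeff p i *\<^sub>R f ((f ^^ i) x)) = f (papp p f x)"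
    unfolding papp_def using assms
    by (subst linear_on_sum[OF lin sub])
      (auto simp: linear_onD(3)[OF lin] funpow_in intro: subspace_scale[OF sub])
  finally show ?thesis .
qed

lemma papp_X: "x \<in> V \<Longrightarrow> papp [:0, 1:] f x = f x"
  using papp_pCons[of x 0 1] by (simp add: one_pCons[symmetric])

lemma linear_papp: "linear_on V V (papp p f)"
proof (induction p)
  case 0
  then show ?case by (simp add: linear_on_def subspace_0 sub)
next
  case (pCons a p)
  show ?case
    unfolding linear_on_def
    using linear_onD[OF pCons.IH] linear_onD[OF lin] subspace_add[OF sub] subspace_scale[OF sub]
    by (auto simp: papp_pCons algebra_simps papp_in)
qed

lemma papp_mult: "x \<in> V \<Longrightarrow> papp (p * q) f x = papp p f (papp q f x)"
proof (induction p)
  case (pCons a p)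
  have "papp (pCons a p * q) f x = a *\<^sub>R papp q f x + f (papp (p * q) f x)"
    using pCons.prems by (simp add: papp_add papp_smult papp_pCons)
  then show ?case using pCons by (simp add: papp_pCons papp_in)
qed simp

lemma papp_power: "x \<in> V \<Longrightarrow> papp (p ^ n) f x = (papp p f ^^ n) x"
proof (induction n)
  case (Suc n)
  then show ?case by (simp add: papp_mult)
qed simp

lemma papp_X_power: "x \<in> V \<Longrightarrow> papp ([:0, 1:] ^ n) f x = (f ^^ n) x"
  by (induction n) (simp_all add: papp_mult papp_in papp_X papp_pCons funpow_in)

lemma papp_dvd_0:
  assumes "p dvd q" "x \<in> V" "papp p f x = 0"
  shows "papp q f x = 0"
proof -
  from assms(1) obtain r where "q = r * p" by (metis dvdE mult.commute)
  then show ?thesis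
    using assms papp_mult[of x r p] linear_on_0[OF linear_papp sub] by simp
qed

text \<open>Turns a congruence modulo an annihilating polynomial into an identity of operators.
  Inverses and square roots are computed among polynomials and carried over to vectors in this
  way.\<close>

lemma papp_dvd_cong:
  assumes "p dvd q - r" "x \<in> V" "papp p f x = 0"
  shows "papp q f x = papp r f x"
  using papp_dvd_0[OF assms] by (simp add: papp_diff)

lemma papp_eigen:
  assumes "x \<in> V" "f x = c *\<^sub>R x"
  shows "papp p f x = poly p c *\<^sub>R x"
proof (induction p)
  case (pCons a p)
  then show ?case
    using assms by (simp add: papp_pCons linear_onD(3)[OF lin] algebra_simps)
qed simp

lemma papp_commute:
  assumes "linear_on V V g" "\<And>x. x \<in> V \<Longrightarrow> g (f x) = f (g x)" "x \<in> V"
  shows "g (papp p f x) = papp p f (g x)"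
proof (induction p)
  case 0
  then show ?case by (simp add: linear_on_0[OF assms(1) sub])
next
  case (pCons a p)
  have "g (a *\<^sub>R x + f (papp p f x)) = a *\<^sub>R g x + f (g (papp p f x))"
    using assms linear_onD[OF assms(1)] linear_onD[OF lin]
    by (simp add: papp_in subspace_scale[OF sub])
  then show ?case
    using assms(3) pCons linear_onD(1)[OF assms(1)] by (simp add: papp_pCons)
qed

lemma papp_commute_self: "x \<in> V \<Longrightarrow> papp p f (papp q f x) = papp q f (papp p f x)"
  by (metis mult.commute papp_mult)

text \<open>The inverses and square roots used later are polynomials in a self-adjoint map, and so
  inherit its compatibility with the form.\<close>

lemma papp_self_adjoint:
  assumes \<gamma>: "sym_bilinear_on V \<gamma>"
    and f: "\<And>x y. x \<in> V \<Longrightarrow> y \<in> V \<Longrightarrow> \<gamma> (f x) y = \<gamma> x (f y)"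
    and x: "x \<in> V" and y: "y \<in> V"
  shows "\<gamma> (papp p f x) y = \<gamma> x (papp p f y)"
  using y
proof (induction p arbitrary: y)
  case 0
  have "linear_on V UNIV (\<lambda>u. \<gamma> u y)" "linear_on V UNIV (\<gamma> x)"
    using \<gamma> x 0 unfolding sym_bilinear_on_def by auto
  from this[THEN linear_on_0, OF sub] show ?case by simp
next
  case (pCons a p)
  have l1: "linear_on V UNIV (\<lambda>u. \<gamma> u y)" and l2: "linear_on V UNIV (\<gamma> x)"
    using \<gamma> x pCons.prems unfolding sym_bilinear_on_def by auto
  have fy: "f y \<in> V" by (rule linear_onD(1)[OF lin pCons.prems])
  have "\<gamma> (papp (pCons a p) f x) y = a *\<^sub>R \<gamma> x y + \<gamma> (f (papp p f x)) y"
    using x pCons.prems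
    by (simp add: papp_pCons papp_in subspace_scale[OF sub] linear_onD[OF l1] linear_onD(1)[OF lin])
  also have "\<gamma> (f (papp p f x)) y = \<gamma> x (f (papp p f y))"
    using f[OF papp_in[OF x] pCons.prems] pCons.IH[OF fy]
      papp_commute[OF lin refl pCons.prems] by simp
  finally show ?case
    using x pCons.prems
    by (simp add: papp_pCons papp_in subspace_scale[OF sub] linear_onD[OF l2] linear_onD(1)[OF lin])
qed

end

section \<open>Annihilating polynomials\<close>

context endo
begin

text \<open>The first \<open>card B + 1\<close> iterates of \<open>x\<close> lie in the span of
  \<open>card B\<close> vectors; a relation between them is the polynomial.\<close>

lemma annihilating_poly_vector:
  assumes fd: "fin_dim_space V" and x: "x \<in> V"
  shows "\<exists>m. m \<noteq> 0 \<and> papp m f x = 0"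
proof -
  obtain B where B: "finite B" "span B = V" using fd by (auto simp: fin_dim_space_def)
  define v where "v i = (f ^^ i) x" for i
  define I where "I = {..card B}"
  show ?thesis
  \<comment> \<open>Coinciding iterates are already a relation, but one that the image set of
    \<open>v\<close> does not show; dependence of that set is used only for distinct
    iterates.\<close>
  proof (cases "inj_on v I")
    case False
    then obtain i j where ij: "i \<noteq> j" "v i = v j" by (auto simp: inj_on_def)
    have "coeff (monom 1 i - monom (1::real) j) i = 1" using ij(1) by simp
    then have "monom 1 i - monom (1::real) j \<noteq> 0" by (metis coeff_0 zero_neq_one)
    then show ?thesis using ij(2) unfolding v_def
      by (intro exI[of _ "monom 1 i - monom 1 j"]) (simp add: papp_diff papp_monom)
  next
    case True
    have "card (v ` I) = Suc (card B)" using True by (simp add: card_image I_def)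
    moreover have "v ` I \<subseteq> span B" using x funpow_in unfolding B v_def by auto
    ultimately have "dependent (v ` I)"
      using independent_span_bound[OF B(1), of "v ` I"] by (metis Suc_n_not_le_n)
    then obtain u w where u: "w \<in> v ` I" "u w \<noteq> 0" "(\<Sum>w\<in>v ` I. u w *\<^sub>R w) = 0"
      using dependent_finite[of "v ` I"] by (auto simp: I_def)
    define m where "m = (\<Sum>i\<in>I. monom (u (v i)) i)"
    have "papp m f x = (\<Sum>i\<in>I. u (v i) *\<^sub>R v i)"
      by (simp add: m_def papp_sum papp_monom v_def)
    also have "\<dots> = 0" using u(3) True by (simp add: sum.reindex)
    finally have m0: "papp m f x = 0" .
    from u obtain i where i: "i \<in> I" "w = v i" by auto
    have "coeff m i = (\<Sum>j\<in>I. if j = i then u (v i) else 0)"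
      unfolding m_def coeff_sum by (intro sum.cong) auto
    also have "\<dots> = u w" using i by (simp add: I_def)
    finally have "m \<noteq> 0" using u by auto
    with m0 show ?thesis by blast
  qed
qed

text \<open>The product of annihilators of finitely many spanning vectors kills all of them, and the
  vectors killed by it form a subspace.\<close>

lemma annihilating_poly:
  assumes fd: "fin_dim_space V"
  shows "\<exists>m. m \<noteq> 0 \<and> (\<forall>x\<in>V. papp m f x = 0)"
proof -
  obtain B where B: "finite B" "span B = V" using fd by (auto simp: fin_dim_space_def)
  have BV: "B \<subseteq> V" using B span_superset by blast
  have "\<exists>m. m \<noteq> 0 \<and> (\<forall>x\<in>S. papp m f x = 0)" if "finite S" "S \<subseteq> V" for S
    using that
  proof (induction S rule: finite_induct)
    case empty
    show ?case by (rule exI[of _ 1]) simp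
  next
    case (insert b S)
    then obtain m where m: "m \<noteq> 0" "\<forall>x\<in>S. papp m f x = 0" by auto
    obtain n where n: "n \<noteq> 0" "papp n f b = 0"
      using annihilating_poly_vector[OF fd] insert.prems by blast
    have "papp (m * n) f x = 0" if "x \<in> insert b S" for x
    proof -
      have xV: "x \<in> V" using that insert.prems by blast
      have "m dvd m * n" "n dvd m * n" by simp_all
      then show ?thesis using papp_dvd_0[OF _ xV] m n that by blast
    qed
    then show ?case using m n by (intro exI[of _ "m * n"]) auto
  qed
  from this[OF B(1) BV] obtain m where m: "m \<noteq> 0" "\<forall>x\<in>B. papp m f x = 0" by blast
  have "span B \<subseteq> {x \<in> V. papp m f x = 0}"
    using m(2) BV by (intro span_minimal subspace_kernel_on[OF linear_papp sub]) blast
  then have "\<forall>x\<in>V. papp m f x = 0" using B(2) by blast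
  with m(1) show ?thesis by blast
qed

end

text \<open>A multiple \<open>X^n m\<close> of the minimal polynomial, \<open>m 0 \<noteq> 0\<close>, splits the space into the part
  where \<open>f\<close> is nilpotent and the part where \<open>f\<close> has an inverse polynomial in \<open>f\<close>.\<close>

lemma (in endo) fitting:
  assumes "fin_dim_space V"
  obtains n u K I where
    "n > 0" "K = {x \<in> V. (f ^^ n) x = 0}"
    "subspace K" "subspace I" "V = {x + y |x y. x \<in> K \<and> y \<in> I}" "K \<inter> I = {0}"
    "\<And>x. x \<in> I \<Longrightarrow> \<exists>y\<in>V. x = (f ^^ n) y"
    "\<And>x. x \<in> I \<Longrightarrow> papp u f (f x) = x"
    "\<And>g. linear_on V V g \<Longrightarrow> (\<And>x. x \<in> V \<Longrightarrow> g (f x) = f (g x)) \<Longrightarrow> g ` K \<subseteq> K \<and> g ` I \<subseteq> I"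
proof -
  define X where "X = [:0, 1 :: real:]"
  have X_power: "papp (X ^ n) f x = (f ^^ n) x" if "x \<in> V" for x n
    using papp_X_power[OF that] by (simp only: X_def)
  have X_1: "papp X f x = f x" if "x \<in> V" for x
    using papp_X[OF that] by (simp only: X_def)
  obtain m0 where m0: "m0 \<noteq> 0" "\<And>x. x \<in> V \<Longrightarrow> papp m0 f x = 0"
    using annihilating_poly[OF assms] by blast
  obtain m where m: "m0 = X ^ order 0 m0 * m" "\<not> X dvd m"
    using order_decomp[OF m0(1), of 0] by (auto simp: X_def)
  \<comment> \<open>The successor keeps \<open>n\<close> positive even if 0 is not a root of
    \<open>m0\<close>, so that a vector killed by \<open>f\<close> is also killed by
    \<open>f ^^ n\<close>.\<close>
  define n where "n = Suc (order 0 m0)"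
  obtain c k where ck: "m = pCons c k" by (cases m)
  have c: "c \<noteq> 0"
  proof
    assume "c = 0"
    then have "m = X * k" using ck by (simp add: X_def)
    then show False using m(2) by (metis dvd_triv_left)
  qed
  \<comment> \<open>Since \<open>m = c + X k\<close>, the polynomial \<open>- k / c\<close> inverts
    \<open>X\<close> modulo \<open>m\<close>.\<close>
  define u where "u = smult (- 1 / c) k"
  have m_eq: "m = [:c:] + X * k" using ck by (simp add: X_def)
  have u: "m dvd X * u - 1"
  proof
    show "X * u - 1 = m * [:- 1 / c:]"
      unfolding u_def m_eq X_def using c by (simp add: algebra_simps one_pCons)
  qed
  have un: "m dvd u ^ n * X ^ n - 1"
  proof -
    have "X * u - 1 dvd (X * u) ^ n - 1 ^ n"
      by (simp only: power_one power_diff_1_eq dvd_triv_left)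
    then show ?thesis using u by (metis dvd_trans mult.commute power_mult_distrib power_one)
  qed
  then obtain v where v: "u ^ n * X ^ n - 1 = m * v" ..
  have ann: "papp (X ^ n * m) f x = 0" if "x \<in> V" for x
  proof -
    have "m0 dvd X ^ n * m" by (subst m(1)) (simp add: n_def)
    then show ?thesis using papp_dvd_0 m0(2) that by blast
  qed
  define K where "K = {x \<in> V. (f ^^ n) x = 0}"
  define I where "I = {x \<in> V. papp m f x = 0}"
  have K_eq: "K = {x \<in> V. papp (X ^ n) f x = 0}"
    unfolding K_def using X_power by auto
  have sK: "subspace K" and sI: "subspace I"
    unfolding K_eq I_def by (rule subspace_kernel_on[OF linear_papp sub])+
  have id: "papp (u ^ n * X ^ n) f x = x + papp (m * v) f x" if "x \<in> V" for x
    unfolding v[symmetric] by (simp add: papp_diff)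
  have part: "papp (m * v) f x = - x" if "x \<in> K" for x
  proof -
    have "papp (u ^ n * X ^ n) f x = 0"
      using that unfolding K_eq by (intro papp_dvd_0[where p = "X ^ n" and q = "u ^ n * X ^ n"]) auto
    then have "x + papp (m * v) f x = 0" using id[of x] that unfolding K_eq by simp
    then show ?thesis by (metis minus_unique)
  qed
  have partI: "papp (u ^ n * X ^ n) f x = x" if "x \<in> I" for x
  proof -
    have "papp (m * v) f x = 0"
      using that unfolding I_def by (intro papp_dvd_0[where p = m and q = "m * v"]) auto
    then show ?thesis using id[of x] that unfolding I_def by simp
  qed
  have sum: "V = {x + y |x y. x \<in> K \<and> y \<in> I}"
  proof (intro equalityI subsetI)
    fix x assume x: "x \<in> V"
    have "papp (X ^ n) f (papp (m * v) f x) = 0"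
      using x ann[of "papp v f x"]
      by (simp add: papp_mult[symmetric] papp_in mult.assoc)
    then have "- papp (m * v) f x \<in> K"
      using x papp_in subspace_neg[OF sub]
        linear_onD(3)[OF linear_papp[of "X ^ n"], where c = "-1" and u = "papp (m * v) f x"]
      unfolding K_eq by simp
    moreover have "papp m f (papp (u ^ n * X ^ n) f x) = 0"
    proof -
      have "papp m f (papp (u ^ n * X ^ n) f x) = papp (u ^ n * (X ^ n * m)) f x"
        using x by (metis mult.assoc mult.commute papp_mult)
      also have "\<dots> = 0" using papp_dvd_0[of "X ^ n * m"] ann x by simp
      finally show ?thesis .
    qed
    then have "papp (u ^ n * X ^ n) f x \<in> I" unfolding I_def using x papp_in by blast
    moreover have "x = - papp (m * v) f x + papp (u ^ n * X ^ n) f x"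
      using id[OF x] by simp
    ultimately show "x \<in> {x + y |x y. x \<in> K \<and> y \<in> I}" by blast
  next
    fix x assume "x \<in> {x + y |x y. x \<in> K \<and> y \<in> I}"
    then show "x \<in> V" unfolding K_def I_def using subspace_add[OF sub] by auto
  qed
  have int: "K \<inter> I = {0}"
  proof -
    have "x = 0" if "x \<in> K" "x \<in> I" for x
    proof -
      have "papp (m * v) f x = 0"
        using that(2) unfolding I_def by (intro papp_dvd_0[where p = m and q = "m * v"]) auto
      then show ?thesis using part[OF that(1)] by simp
    qed
    then show ?thesis using subspace_0[OF sK] subspace_0[OF sI] by auto
  qed
  have img: "\<exists>y\<in>V. x = (f ^^ n) y" if "x \<in> I" for x
  proof
    have xV: "x \<in> V" using that unfolding I_def by blast
    show "papp (u ^ n) f x \<in> V" using papp_in xV .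
    show "x = (f ^^ n) (papp (u ^ n) f x)"
      using partI[OF that] xV papp_in papp_mult X_power by (metis mult.commute)
  qed
  have inv: "papp u f (f x) = x" if "x \<in> I" for x
  proof -
    have xV: "x \<in> V" using that unfolding I_def by blast
    have "papp (X * u) f x = papp 1 f x"
      using papp_dvd_cong[OF u xV] that unfolding I_def by blast
    moreover have "papp (X * u) f x = papp u f (f x)"
      using xV by (metis mult.commute X_1 papp_mult)
    ultimately show ?thesis by simp
  qed
  \<comment> \<open>Both parts are kernels of polynomials in \<open>f\<close>, hence stable under
    every map that commutes with \<open>f\<close>.\<close>
  have inva: "g ` K \<subseteq> K \<and> g ` I \<subseteq> I"
    if g: "linear_on V V g" "\<And>x. x \<in> V \<Longrightarrow> g (f x) = f (g x)" for g
  proof -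
    have "papp q f (g x) = 0" if "x \<in> V" "papp q f x = 0" for q x
      using papp_commute[OF g that(1), of q] that(2) linear_on_0[OF g(1) sub] by simp
    then show ?thesis unfolding K_eq I_def using linear_onD(1)[OF g(1)] by blast
  qed
  show thesis
  proof (rule that[of n K I u])
    show "n > 0" by (simp add: n_def)
  qed (fact K_def sK sI sum int img inv inva)+
qed

text \<open>The remainder modulo the quadratic is a real polynomial \<open>x + y X\<close> that
  vanishes at the non-real number \<open>a + i b\<close>, so \<open>y b = 0\<close> and
  \<open>x + y a = 0\<close>.\<close>

lemma quadratic_dvd:
  fixes m :: "real poly"
  assumes "poly (map_poly of_real m) (Complex a b) = 0" "b \<noteq> 0"
  shows "[:a\<^sup>2 + b\<^sup>2, - 2 * a, 1:] dvd m"
proof -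
  let ?Q = "[:a\<^sup>2 + b\<^sup>2, - 2 * a, 1:]"
  let ?c = "map_poly (of_real :: real \<Rightarrow> complex)"
  have add: "?c (p + q) = ?c p + ?c q" for p q
    by (rule poly_eqI) (simp add: coeff_map_poly)
  have Q: "poly (?c ?Q) (Complex a b) = 0"
    by (simp add: map_poly_pCons complex_eq_iff power2_eq_square algebra_simps)
  have mult: "poly (?c (p * q)) z = poly (?c p) z * poly (?c q) z" for p q z
  proof (induction p)
    case (pCons x p)
    have "?c (smult x q) = smult (of_real x) (?c q)"
      by (rule poly_eqI) (simp add: coeff_map_poly)
    then show ?case using pCons by (simp add: add map_poly_pCons algebra_simps)
  qed simp
  have "m = ?Q * (m div ?Q) + m mod ?Q" by (simp only: mult_div_mod_eq)
  then have "poly (?c m) (Complex a b) = poly (?c (?Q * (m div ?Q))) (Complex a b) + poly (?c (m mod ?Q)) (Complex a b)"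
    by (metis add poly_add)
  then have r: "poly (?c (m mod ?Q)) (Complex a b) = 0" using assms(1) Q mult[of ?Q "m div ?Q"] by (metis add_0 mult_zero_left)
  have "degree (m mod ?Q) < 2 \<or> m mod ?Q = 0"
    using degree_mod_less[of ?Q m] by auto
  then have "degree (m mod ?Q) < 2" by auto
  then obtain x y where xy: "m mod ?Q = [:x, y:]"
  proof -
    assume d: "degree (m mod ?Q) < 2"
    obtain x p where p: "m mod ?Q = pCons x p" by (cases "m mod ?Q")
    then have "degree p = 0" using d by (cases "p = 0") auto
    then obtain y where "p = [:y:]" by (rule degree_eq_zeroE)
    then show thesis using p that by blast
  qed
  then have "y * b = 0" "x + y * a = 0"
    using r by (auto simp: map_poly_pCons complex_eq_iff algebra_simps)
  then have "m mod ?Q = 0" using xy assms(2) by simp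
  then show ?thesis by (simp add: dvd_eq_mod_eq_0)
qed

text \<open>The quadratic is \<open>(X - a)^2 + b^2\<close>, which treats real eigenvalues
  (\<open>b = 0\<close>) and conjugate pairs alike. A real factor belonging to a complex root is
  split off an annihilator of \<open>w\<close>: either the cofactor still annihilates
  \<open>w\<close> and has smaller degree, or it sends \<open>w\<close> to the wanted
  vector.\<close>

lemma (in endo) quadratic_kernel:
  assumes "fin_dim_space V" "V \<noteq> {0}"
  obtains a b w where "w \<in> V" "w \<noteq> 0" "papp [:a\<^sup>2 + b\<^sup>2, - 2 * a, 1:] f w = 0"
proof -
  obtain w where w: "w \<in> V" "w \<noteq> 0" using assms(2) subspace_0[OF sub] by auto
  obtain m where m: "m \<noteq> 0" "papp m f w = 0" using annihilating_poly_vector[OF assms(1) w(1)] by blast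
  have "\<exists>a b w. w \<in> V \<and> w \<noteq> 0 \<and> papp [:a\<^sup>2 + b\<^sup>2, - 2 * a, 1:] f w = 0"
    using m
  proof (induction "degree m" arbitrary: m rule: less_induct)
    case less
    have "degree m \<noteq> 0"
    proof
      assume "degree m = 0"
      then obtain c where "m = [:c:]" by (rule degree_eq_zeroE)
      then show False using less.prems w by (simp add: papp_def)
    qed
    then have "\<not> constant (poly (map_poly complex_of_real m))"
      by (simp add: constant_degree degree_map_poly)
    then obtain z where z: "poly (map_poly complex_of_real m) z = 0"
      using fundamental_theorem_of_algebra by blast
    obtain a b where ab: "z = Complex a b" by (cases z)
    \<comment> \<open>For a real root only \<open>X - a\<close> is known to divide \<open>m\<close>;
      the quadratic is then its square, so a vector killed by \<open>q\<close> is killed by the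
      quadratic too.\<close>
    obtain q where q: "q dvd m" "degree q > 0" "q dvd [:a\<^sup>2 + b\<^sup>2, - 2 * a, 1:]"
    proof (cases "b = 0")
      case True
      then have "poly (map_poly complex_of_real m) (of_real a) = 0" using z ab by (simp add: complex_of_real_def)
      moreover have "poly (map_poly complex_of_real p) (of_real a) = of_real (poly p a)" for p
        by (induction p) (simp_all add: map_poly_pCons)
      ultimately have "poly m a = 0" by simp
      then have "[:- a, 1:] dvd m" by (simp add: poly_eq_0_iff_dvd)
      moreover have "[:a\<^sup>2 + b\<^sup>2, - 2 * a, 1:] = [:- a, 1:] * [:- a, 1:]"
        using True by (simp add: power2_eq_square)
      then have "[:- a, 1:] dvd [:a\<^sup>2 + b\<^sup>2, - 2 * a, 1:]" by (metis dvd_triv_left)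
      ultimately show thesis by (intro that[of "[:- a, 1:]"]) simp_all
    next
      case False
      then show thesis using that[of "[:a\<^sup>2 + b\<^sup>2, - 2 * a, 1:]"] quadratic_dvd z ab by simp
    qed
    obtain m' where m': "m = q * m'" using q(1) ..
    show ?case
    proof (cases "papp m' f w = 0")
      case True
      have "degree m' < degree m"
        using m' q(2) less.prems by (simp add: degree_mult_eq)
      then show ?thesis using less.hyps True less.prems m' by auto
    next
      case False
      have "papp q f (papp m' f w) = 0"
        using less.prems m' w by (simp add: papp_mult)
      then have "papp [:a\<^sup>2 + b\<^sup>2, - 2 * a, 1:] f (papp m' f w) = 0"
        using papp_dvd_0[OF q(3)] papp_in w by blast
      then show ?thesis using False papp_in w by blast
    qed
  qed
  then show thesis using that by blast
qed

text \<open>Hensel lifting: a square root of \<open>X\<close> modulo \<open>Q\<close> is explicit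
  and is improved modulo higher powers of \<open>Q\<close>. The roots of \<open>Q\<close> are
  \<open>a + i b\<close> and \<open>a - i b\<close>, and the hypothesis excludes precisely a real
  root \<open>a <= 0\<close>.\<close>

lemma poly_sqrt_mod_quadratic_power:
  fixes a b :: real
  assumes "b \<noteq> 0 \<or> a > 0"
  defines "Q \<equiv> [:a\<^sup>2 + b\<^sup>2, - 2 * a, 1:]"
  shows "\<exists>p u. Q ^ k dvd p * p - [:0, 1:] \<and> Q ^ k dvd p * u - 1"
proof -
  define X where "X = [:0, 1 :: real:]"
  define r where "r = sqrt (a\<^sup>2 + b\<^sup>2)"
  have r2: "r * r = a\<^sup>2 + b\<^sup>2" unfolding r_def by simp
  have "r > 0"
    using assms(1) unfolding r_def by (auto simp: add_pos_nonneg add_nonneg_pos)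
  have "r + a > 0"
  proof (cases "b = 0")
    case True
    then show ?thesis using \<open>r > 0\<close> assms(1) by simp
  next
    case False
    then have "\<bar>a\<bar> < r" unfolding r_def by (intro real_less_rsqrt) simp
    then show ?thesis by linarith
  qed
  \<comment> \<open>From the formula \<open>(z + |z|) / sqrt (2 (|z| + Re z))\<close> for a square
    root of the complex number \<open>z\<close>, with \<open>X\<close>, \<open>r\<close>,
    \<open>a\<close> in place of \<open>z\<close>, \<open>|z|\<close>, \<open>Re z\<close>.\<close>
  define d where "d = sqrt (1 / (2 * (r + a)))"
  have d2: "d * d * (2 * (r + a)) = 1"
    using \<open>r + a > 0\<close> unfolding d_def by simp
  define p0 where "p0 = [:d * r, d:]"
  \<comment> \<open>Modulo \<open>Q\<close> one has \<open>X * (2 a - X) = r * r\<close>, so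
    \<open>w\<close> inverts \<open>X\<close>.\<close>
  define w where "w = [:2 * a / (r * r), - 1 / (r * r):]"
  have w: "Q dvd X * w - 1"
  proof
    show "X * w - 1 = Q * [:- 1 / (r * r):]"
      unfolding Q_def X_def w_def r2[symmetric] using \<open>r > 0\<close> by (simp add: one_pCons field_simps)
  qed
  have p0: "Q dvd p0 * p0 - X"
  proof
    show "p0 * p0 - X = Q * [:d * d:]"
      unfolding Q_def X_def p0_def r2[symmetric] using d2 by (simp add: algebra_simps)
  qed
  have main: "\<exists>p. Q ^ Suc k dvd p * p - X"
  proof (induction k)
    case 0
    then show ?case using p0 by auto
  next
    case (Suc k)
    then obtain p s where s: "p * p - X = Q ^ Suc k * s" by (auto elim: dvdE)
    have "Q dvd p * p - X" unfolding s by simp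
    then have "Q dvd (p * p - X) * w + (X * w - 1)" using w by (intro dvd_add dvd_mult2)
    then have inv: "Q dvd p * (p * w) - 1" by (simp add: algebra_simps)
    \<comment> \<open>Newton correction: \<open>t\<close> solves \<open>s + 2 p t = 0\<close> modulo
      \<open>Q\<close>, with \<open>p * w\<close> as the inverse of \<open>p\<close>; the improved
      root is \<open>p + Q ^ Suc k * t\<close>.\<close>
    define t where "t = smult (- 1 / 2) (s * (p * w))"
    have "s + (p * t + p * t) = - s * (p * (p * w) - 1)"
    proof -
      have "t + t = - (s * (p * w))"
        unfolding t_def by (rule poly_eqI) (simp only: coeff_add coeff_smult coeff_minus)
      then have "p * (t + t) = - (s * (p * (p * w)))" by (simp add: algebra_simps)
      then show ?thesis by (simp add: algebra_simps)
    qed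
    then have "Q dvd s + (p * t + p * t)" using inv by simp
    then have "Q ^ Suc (Suc k) dvd Q ^ Suc k * (s + (p * t + p * t))"
      by (metis dvd_refl mult_dvd_mono power_Suc2)
    moreover have "Q ^ Suc (Suc k) dvd Q ^ Suc k * Q ^ Suc k * (t * t)"
      by (rule dvd_mult2) (simp only: power_add[symmetric], rule le_imp_power_dvd, simp)
    ultimately have "Q ^ Suc (Suc k) dvd
        Q ^ Suc k * (s + (p * t + p * t)) + Q ^ Suc k * Q ^ Suc k * (t * t)"
      by (rule dvd_add)
    also have "Q ^ Suc k * (s + (p * t + p * t)) + Q ^ Suc k * Q ^ Suc k * (t * t) =
        (p + Q ^ Suc k * t) * (p + Q ^ Suc k * t) - X"
      using s by (simp add: algebra_simps del: power_Suc)
    finally show ?case by blast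
  qed
  obtain p where p: "Q ^ Suc k dvd p * p - X" using main by blast
  then have pk: "Q ^ k dvd p * p - X" using dvd_trans[OF le_imp_power_dvd[of k "Suc k" Q]] by simp
  \<comment> \<open>\<open>Q\<close> divides \<open>1 - X * w\<close>, so the \<open>k\<close>-th
    power of the latter vanishes modulo \<open>Q ^ k\<close>, while \<open>X\<close> divides
    \<open>1 - (1 - X * w) ^ k\<close>.\<close>
  have "\<exists>v. Q ^ k dvd X * v - 1"
  proof -
    have "Q ^ k dvd (1 - X * w) ^ k"
      using w by (intro dvd_power_same) (metis dvd_minus_iff minus_diff_eq)
    moreover have "X dvd 1 - (1 - X * w) ^ k"
    proof -
      have "(1 - X * w) - 1 dvd (1 - X * w) ^ k - 1"
        by (simp only: power_diff_1_eq dvd_triv_left)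
      then have "X * w dvd 1 - (1 - X * w) ^ k" by (simp add: dvd_diff_commute)
      then show ?thesis by (rule dvd_mult_left)
    qed
    then obtain v where "1 - (1 - X * w) ^ k = X * v" ..
    then have "X * v - 1 = - ((1 - X * w) ^ k)" by (simp add: algebra_simps)
    ultimately show ?thesis by (metis dvd_minus_iff)
  qed
  then obtain v where v: "Q ^ k dvd X * v - 1" by blast
  \<comment> \<open>Modulo \<open>Q ^ k\<close>, \<open>p * (p * v) = X * v = 1\<close>: the inverse
    of \<open>p\<close> is \<open>p * v\<close>.\<close>
  have "Q ^ k dvd (p * p - X) * v + (X * v - 1)" using pk v by (intro dvd_add dvd_mult2)
  then have "Q ^ k dvd p * (p * v) - 1" by (simp add: algebra_simps)
  then show ?thesis using pk unfolding X_def by blast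
qed

section \<open>The trace\<close>

definition trace_wrt :: "'a::real_vector set \<Rightarrow> ('a \<Rightarrow> 'a) \<Rightarrow> real" where
  "trace_wrt B f = (\<Sum>b\<in>B. representation B (f b) b)"

lemma sum_representation:
  assumes "finite B" "independent B" "v \<in> span B"
  shows "(\<Sum>b\<in>B. representation B v b *\<^sub>R b) = v"
  using real_vector.sum_representation_eq[OF assms(2,3,1) order_refl] .

lemma representation_linear_on:
  assumes "independent B" "span B = V" "linear_on V V f"
    "finite I" "\<And>i. i \<in> I \<Longrightarrow> v i \<in> V"
  shows "representation B (f (\<Sum>i\<in>I. c i *\<^sub>R v i)) b = (\<Sum>i\<in>I. c i * representation B (f (v i)) b)"
proof -
  have V: "subspace V" using assms(2) subspace_span by blast
  have "f (\<Sum>i\<in>I. c i *\<^sub>R v i) = (\<Sum>i\<in>I. c i *\<^sub>R f (v i))"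
    using linear_on_sum[OF assms(3) V, of I "\<lambda>i. c i *\<^sub>R v i"] assms(5)
      linear_onD(3)[OF assms(3)] subspace_scale[OF V] by simp
  moreover have "representation B (\<Sum>i\<in>I. c i *\<^sub>R f (v i)) b = (\<Sum>i\<in>I. c i * representation B (f (v i)) b)"
  proof -
    have "f (v i) \<in> span B" if "i \<in> I" for i
      using linear_onD(1)[OF assms(3) assms(5)[OF that]] assms(2) by simp
    then show ?thesis
      using assms(1) by (subst real_vector.representation_sum)
        (auto simp: real_vector.representation_scale intro: span_scale)
  qed
  ultimately show ?thesis by simp
qed

text \<open>The identity \<open>tr (M N) = tr (N M)\<close> in disguise: expand each
  \<open>b\<close> in \<open>C\<close>, exchange the two sums, and reassemble \<open>f c\<close>
  from its coordinates in \<open>B\<close>.\<close>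

lemma trace_wrt_unique:
  assumes B: "finite B" "independent B" "span B = V"
    and C: "finite C" "independent C" "span C = V" and f: "linear_on V V f"
  shows "trace_wrt B f = trace_wrt C f"
proof -
  have BV: "B \<subseteq> V" and CV: "C \<subseteq> V" using B C span_superset by blast+
  have "trace_wrt B f = (\<Sum>b\<in>B. representation B (f (\<Sum>c\<in>C. representation C b c *\<^sub>R c)) b)"
    unfolding trace_wrt_def using C BV by (intro sum.cong refl) (subst sum_representation, auto)
  also have "\<dots> = (\<Sum>b\<in>B. \<Sum>c\<in>C. representation C b c * representation B (f c) b)"
    using CV by (intro sum.cong refl representation_linear_on[OF B(2,3) f C(1)]) auto
  also have "\<dots> = (\<Sum>c\<in>C. \<Sum>b\<in>B. representation B (f c) b * representation C b c)"
    by (subst sum.swap) (simp add: mult.commute)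
  also have "\<dots> = (\<Sum>c\<in>C. representation C (\<Sum>b\<in>B. representation B (f c) b *\<^sub>R b) c)"
  proof (rule sum.cong[OF refl])
    fix c
    have id: "linear_on V V (\<lambda>x. x)" by (simp add: linear_on_def)
    show "(\<Sum>b\<in>B. representation B (f c) b * representation C b c) =
        representation C (\<Sum>b\<in>B. representation B (f c) b *\<^sub>R b) c"
      using representation_linear_on[OF C(2,3) id B(1), where v = "\<lambda>b. b"
          and c = "representation B (f c)" and b = c] BV by (simp add: subset_eq)
  qed
  also have "\<dots> = trace_wrt C f"
    unfolding trace_wrt_def using B CV linear_onD(1)[OF f]
    by (intro sum.cong refl) (subst sum_representation, auto)
  finally show ?thesis .
qed

text \<open>Induction on the dimension. The image of a nilpotent map is a proper subspace. In a
  basis \<open>D\<close> that extends a basis \<open>C\<close> of the image, diagonal entries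
  outside \<open>C\<close> vanish, and the others are those of the restriction of \<open>f\<close>
  to its image.\<close>

lemma trace_wrt_nilpotent:
  assumes "finite B" "independent B" "span B = V" "linear_on V V f"
    and "\<And>x. x \<in> V \<Longrightarrow> (f ^^ n) x = 0"
  shows "trace_wrt B f = 0"
  using assms
proof (induction "dim V" arbitrary: V B rule: less_induct)
  case less
  have V: "subspace V" "fin_dim_space V"
    using less.prems subspace_span by (auto simp: fin_dim_space_def)
  show ?case
  proof (cases "V = {0}")
    case True
    then have "B \<subseteq> {0}" using less.prems(3) span_superset by blast
    moreover have "0 \<notin> B" using less.prems(2) dependent_zero by blast
    ultimately have "B = {}" by blast
    then show ?thesis by (simp add: trace_wrt_def)
  next
    case False
    let ?I = "f ` V"
    have IV: "?I \<subseteq> V" using linear_onD(1)[OF less.prems(4)] by blast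
    have I: "subspace ?I" using subspace_image_on[OF less.prems(4) V(1)] .
    have "?I \<noteq> V"
    proof
      assume eq: "?I = V"
      have "(f ^^ k) ` V = V" for k
        by (induction k) (simp, simp only: funpow.simps image_comp[symmetric] eq)
      then have "V = (f ^^ n) ` V" by simp
      also have "\<dots> \<subseteq> {0}" using less.prems(5) by auto
      finally show False using False subspace_0[OF V(1)] by blast
    qed
    then have dim: "dim ?I < dim V" using dim_less[OF V(2) I] IV by blast
    have fdI: "fin_dim_space ?I" by (rule fin_dim_space_subset[OF V(2) I IV])
    obtain C where C: "finite C" "independent C" "span C = ?I"
      using fdI by (rule fin_dim_space_obtain_basis)
    have CV: "C \<subseteq> V" using C(3) span_superset[of C] IV by simp
    obtain D where D: "C \<subseteq> D" "D \<subseteq> V" "independent D" "V \<subseteq> span D"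
      using maximal_independent_subset_extend[OF CV C(2)] by blast
    have sD: "span D = V" using D V(1) by (simp add: span_minimal subset_antisym)
    have fD: "finite D"
      using independent_span_bound[OF less.prems(1) D(3)] D(2) less.prems(3) by simp
    have "trace_wrt B f = trace_wrt D f"
      using trace_wrt_unique[OF less.prems(1-3) fD D(3) sD less.prems(4)] .
    also have "\<dots> = (\<Sum>d\<in>D. representation C (f d) d)"
      unfolding trace_wrt_def
    proof (rule sum.cong[OF refl])
      fix d assume "d \<in> D"
      then have "f d \<in> span C" using C(3) D(2) by blast
      then show "representation D (f d) d = representation C (f d) d"
        using real_vector.representation_extend[OF D(3) _ D(1)] by metis
    qed
    also have "\<dots> = trace_wrt C f"
      unfolding trace_wrt_def
      by (rule sum.mono_neutral_right[OF fD D(1)]) (auto intro: real_vector.representation_ne_zero)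
    also have "\<dots> = 0"
    proof (rule less.hyps[OF dim C])
      show "linear_on ?I ?I f"
        by (rule linear_on_range[OF linear_on_subset[OF less.prems(4) IV order_refl]]) (use IV in auto)
    qed (use less.prems(5) IV in blast)
    finally show ?thesis .
  qed
qed

text \<open>Otherwise compare traces: \<open>c\<close> plus a nilpotent map has trace
  \<open>c * dim V <= 0\<close>, while the identity has trace \<open>dim V > 0\<close>.\<close>

lemma identity_not_sum_nonpositive:
  assumes V: "fin_dim_space V" "V \<noteq> {0}" and J: "finite J"
    and g: "\<And>j. j \<in> J \<Longrightarrow> linear_on V V (g j)"
    and id: "\<And>x. x \<in> V \<Longrightarrow> (\<Sum>j\<in>J. g j x) = x"
  shows "\<exists>j\<in>J. \<not> (\<exists>c n. c \<le> 0 \<and> (\<forall>x\<in>V. ((\<lambda>x. g j x - c *\<^sub>R x) ^^ n) x = 0))"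
proof (rule ccontr)
  assume "\<not> ?thesis"
  then obtain c n where c: "\<And>j. j \<in> J \<Longrightarrow> c j \<le> (0::real)"
    and n: "\<And>j x. j \<in> J \<Longrightarrow> x \<in> V \<Longrightarrow> ((\<lambda>x. g j x - c j *\<^sub>R x) ^^ n j) x = 0"
    by metis
  obtain B where B: "finite B" "independent B" "span B = V"
    using V(1) by (rule fin_dim_space_obtain_basis)
  have sub: "subspace V" using V(1) by (simp add: fin_dim_space_def)
  have BV: "B \<subseteq> V" using B span_superset by blast
  have "B \<noteq> {}" using B(3) V(2) by auto
  have rep1: "representation B b b = 1" if "b \<in> B" for b
    using real_vector.representation_basis[OF B(2) that] by simp
  have "(\<Sum>b\<in>B. representation B (g j b) b) = c j * card B" if j: "j \<in> J" for j
  proof -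
    have gV: "g j b \<in> V" if "b \<in> B" for b using linear_onD(1)[OF g[OF j]] that BV by blast
    have lin: "linear_on V V (\<lambda>x. g j x - c j *\<^sub>R x)"
      using linear_onD[OF g[OF j]] subspace_diff[OF sub] subspace_scale[OF sub]
      by (auto simp: linear_on_def algebra_simps)
    have "0 = (\<Sum>b\<in>B. representation B (g j b - c j *\<^sub>R b) b)"
      using trace_wrt_nilpotent[OF B lin n[OF j]] by (simp add: trace_wrt_def)
    also have "\<dots> = (\<Sum>b\<in>B. representation B (g j b) b - c j * representation B b b)"
    proof (intro sum.cong refl)
      fix b assume b: "b \<in> B"
      have "b \<in> span B" "g j b \<in> span B" using B(3) BV gV b by auto
      then show "representation B (g j b - c j *\<^sub>R b) b = representation B (g j b) b - c j * representation B b b"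
        using real_vector.representation_diff[OF B(2), of "c j *\<^sub>R b" "g j b"]
          real_vector.representation_scale[OF B(2)] by (simp add: span_scale)
    qed
    also have "\<dots> = (\<Sum>b\<in>B. representation B (g j b) b) - c j * card B"
      using rep1 by (simp add: sum_subtractf)
    finally show ?thesis by simp
  qed
  then have "(\<Sum>j\<in>J. \<Sum>b\<in>B. representation B (g j b) b) = (\<Sum>j\<in>J. c j * card B)" by simp
  also have "\<dots> \<le> 0" using c by (intro sum_nonpos mult_nonpos_nonneg) auto
  finally have "(\<Sum>b\<in>B. \<Sum>j\<in>J. representation B (g j b) b) \<le> 0" by (subst sum.swap)
  also have "(\<Sum>b\<in>B. \<Sum>j\<in>J. representation B (g j b) b) = (\<Sum>b\<in>B. representation B b b)"
  proof (intro sum.cong refl)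
    fix b assume b: "b \<in> B"
    then have bV: "b \<in> V" using BV by blast
    have "(\<Sum>j\<in>J. representation B (g j b) b) = representation B (\<Sum>j\<in>J. g j b) b"
      using g linear_onD(1) bV B(3) by (subst real_vector.representation_sum[OF B(2)]) blast+
    then show "(\<Sum>j\<in>J. representation B (g j b) b) = representation B b b" using id[OF bV] by simp
  qed
  also have "\<dots> = card B" using rep1 by simp
  finally show False using B(1) \<open>B \<noteq> {}\<close> by simp
qed

section \<open>Orthogonal sums and isometries\<close>

locale form =
  fixes V :: "'a::real_vector set" and \<gamma> :: "'a \<Rightarrow> 'a \<Rightarrow> real"
  assumes sub: "subspace V" and bil: "sym_bilinear_on V \<gamma>"
begin

lemma sym: "u \<in> V \<Longrightarrow> v \<in> V \<Longrightarrow> \<gamma> u v = \<gamma> v u"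
  using bil unfolding sym_bilinear_on_def by blast

lemma lin_left: "v \<in> V \<Longrightarrow> linear_on V UNIV (\<lambda>u. \<gamma> u v)"
  and lin_right: "u \<in> V \<Longrightarrow> linear_on V UNIV (\<gamma> u)"
  using bil unfolding sym_bilinear_on_def by blast+

lemma add_left: "u \<in> V \<Longrightarrow> v \<in> V \<Longrightarrow> w \<in> V \<Longrightarrow> \<gamma> (u + v) w = \<gamma> u w + \<gamma> v w"
  and add_right: "u \<in> V \<Longrightarrow> v \<in> V \<Longrightarrow> w \<in> V \<Longrightarrow> \<gamma> w (u + v) = \<gamma> w u + \<gamma> w v"
  and scale_left: "u \<in> V \<Longrightarrow> w \<in> V \<Longrightarrow> \<gamma> (c *\<^sub>R u) w = c * \<gamma> u w"
  and scale_right: "u \<in> V \<Longrightarrow> w \<in> V \<Longrightarrow> \<gamma> w (c *\<^sub>R u) = c * \<gamma> w u"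
  using linear_onD[OF lin_left] linear_onD[OF lin_right] by simp_all

lemma diff_left: "u \<in> V \<Longrightarrow> v \<in> V \<Longrightarrow> w \<in> V \<Longrightarrow> \<gamma> (u - v) w = \<gamma> u w - \<gamma> v w"
  and diff_right: "u \<in> V \<Longrightarrow> v \<in> V \<Longrightarrow> w \<in> V \<Longrightarrow> \<gamma> w (u - v) = \<gamma> w u - \<gamma> w v"
  using linear_on_diff[OF lin_left sub] linear_on_diff[OF lin_right sub] by simp_all

lemma zero_left: "w \<in> V \<Longrightarrow> \<gamma> 0 w = 0"
  and zero_right: "w \<in> V \<Longrightarrow> \<gamma> w 0 = 0"
  using linear_on_0[OF lin_left sub] linear_on_0[OF lin_right sub] by simp_all

end

lemma sym_bilinear_on_subset:
  assumes "sym_bilinear_on V \<gamma>" "W \<subseteq> V"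
  shows "sym_bilinear_on W \<gamma>"
  unfolding sym_bilinear_on_def
proof (intro conjI ballI)
  fix u v assume uv: "u \<in> W" "v \<in> W"
  then have V: "u \<in> V" "v \<in> V" using assms(2) by blast+
  show "linear_on W UNIV (\<lambda>v. \<gamma> u v)" "linear_on W UNIV (\<lambda>u. \<gamma> u v)" "\<gamma> u v = \<gamma> v u"
    using assms(1) V linear_on_subset[OF _ assms(2) order_refl] unfolding sym_bilinear_on_def by auto
qed

text \<open>Common ground of pairs and triples: nothing is asked of the kernel of the form, so
  orthogonal sums are studied once for both.\<close>

definition skew_space ::
  "('a::real_vector \<Rightarrow> 'a) \<Rightarrow> 'a set \<Rightarrow> ('a \<Rightarrow> 'a \<Rightarrow> real) \<Rightarrow> bool" where
  "skew_space \<xi> V \<gamma> \<longleftrightarrow>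
     fin_dim_space V \<and> sym_bilinear_on V \<gamma> \<and> linear_on V V \<xi> \<and> skew_on V \<gamma> \<xi>"

lemma skew_spaceD:
  assumes "skew_space \<xi> V \<gamma>"
  shows "fin_dim_space V" "subspace V" "sym_bilinear_on V \<gamma>" "linear_on V V \<xi>" "form V \<gamma>"
    and "u \<in> V \<Longrightarrow> v \<in> V \<Longrightarrow> \<gamma> (\<xi> u) v = - \<gamma> u (\<xi> v)"
  using assms
  by (auto simp: skew_space_def fin_dim_space_def form_def skew_on_def add_eq_0_iff2)

lemma skew_space_subset:
  assumes "skew_space \<xi> V \<gamma>" "subspace W" "W \<subseteq> V" "invariant_under \<xi> W"
  shows "skew_space \<xi> W \<gamma>"
  unfolding skew_space_def
proof (intro conjI)
  show "fin_dim_space W" "sym_bilinear_on W \<gamma>"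
    using assms fin_dim_space_subset sym_bilinear_on_subset unfolding skew_space_def by auto
  have "linear_on W V \<xi>"
    using assms(1,3) linear_on_subset[of V V \<xi> W V] unfolding skew_space_def by simp
  then show "linear_on W W \<xi>"
    using assms(4) linear_on_range unfolding invariant_under_def by auto
  show "skew_on W \<gamma> \<xi>"
    using assms(1,3) unfolding skew_space_def skew_on_def by blast
qed

definition inv_sum ::
  "('a::real_vector \<Rightarrow> 'a) \<Rightarrow> ('a \<Rightarrow> 'a \<Rightarrow> real) \<Rightarrow> 'a set \<Rightarrow> 'a set \<Rightarrow> 'a set \<Rightarrow> bool" where
  "inv_sum \<xi> \<gamma> V W1 W2 \<longleftrightarrow>
     orthogonal_sum \<gamma> V W1 W2 \<and> invariant_under \<xi> W1 \<and> invariant_under \<xi> W2"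

lemma inv_sumD:
  assumes "inv_sum \<xi> \<gamma> V W1 W2"
  shows "subspace W1" "subspace W2" "V = {x + y |x y. x \<in> W1 \<and> y \<in> W2}" "W1 \<inter> W2 = {0}"
    and "W1 \<subseteq> V" "W2 \<subseteq> V"
    and "x \<in> W1 \<Longrightarrow> y \<in> W2 \<Longrightarrow> \<gamma> x y = 0"
    and "x \<in> W1 \<Longrightarrow> \<xi> x \<in> W1" "x \<in> W2 \<Longrightarrow> \<xi> x \<in> W2"
    and "invariant_under \<xi> W1" "invariant_under \<xi> W2"
proof -
  show s: "subspace W1" "subspace W2" and V: "V = {x + y |x y. x \<in> W1 \<and> y \<in> W2}"
    and "W1 \<inter> W2 = {0}" "invariant_under \<xi> W1" "invariant_under \<xi> W2"
    and "x \<in> W1 \<Longrightarrow> y \<in> W2 \<Longrightarrow> \<gamma> x y = 0"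
    and "x \<in> W1 \<Longrightarrow> \<xi> x \<in> W1" "x \<in> W2 \<Longrightarrow> \<xi> x \<in> W2"
    using assms by (auto simp: inv_sum_def orthogonal_sum_def invariant_under_def)
  show "W1 \<subseteq> V"
  proof
    fix x assume "x \<in> W1"
    then show "x \<in> V" using subspace_0[OF s(2)] unfolding V
      by (intro CollectI exI[where x = x] exI[where x = 0]) simp
  qed
  show "W2 \<subseteq> V"
  proof
    fix x assume "x \<in> W2"
    then show "x \<in> V" using subspace_0[OF s(1)] unfolding V
      by (intro CollectI exI[where x = 0] exI[where x = x]) simp
  qed
qed

lemma inv_sum_skew_space:
  assumes "skew_space \<xi> V \<gamma>" "inv_sum \<xi> \<gamma> V W1 W2"
  shows "skew_space \<xi> W1 \<gamma>" "skew_space \<xi> W2 \<gamma>"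
  using skew_space_subset[OF assms(1)] inv_sumD[OF assms(2)] by blast+

lemma inv_sum_commute:
  assumes "skew_space \<xi> V \<gamma>" "inv_sum \<xi> \<gamma> V W1 W2"
  shows "inv_sum \<xi> \<gamma> V W2 W1"
proof -
  interpret form V \<gamma> using skew_spaceD(5)[OF assms(1)] .
  note S = inv_sumD[OF assms(2)]
  have "\<gamma> y x = 0" if "x \<in> W1" "y \<in> W2" for x y
    using S(7)[OF that] sym S(5,6) that by (metis subsetD)
  moreover have "V = {x + y |x y. x \<in> W2 \<and> y \<in> W1}"
  proof (rule set_eqI)
    fix v
    have "v \<in> V \<longleftrightarrow> (\<exists>x y. v = x + y \<and> x \<in> W1 \<and> y \<in> W2)" by (subst S(3)) blast
    also have "\<dots> \<longleftrightarrow> (\<exists>x y. v = y + x \<and> x \<in> W1 \<and> y \<in> W2)" by (simp add: add.commute)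
    finally show "v \<in> V \<longleftrightarrow> v \<in> {x + y |x y. x \<in> W2 \<and> y \<in> W1}" by auto
  qed
  moreover have "W2 \<inter> W1 = {0}" using S(4) by blast
  ultimately show ?thesis
    unfolding inv_sum_def orthogonal_sum_def using S(1,2,10,11) by simp
qed

lemma inv_sum_trivial:
  assumes "skew_space \<xi> V \<gamma>"
  shows "inv_sum \<xi> \<gamma> V V {0}"
proof -
  interpret form V \<gamma> using skew_spaceD(5)[OF assms] .
  show ?thesis
    unfolding inv_sum_def orthogonal_sum_def
    using zero_right subspace_0[OF sub] linear_on_0[OF skew_spaceD(4)[OF assms] sub] sub
      linear_onD(1)[OF skew_spaceD(4)[OF assms]]
    by (auto simp: invariant_under_def)
qed

text \<open>Pairing a vector of \<open>W1\<close> with \<open>W2\<close> always gives 0, so testing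
  against \<open>V\<close> is the same as testing against \<open>W1\<close>.\<close>

lemma inv_sum_kernel:
  assumes "skew_space \<xi> V \<gamma>" "inv_sum \<xi> \<gamma> V W1 W2"
  shows "form_kernel W1 \<gamma> = form_kernel V \<gamma> \<inter> W1"
proof -
  interpret form V \<gamma> using skew_spaceD(5)[OF assms(1)] .
  note S = inv_sumD[OF assms(2)]
  have "\<gamma> x (y + z) = \<gamma> x y" if "x \<in> W1" "y \<in> W1" "z \<in> W2" for x y z
    using that S(5,6,7) by (simp add: add_right subsetD)
  then have "(\<forall>v\<in>V. \<gamma> x v = 0) \<longleftrightarrow> (\<forall>v\<in>W1. \<gamma> x v = 0)" if "x \<in> W1" for x
  proof (intro iffI ballI)
    fix v assume "\<forall>v\<in>W1. \<gamma> x v = 0" "v \<in> V"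
    moreover obtain y z where "v = y + z" "y \<in> W1" "z \<in> W2" using \<open>v \<in> V\<close> S(3) by blast
    ultimately show "\<gamma> x v = 0"
      using \<open>\<And>z y x. \<lbrakk>x \<in> W1; y \<in> W1; z \<in> W2\<rbrakk> \<Longrightarrow> \<gamma> x (y + z) = \<gamma> x y\<close> that by simp
  qed (use S(5) in blast)
  then show ?thesis unfolding form_kernel_def using S(5) by blast
qed

text \<open>Re-bracketing of \<open>(A + A') + W2\<close> as \<open>A + (A' + W2)\<close>; in
  particular a summand of a summand is a summand.\<close>

lemma inv_sum_assoc:
  assumes V: "skew_space \<xi> V \<gamma>" and W: "inv_sum \<xi> \<gamma> V W1 W2" and A: "inv_sum \<xi> \<gamma> W1 A A'"
  defines "R \<equiv> {x + y |x y. x \<in> A' \<and> y \<in> W2}"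
  shows "inv_sum \<xi> \<gamma> V A R" "inv_sum \<xi> \<gamma> R A' W2"
proof -
  interpret form V \<gamma> using skew_spaceD(5)[OF V] .
  note S = inv_sumD[OF W] and T = inv_sumD[OF A]
  have sR: "subspace R" unfolding R_def using subspace_sums[OF T(2) S(2)] .
  have AV: "A \<subseteq> V" "A' \<subseteq> V" using S(5) T(5,6) by simp_all
  have inR: "\<xi> ` R \<subseteq> R"
  proof -
    have "\<xi> (x + y) \<in> R" if "x \<in> A'" "y \<in> W2" for x y
    proof -
      have "\<xi> (x + y) = \<xi> x + \<xi> y"
        using that AV S(6) linear_onD(2)[OF skew_spaceD(4)[OF V]] by (simp add: subsetD)
      then show ?thesis unfolding R_def using S(9) T(9) that by blast
    qed
    then show ?thesis unfolding R_def by blast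
  qed
  show "inv_sum \<xi> \<gamma> R A' W2"
  proof -
    have "A' \<inter> W2 = {0}"
      using S(4) T(6) subspace_0[OF S(2)] subspace_0[OF T(2)] by blast
    moreover have "\<gamma> x y = 0" if "x \<in> A'" "y \<in> W2" for x y
      using S(7) T(6) that by (simp add: subsetD)
    ultimately show ?thesis
      unfolding inv_sum_def orthogonal_sum_def using S(2,11) T(2,11) R_def by simp
  qed
  have "V = {x + y |x y. x \<in> A \<and> y \<in> R}"
  proof (intro equalityI subsetI)
    fix v assume "v \<in> V"
    then obtain x y where "v = x + y" "x \<in> W1" "y \<in> W2" using S(3) by blast
    moreover then obtain a a' where "x = a + a'" "a \<in> A" "a' \<in> A'" using T(3) by blast
    ultimately have "v = a + (a' + y)" "a \<in> A" "a' + y \<in> R" by (auto simp: R_def)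
    then show "v \<in> {x + y |x y. x \<in> A \<and> y \<in> R}" by blast
  next
    fix v assume "v \<in> {x + y |x y. x \<in> A \<and> y \<in> R}"
    then obtain a x y where "v = a + (x + y)" "a \<in> A" "x \<in> A'" "y \<in> W2" unfolding R_def by blast
    then show "v \<in> V" using AV S(6) by (simp add: subsetD subspace_add[OF sub])
  qed
  moreover have "A \<inter> R = {0}"
  proof -
    have "a = 0" if "a \<in> A" "a = x + y" "x \<in> A'" "y \<in> W2" for a x y
    proof -
      have "a - x \<in> W1" using that(1,3) T(5,6) by (intro subspace_diff[OF S(1)]) auto
      moreover have "a - x = y" using that by simp
      ultimately have "y = 0" using that S(4) by blast
      then show ?thesis using that T(4) by auto
    qed
    then show ?thesis using subspace_0[OF sR] subspace_0[OF T(1)] unfolding R_def by blast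
  qed
  moreover have "\<gamma> a r = 0" if ar: "a \<in> A" "r \<in> R" for a r
  proof -
    obtain x y where xy: "r = x + y" "x \<in> A'" "y \<in> W2" using ar unfolding R_def by blast
    have "\<gamma> a r = \<gamma> a x + \<gamma> a y" using xy ar AV S(6) by (simp add: add_right subsetD)
    also have "\<dots> = 0" using T(7) S(7) T(5) ar xy by (simp add: subsetD)
    finally show ?thesis .
  qed
  ultimately show "inv_sum \<xi> \<gamma> V A R"
    unfolding inv_sum_def orthogonal_sum_def using T(1,10) sR inR by (simp add: invariant_under_def)
qed

definition proj :: "'a::real_vector set \<Rightarrow> 'a set \<Rightarrow> 'a \<Rightarrow> 'a" where
  "proj W1 W2 x = (THE y. y \<in> W1 \<and> x - y \<in> W2)"

locale sum_decomp =
  fixes \<xi> :: "'a::real_vector \<Rightarrow> 'a" and \<gamma> V W1 W2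
  assumes space: "skew_space \<xi> V \<gamma>" and sum: "inv_sum \<xi> \<gamma> V W1 W2"
begin

lemmas sumD = inv_sumD[OF sum]

lemma proj_eq:
  assumes "y \<in> W1" "z \<in> W2"
  shows "proj W1 W2 (y + z) = y"
  unfolding proj_def
proof (rule the_equality)
  show "y \<in> W1 \<and> y + z - y \<in> W2" using assms by simp
  fix y' assume y': "y' \<in> W1 \<and> y + z - y' \<in> W2"
  then have "(y + z - y') - z \<in> W2" using subspace_diff[OF sumD(2)] assms by blast
  then have "y - y' \<in> W2" by simp
  moreover have "y - y' \<in> W1" using subspace_diff[OF sumD(1)] assms y' by blast
  ultimately have "y - y' = 0" using sumD(4) by blast
  then show "y' = y" by simp
qed

lemma proj_in: "x \<in> V \<Longrightarrow> proj W1 W2 x \<in> W1" "x \<in> V \<Longrightarrow> x - proj W1 W2 x \<in> W2"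
  using proj_eq sumD(3) by force+

lemma proj_id: "x \<in> W1 \<Longrightarrow> proj W1 W2 x = x"
  using proj_eq[of x 0] subspace_0[OF sumD(2)] by simp

lemma proj_0: "x \<in> W2 \<Longrightarrow> proj W1 W2 x = 0"
  using proj_eq[of 0 x] subspace_0[OF sumD(1)] by simp

lemma linear_proj: "linear_on V W1 (proj W1 W2)"
  unfolding linear_on_def
proof (intro conjI ballI allI)
  fix u v c assume u: "u \<in> V"
  show "proj W1 W2 u \<in> W1" using proj_in u by blast
  have "proj W1 W2 (c *\<^sub>R proj W1 W2 u + c *\<^sub>R (u - proj W1 W2 u)) = c *\<^sub>R proj W1 W2 u"
    using proj_in[OF u] sumD(1,2) by (intro proj_eq) (auto intro: subspace_scale)
  then show "proj W1 W2 (c *\<^sub>R u) = c *\<^sub>R proj W1 W2 u"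
    by (simp add: algebra_simps)
next
  fix u v assume uv: "u \<in> V" "v \<in> V"
  have "proj W1 W2 ((proj W1 W2 u + proj W1 W2 v) + ((u - proj W1 W2 u) + (v - proj W1 W2 v))) =
      proj W1 W2 u + proj W1 W2 v"
    using proj_in[OF uv(1)] proj_in[OF uv(2)] sumD(1,2) by (intro proj_eq) (auto intro: subspace_add)
  then show "proj W1 W2 (u + v) = proj W1 W2 u + proj W1 W2 v"
    by (simp add: algebra_simps)
qed

lemma proj_in_space: "x \<in> V \<Longrightarrow> proj W1 W2 x \<in> V"
  using proj_in sumD(5) by blast

lemma proj_commute:
  assumes "x \<in> V"
  shows "proj W1 W2 (\<xi> x) = \<xi> (proj W1 W2 x)"
proof -
  have "\<xi> x = \<xi> (proj W1 W2 x) + \<xi> (x - proj W1 W2 x)"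
    using linear_onD(2)[OF skew_spaceD(4)[OF space]] proj_in_space[OF assms] assms
      subspace_diff[OF skew_spaceD(2)[OF space]] by (metis add.commute diff_add_cancel)
  then show ?thesis using proj_eq sumD(8,9) proj_in[OF assms] by metis
qed

text \<open>The difference \<open>x - proj W1 W2 x\<close> is orthogonal to \<open>W1\<close>.
  Self-adjointness of the composite of two such projections rests on this.\<close>

lemma proj_form:
  assumes "x \<in> V" "y \<in> W1"
  shows "\<gamma> (proj W1 W2 x) y = \<gamma> x y" "\<gamma> y (proj W1 W2 x) = \<gamma> y x"
proof -
  interpret form V \<gamma> using skew_spaceD(5)[OF space] .
  have yV: "y \<in> V" using assms sumD(5) by blast
  have "\<gamma> y (x - proj W1 W2 x) = 0" using sumD(7) proj_in assms by blast
  then show eq: "\<gamma> y (proj W1 W2 x) = \<gamma> y x"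
    using diff_right[OF assms(1) proj_in_space[OF assms(1)] yV] by simp
  show "\<gamma> (proj W1 W2 x) y = \<gamma> x y"
    using eq sym yV assms proj_in_space by metis
qed

end

section \<open>The exchange isometry\<close>

text \<open>In the next locale \<open>C\<close> is a self-adjoint square root of the map \<open>q p\<close> on \<open>W1\<close>, where \<open>q\<close> and \<open>p\<close>
  project onto \<open>W1\<close> and \<open>U1\<close>; \<open>D\<close> is the inverse of \<open>C\<close> and \<open>E\<close> that of \<open>1 + C\<close>. Then \<open>p D\<close> is an
  isometry from \<open>W1\<close> to \<open>U1\<close>, and it extends to the reflection \<open>\<rho>\<close> of \<open>V\<close> in \<open>{x + p D x | x \<in> W1}\<close>.\<close>

locale exchange = W: sum_decomp \<xi> \<gamma> V W1 W2 + U: sum_decomp \<xi> \<gamma> V U1 U2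
  for \<xi> :: "'a::real_vector \<Rightarrow> 'a" and \<gamma> V W1 W2 U1 U2 +
  fixes C D E :: "'a \<Rightarrow> 'a"
  assumes linC: "linear_on W1 W1 C" and linD: "linear_on W1 W1 D" and linE: "linear_on W1 W1 E"
    and comD: "x \<in> W1 \<Longrightarrow> \<xi> (D x) = D (\<xi> x)"
    and comE: "x \<in> W1 \<Longrightarrow> \<xi> (E x) = E (\<xi> x)"
    and adjD: "x \<in> W1 \<Longrightarrow> y \<in> W1 \<Longrightarrow> \<gamma> (D x) y = \<gamma> x (D y)"
    and adjE: "x \<in> W1 \<Longrightarrow> y \<in> W1 \<Longrightarrow> \<gamma> (E x) y = \<gamma> x (E y)"
    and CC: "x \<in> W1 \<Longrightarrow> C (C x) = proj W1 W2 (proj U1 U2 x)"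
    and CD: "x \<in> W1 \<Longrightarrow> C (D x) = x" and DC: "x \<in> W1 \<Longrightarrow> D (C x) = x"
    and CE: "x \<in> W1 \<Longrightarrow> E x + C (E x) = x" and EC: "x \<in> W1 \<Longrightarrow> E (x + C x) = x"
    and onto: "U1 \<subseteq> proj U1 U2 ` W1"
    and nondeg: "nondegenerate_on W2 \<gamma>"
begin

sublocale form V \<gamma> using skew_spaceD(5)[OF W.space] .

abbreviation "q \<equiv> proj W1 W2"
abbreviation "p \<equiv> proj U1 U2"

text \<open>\<open>s\<close> parametrizes the space that the reflection is to fix, and
  \<open>st\<close> is its adjoint with respect to the form. As \<open>st s = 2 (1 + C)\<close>, the
  map \<open>h = s E st\<close> is twice the orthogonal projection onto that space, and
  \<open>\<rho> = h - 1\<close> is the reflection.\<close>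

definition s where "s x = x + p (D x)"
definition st where "st v = q v + D (q (p v))"
definition h where "h v = s (E (st v))"
definition \<rho> where "\<rho> v = h v - v"

lemma W1V: "x \<in> W1 \<Longrightarrow> x \<in> V" using W.sumD(5) by blast
lemma U1V: "x \<in> U1 \<Longrightarrow> x \<in> V" using U.sumD(5) by blast
lemma W2V: "x \<in> W2 \<Longrightarrow> x \<in> V" using W.sumD(6) by blast
lemma subW: "subspace W1" by (rule W.sumD(1))

lemma in_W1: "v \<in> V \<Longrightarrow> q v \<in> W1" "x \<in> W1 \<Longrightarrow> C x \<in> W1" "x \<in> W1 \<Longrightarrow> D x \<in> W1" "x \<in> W1 \<Longrightarrow> E x \<in> W1"
  by (simp_all add: W.proj_in(1) linear_onD(1)[OF linC] linear_onD(1)[OF linD] linear_onD(1)[OF linE])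

lemma in_V: "v \<in> V \<Longrightarrow> q v \<in> V" "v \<in> V \<Longrightarrow> p v \<in> V" "x \<in> W1 \<Longrightarrow> s x \<in> V"
  by (simp_all add: s_def W.proj_in_space U.proj_in_space W1V in_W1 subspace_add[OF sub])

lemma st_in: "v \<in> V \<Longrightarrow> st v \<in> W1"
  by (simp add: st_def in_W1 in_V subspace_add[OF subW])

lemma h_in: "v \<in> V \<Longrightarrow> h v \<in> V"
  unfolding h_def by (intro in_V in_W1 st_in)

lemma \<rho>_in: "v \<in> V \<Longrightarrow> \<rho> v \<in> V"
  unfolding \<rho>_def by (intro subspace_diff[OF sub] h_in)

lemma lin_W1_V: "linear_on V W1 f \<Longrightarrow> linear_on V V f" "linear_on W1 W1 f \<Longrightarrow> linear_on W1 V f"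
  using W.sumD(5) by (auto elim: linear_on_subset)

lemma lin_p: "linear_on V V p"
  using linear_on_subset[OF U.linear_proj order_refl U.sumD(5)] .

lemma lin_s: "linear_on W1 V s"
  unfolding s_def
  using linear_on_plus[OF linear_on_ident[OF W.sumD(5)] linear_on_comp[OF lin_W1_V(2)[OF linD] lin_p] sub] .

lemma lin_st: "linear_on V W1 st"
  unfolding st_def
  using linear_on_plus[OF W.linear_proj linear_on_comp[OF linear_on_comp[OF lin_p W.linear_proj] linD] subW] .

lemma lin_h: "linear_on V V h"
  unfolding h_def using linear_on_comp[OF linear_on_comp[OF lin_st linE] lin_s] .

lemma lin_\<rho>: "linear_on V V \<rho>"
  unfolding \<rho>_def using linear_on_minus[OF lin_h linear_on_ident[OF order_refl] sub] .

lemmas mem = in_W1 in_V st_in h_in \<rho>_in W1V W2V U.proj_in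

lemma s_adj:
  assumes "x \<in> W1" "v \<in> V"
  shows "\<gamma> (s x) v = \<gamma> x (st v)"
proof -
  have pU: "p v \<in> U1" "p (D x) \<in> U1" using assms by (simp_all add: mem)
  have "\<gamma> (s x) v = \<gamma> x v + \<gamma> (p (D x)) v"
    unfolding s_def using assms by (intro add_left) (simp_all add: mem)
  also have "\<gamma> x v = \<gamma> x (q v)" using W.proj_form(2)[OF assms(2,1)] by simp
  also have "\<gamma> (p (D x)) v = \<gamma> (p (D x)) (p v)" using U.proj_form(2)[OF assms(2) pU(2)] by simp
  also have "\<dots> = \<gamma> (D x) (p v)" using U.proj_form(1)[OF W1V[OF in_W1(3)[OF assms(1)]] pU(1)] .
  also have "\<dots> = \<gamma> (D x) (q (p v))"
    using W.proj_form(2)[OF in_V(2)[OF assms(2)] in_W1(3)[OF assms(1)]] by simp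
  also have "\<dots> = \<gamma> x (D (q (p v)))" using assms by (intro adjD) (simp_all add: mem)
  also have "\<gamma> x (q v) + \<gamma> x (D (q (p v))) = \<gamma> x (st v)"
    unfolding st_def using assms by (intro add_right[symmetric]) (simp_all add: mem)
  finally show ?thesis .
qed

text \<open>On \<open>W1\<close> replace \<open>q p\<close> by \<open>C C\<close>: both
  \<open>q (s x)\<close> and \<open>D (q (p (s x)))\<close> become \<open>x + C x\<close>.\<close>

lemma st_s:
  assumes "x \<in> W1"
  shows "st (s x) = 2 *\<^sub>R (x + C x)"
proof -
  have Dx: "D x \<in> W1" "D x \<in> V" "p (D x) \<in> V" "x \<in> V"
    using assms by (simp_all add: mem)
  have "q (s x) = q x + q (p (D x))"
    unfolding s_def using Dx by (intro linear_onD(2)[OF W.linear_proj])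
  then have 1: "q (s x) = x + C x"
    using CC[OF Dx(1)] CD assms in_W1 W.proj_id by simp
  have "p (s x) = p x + p (p (D x))"
    unfolding s_def using Dx by (intro linear_onD(2)[OF U.linear_proj])
  also have "p (p (D x)) = p (D x)" using Dx by (simp add: U.proj_id mem)
  finally have "q (p (s x)) = q (p x) + q (p (D x))"
    using Dx in_V linear_onD(2)[OF W.linear_proj] by simp
  also have "\<dots> = C (C x) + C (C (D x))" using CC Dx assms by simp
  finally have "D (q (p (s x))) = D (C (C x)) + D (C (C (D x)))"
    using linear_onD(2)[OF linD] in_W1 Dx assms by simp
  also have "\<dots> = C x + x" using DC CD in_W1 assms Dx by simp
  finally show ?thesis using 1 unfolding st_def by (simp add: scaleR_2)
qed

lemma st_h: "v \<in> V \<Longrightarrow> st (h v) = 2 *\<^sub>R st v"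
  unfolding h_def using st_s CE st_in in_W1 by simp

lemma h_h:
  assumes "v \<in> V"
  shows "h (h v) = 2 *\<^sub>R h v"
proof -
  have "h (h v) = s (E (2 *\<^sub>R st v))" unfolding h_def[of "h v"] st_h[OF assms] ..
  also have "\<dots> = 2 *\<^sub>R h v"
    using assms by (simp add: h_def linear_onD(3)[OF linE] linear_onD(3)[OF lin_s] st_in in_W1)
  finally show ?thesis .
qed

lemma \<rho>_\<rho>:
  assumes "v \<in> V"
  shows "\<rho> (\<rho> v) = v"
proof -
  have "h (\<rho> v) = h (h v) - h v"
    unfolding \<rho>_def using assms by (intro linear_on_diff[OF lin_h sub]) (simp_all add: mem)
  then show ?thesis unfolding \<rho>_def[of "\<rho> v"] using h_h[OF assms] by (simp add: \<rho>_def scaleR_2)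
qed

text \<open>\<open>\<gamma> (h u) v\<close>, \<open>\<gamma> u (h v)\<close> and half of
  \<open>\<gamma> (h u) (h v)\<close> coincide, so all terms with \<open>h\<close> cancel.\<close>

lemma \<rho>_isometry:
  assumes u: "u \<in> V" and v: "v \<in> V"
  shows "\<gamma> (\<rho> u) (\<rho> v) = \<gamma> u v"
proof -
  let ?a = "\<gamma> (E (st u)) (st v)"
  have su: "st u \<in> W1" "E (st u) \<in> W1" "st v \<in> W1" "E (st v) \<in> W1" "h u \<in> V" "h v \<in> V"
    using assms by (simp_all add: mem)
  have 1: "\<gamma> (h u) v = ?a" unfolding h_def using s_adj su v by simp
  have "\<gamma> (h u) (h v) = \<gamma> (E (st u)) (st (h v))"
    unfolding h_def[of u] using s_adj su by simp
  also have "\<dots> = 2 * ?a" using st_h[OF v] su W1V scale_right by simp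
  finally have 2: "\<gamma> (h u) (h v) = 2 * ?a" .
  have "\<gamma> u (h v) = \<gamma> (h v) u" using u su by (intro sym)
  also have "\<dots> = \<gamma> (E (st v)) (st u)" unfolding h_def using s_adj su u by simp
  also have "\<dots> = \<gamma> (st u) (E (st v))" using su by (intro sym W1V)
  also have "\<dots> = ?a" using adjE su by simp
  finally have 3: "\<gamma> u (h v) = ?a" .
  have "\<gamma> (\<rho> u) (\<rho> v) = \<gamma> (h u) (h v) - \<gamma> u (h v) - (\<gamma> (h u) v - \<gamma> u v)"
    unfolding \<rho>_def using su u v by (simp add: diff_left diff_right subspace_diff[OF sub])
  then show ?thesis using 1 2 3 by simp
qed

text \<open>For \<open>x\<close> in \<open>W1\<close>,
  \<open>D (q (p x)) = D (C (C x)) = C x\<close>, so \<open>st x = x + C x\<close>, and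
  \<open>E\<close> turns this back into \<open>x\<close>.\<close>

lemma \<rho>_W1:
  assumes "x \<in> W1"
  shows "\<rho> x = p (D x)"
proof -
  have "st x = x + C x"
    unfolding st_def using CC[OF assms, symmetric] W.proj_id DC in_W1 assms by simp
  then have "h x = s x" unfolding h_def using EC assms by simp
  then show ?thesis unfolding \<rho>_def s_def by simp
qed

lemma \<rho>_commute:
  assumes v: "v \<in> V"
  shows "\<xi> (\<rho> v) = \<rho> (\<xi> v)"
proof -
  note lin\<xi> = skew_spaceD(4)[OF W.space]
  have \<xi>v: "\<xi> v \<in> V" using linear_onD(1)[OF lin\<xi> v] .
  have "\<xi> (st v) = \<xi> (q v) + \<xi> (D (q (p v)))"
    unfolding st_def using v by (intro linear_onD(2)[OF lin\<xi>]) (simp_all add: mem)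
  also have "\<dots> = st (\<xi> v)"
    unfolding st_def using W.proj_commute[symmetric] U.proj_commute[symmetric] comD in_W1 in_V v by simp
  finally have 1: "\<xi> (st v) = st (\<xi> v)" .
  have 2: "\<xi> (s x) = s (\<xi> x)" if x: "x \<in> W1" for x
  proof -
    have "\<xi> (s x) = \<xi> x + \<xi> (p (D x))"
      unfolding s_def using x by (intro linear_onD(2)[OF lin\<xi>]) (simp_all add: mem)
    also have "\<dots> = s (\<xi> x)"
      unfolding s_def using U.proj_commute[symmetric] comD in_W1 W1V x by simp
    finally show ?thesis .
  qed
  have "\<xi> (h v) = h (\<xi> v)"
    unfolding h_def using 1 2 comE in_W1 st_in v by simp
  then show ?thesis
    unfolding \<rho>_def using linear_on_diff[OF lin\<xi> sub] h_in v by simp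
qed

lemma isometry_first: "isometry_between W1 \<xi> \<gamma> U1 \<xi> \<gamma> (\<lambda>x. p (D x))"
  unfolding isometry_between_def
proof (intro conjI ballI)
  have "linear_on W1 V D" using linear_on_subset[OF linD order_refl W.sumD(5)] .
  then show "linear_on W1 U1 (\<lambda>x. p (D x))" by (rule linear_on_comp[OF _ U.linear_proj])
  show "bij_betw (\<lambda>x. p (D x)) W1 U1"
    unfolding bij_betw_def
  proof
    show "inj_on (\<lambda>x. p (D x)) W1"
    proof (rule inj_onI)
      fix x y assume "x \<in> W1" "y \<in> W1" "p (D x) = p (D y)"
      then have "C (C (D x)) = C (C (D y))" using CC in_W1 by simp
      then have "C x = C y" using CD \<open>x \<in> W1\<close> \<open>y \<in> W1\<close> by simp
      then show "x = y" using DC \<open>x \<in> W1\<close> \<open>y \<in> W1\<close> by metis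
    qed
    show "(\<lambda>x. p (D x)) ` W1 = U1"
    proof (intro equalityI subsetI)
      fix u assume "u \<in> U1"
      then obtain x where x: "x \<in> W1" "u = p x" using onto by blast
      then have "u = p (D (C x))" using DC by simp
      then show "u \<in> (\<lambda>x. p (D x)) ` W1" using x by (auto simp: mem)
    next
      fix u assume "u \<in> (\<lambda>x. p (D x)) ` W1"
      then show "u \<in> U1" by (auto simp: mem)
    qed
  qed
  show "\<gamma> (p (D x)) (p (D y)) = \<gamma> x y" if "x \<in> W1" "y \<in> W1" for x y
    using \<rho>_isometry[of x y] \<rho>_W1 W1V that by simp
  show "\<xi> (p (D x)) = p (D (\<xi> x))" if "x \<in> W1" for x
    using U.proj_commute[symmetric] comD in_W1 W1V that by simp
qed

text \<open>\<open>\<rho>\<close> maps \<open>W1\<close> onto \<open>U1\<close>, so it maps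
  \<open>W2\<close> into the vectors orthogonal to \<open>U1\<close>. If the form has a kernel
  inside \<open>U1\<close>, these need not lie in \<open>U2\<close>; the component in
  \<open>U1\<close> is therefore subtracted. It is orthogonal to all of \<open>U1\<close>, so values
  of the form do not change.\<close>

lemma isometry_second: "isometry_between W2 \<xi> \<gamma> U2 \<xi> \<gamma> (\<lambda>v. \<rho> v - p (\<rho> v))"
proof -
  let ?\<phi> = "\<lambda>v. \<rho> v - p (\<rho> v)"
  note lin\<xi> = skew_spaceD(4)[OF W.space]
  have \<phi>_in: "?\<phi> v \<in> U2" if "v \<in> V" for v
    using that by (simp add: mem)
  have "linear_on V V ?\<phi>"
    using linear_on_minus[OF lin_\<rho> linear_on_comp[OF lin_\<rho> lin_p] sub] .
  then have "linear_on W2 V ?\<phi>" by (rule linear_on_subset[OF _ W.sumD(6) order_refl])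
  then have lin\<phi>: "linear_on W2 U2 ?\<phi>" by (rule linear_on_range) (simp add: image_subset_iff mem)
  have iso: "\<gamma> (?\<phi> v) (?\<phi> w) = \<gamma> v w" if v: "v \<in> W2" and w: "w \<in> W2" for v w
  proof -
    have V: "\<rho> v \<in> V" "\<rho> w \<in> V" "p (\<rho> v) \<in> U1" "p (\<rho> w) \<in> U1" "?\<phi> v \<in> U2" "?\<phi> v \<in> V"
      using v w subsetD[OF U.sumD(6) \<phi>_in] by (simp_all add: mem)
    have orth: "\<gamma> (p (\<rho> v)) u = 0" if "u \<in> U1" for u
    proof -
      obtain y where "y \<in> W1" "u = p y" using \<open>u \<in> U1\<close> onto by blast
      then have "C y \<in> W1" "u = p (D (C y))" by (simp_all add: DC mem)
      then obtain x where x: "x \<in> W1" "u = p (D x)" by blast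
      have "\<gamma> (p (\<rho> v)) u = \<gamma> (\<rho> v) u" using V that by (intro U.proj_form(1))
      also have "\<dots> = \<gamma> v x" using \<rho>_isometry[of v x] \<rho>_W1 x v W1V W2V by simp
      also have "\<dots> = \<gamma> x v" using x v by (intro sym W1V W2V)
      also have "\<dots> = 0" using x v by (intro W.sumD(7))
      finally show ?thesis .
    qed
    have "\<gamma> (?\<phi> v) (?\<phi> w) = \<gamma> (?\<phi> v) (\<rho> w) - \<gamma> (?\<phi> v) (p (\<rho> w))"
      using V U1V by (intro diff_right) simp_all
    also have "\<gamma> (?\<phi> v) (p (\<rho> w)) = \<gamma> (p (\<rho> w)) (?\<phi> v)" using V U1V by (intro sym) simp_all
    also have "\<dots> = 0" using V by (intro U.sumD(7))
    also have "\<gamma> (?\<phi> v) (\<rho> w) = \<gamma> (\<rho> v) (\<rho> w) - \<gamma> (p (\<rho> v)) (\<rho> w)"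
      using V U1V by (intro diff_left) simp_all
    also have "\<gamma> (p (\<rho> v)) (\<rho> w) = \<gamma> (p (\<rho> v)) (p (\<rho> w))" using U.proj_form(2) V by simp
    also have "\<dots> = 0" using V by (intro orth)
    finally show ?thesis using \<rho>_isometry W2V v w by simp
  qed
  have "inj_on ?\<phi> W2"
  proof (rule inj_onI)
    fix x y assume xy: "x \<in> W2" "y \<in> W2" "?\<phi> x = ?\<phi> y"
    have d: "x - y \<in> W2" using xy by (intro subspace_diff[OF W.sumD(2)])
    have "?\<phi> (x - y) = 0" using linear_on_diff[OF lin\<phi> W.sumD(2)] xy by simp
    then have "\<gamma> (x - y) z = 0" if "z \<in> W2" for z
      using iso[OF d that] zero_left \<phi>_in[OF W2V[OF that]] U.sumD(6) by (simp add: subsetD)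
    then have "x - y \<in> form_kernel W2 \<gamma>" unfolding form_kernel_def using d by blast
    then show "x = y" using nondeg unfolding nondegenerate_on_def by simp
  qed
  moreover have "?\<phi> ` W2 = U2"
  proof (intro equalityI subsetI)
    fix z assume z: "z \<in> U2"
    then have zV: "z \<in> V" using U.sumD(6) by blast
    \<comment> \<open>\<open>\<rho>\<close> is an involution, so \<open>y\<close> is the preimage of
      \<open>z\<close>. Dropping its part in \<open>W1\<close> alters the image only by a vector of
      \<open>U1\<close>, which \<open>?\<phi>\<close> removes.\<close>
    define y where "y = \<rho> z"
    have y: "y \<in> V" "\<rho> y = z" unfolding y_def using zV by (simp_all add: mem \<rho>_\<rho>)
    define v where "v = y - q y"
    have v: "v \<in> W2" unfolding v_def using y by (intro W.proj_in(2))
    have "\<rho> v = z - p (D (q y))"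
      unfolding v_def using linear_on_diff[OF lin_\<rho> sub] y in_V in_W1 \<rho>_W1 by simp
    moreover have "p (\<rho> v) = - p (D (q y))"
    proof -
      have D: "D (q y) \<in> V" using y by (simp add: mem)
      then have "p (z - p (D (q y))) = p z - p (p (D (q y)))"
        using zV by (intro linear_on_diff[OF U.linear_proj sub]) (simp_all add: mem)
      then show ?thesis
        using \<open>\<rho> v = z - p (D (q y))\<close> U.proj_0[OF z] U.proj_id[OF U.proj_in(1)[OF D]] by simp
    qed
    ultimately have "?\<phi> v = z" by simp
    then show "z \<in> ?\<phi> ` W2" using v by (intro image_eqI[of _ _ v]) simp_all
  qed (auto simp: \<phi>_in W2V)
  moreover have "\<xi> (?\<phi> v) = ?\<phi> (\<xi> v)" if v: "v \<in> W2" for v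
    using linear_on_diff[OF lin\<xi> sub] \<rho>_in in_V W2V v \<rho>_commute U.proj_commute[symmetric] by simp
  ultimately show ?thesis
    unfolding isometry_between_def bij_betw_def using lin\<phi> iso by blast
qed

end

section \<open>Decompositions from self-adjoint maps\<close>

lemma (in endo) sqrt_operator:
  assumes "b \<noteq> 0 \<or> a > 0" "\<forall>x\<in>V. papp ([:a\<^sup>2 + b\<^sup>2, - 2 * a, 1:] ^ k) f x = 0"
  shows "\<exists>p u. \<forall>x\<in>V. papp p f (papp p f x) = f x \<and> papp p f (papp u f x) = x \<and>
    papp u f (papp p f x) = x"
proof -
  let ?Q = "[:a\<^sup>2 + b\<^sup>2, - 2 * a, 1:] ^ k"
  obtain p u where p: "?Q dvd p * p - [:0, 1:]" and u: "?Q dvd p * u - 1"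
    using poly_sqrt_mod_quadratic_power[OF assms(1), of k] by blast
  have "papp p f (papp p f x) = f x \<and> papp p f (papp u f x) = x \<and> papp u f (papp p f x) = x"
    if x: "x \<in> V" for x
  proof -
    have 0: "papp ?Q f x = 0" using assms(2) x by blast
    have "papp (p * p) f x = f x" "papp (p * u) f x = x"
      using papp_dvd_cong[OF p x 0] papp_dvd_cong[OF u x 0] papp_X[OF x] by simp_all
    then have "papp p f (papp p f x) = f x" "papp p f (papp u f x) = x"
      using papp_mult[OF x] by simp_all
    then show ?thesis using papp_commute_self[OF x, of u p] by simp
  qed
  then show ?thesis by blast
qed

text \<open>Vectors of \<open>I\<close> have the form \<open>(f ^^ n) z\<close>; moving
  \<open>f ^^ n\<close> to the other argument, at the price of a power of \<open>\<epsilon>\<close>,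
  kills the pairing with the kernel of \<open>f ^^ n\<close>. The factor \<open>\<epsilon>\<close>
  covers self-adjoint maps (1) and \<open>\<xi>\<close> itself (-1).\<close>

lemma (in endo) fitting_inv_sum:
  assumes space: "skew_space \<xi> V \<gamma>"
    and com: "\<And>x. x \<in> V \<Longrightarrow> \<xi> (f x) = f (\<xi> x)"
    and adj: "\<And>x y. x \<in> V \<Longrightarrow> y \<in> V \<Longrightarrow> \<gamma> (f x) y = \<epsilon> * \<gamma> x (f y)" and \<epsilon>: "\<epsilon> \<noteq> 0"
  obtains n u I where
    "n > 0" "inv_sum \<xi> \<gamma> V {x \<in> V. (f ^^ n) x = 0} I"
    "\<And>x. x \<in> I \<Longrightarrow> papp u f (f x) = x" "\<And>x. x \<in> I \<Longrightarrow> f x \<in> I"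
proof -
  interpret F: form V \<gamma> using skew_spaceD(5)[OF space] .
  obtain n u K I where F: "n > 0" "K = {x \<in> V. (f ^^ n) x = 0}"
    "subspace K" "subspace I" "V = {x + y |x y. x \<in> K \<and> y \<in> I}" "K \<inter> I = {0}"
    and img: "\<And>x. x \<in> I \<Longrightarrow> \<exists>y\<in>V. x = (f ^^ n) y"
    and inv: "\<And>x. x \<in> I \<Longrightarrow> papp u f (f x) = x"
    and inva: "\<And>g. linear_on V V g \<Longrightarrow> (\<And>x. x \<in> V \<Longrightarrow> g (f x) = f (g x)) \<Longrightarrow> g ` K \<subseteq> K \<and> g ` I \<subseteq> I"
    apply (rule fitting[OF skew_spaceD(1)[OF space]])
    subgoal premises prems for n u K I by (rule that[of n K I u]) (fact prems)+
    done
  have adj_pow: "\<gamma> ((f ^^ m) x) y = \<epsilon> ^ m * \<gamma> x ((f ^^ m) y)" if "x \<in> V" "y \<in> V" for m x y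
    using that
  proof (induction m arbitrary: y)
    case (Suc m)
    have "\<gamma> ((f ^^ Suc m) x) y = \<epsilon> * \<gamma> ((f ^^ m) x) (f y)"
      using Suc.prems adj funpow_in by simp
    also have "\<dots> = \<epsilon> * (\<epsilon> ^ m * \<gamma> x ((f ^^ m) (f y)))"
      using Suc.IH[OF Suc.prems(1), of "f y"] linear_onD(1)[OF lin Suc.prems(2)] by simp
    finally show ?case by (simp add: funpow_swap1)
  qed simp
  have orth: "\<gamma> x y = 0" if x: "x \<in> K" and y: "y \<in> I" for x y
  proof -
    obtain z where z: "z \<in> V" "y = (f ^^ n) z" using img[OF y] by blast
    have xK: "x \<in> V" "(f ^^ n) x = 0" using x F(2) by simp_all
    have "\<epsilon> ^ n * \<gamma> x y = \<gamma> ((f ^^ n) x) z" using adj_pow[OF xK(1) z(1)] z(2) by simp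
    also have "\<dots> = 0" using xK(2) F.zero_left[OF z(1)] by simp
    finally show ?thesis using \<epsilon> by simp
  qed
  have \<xi>: "\<xi> ` K \<subseteq> K" "\<xi> ` I \<subseteq> I"
    using inva[OF skew_spaceD(4)[OF space] com] by simp_all
  have f: "f ` I \<subseteq> I" using inva[OF lin] by simp
  have "inv_sum \<xi> \<gamma> V K I"
    unfolding inv_sum_def orthogonal_sum_def invariant_under_def
    by (intro conjI F(3,4,5,6) \<xi> ballI orth)
  then show thesis
    using that[of n I u] F(1,2) inv f by (simp add: image_subset_iff)
qed

definition indecomposable_space where
  "indecomposable_space \<xi> W \<gamma> \<longleftrightarrow>
     (\<forall>W1 W2. inv_sum \<xi> \<gamma> W W1 W2 \<longrightarrow> W1 = {0} \<or> W2 = {0})"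

lemma inv_sum_zero_left:
  assumes "inv_sum \<xi> \<gamma> V {0} W"
  shows "W = V"
  using inv_sumD(3)[OF assms] by simp

lemma inv_sum_zero_right:
  assumes "inv_sum \<xi> \<gamma> V W {0}"
  shows "W = V"
  using inv_sumD(3)[OF assms] by simp

lemma (in endo) nilpotent_or_invertible:
  assumes space: "skew_space \<xi> V \<gamma>" and ind: "indecomposable_space \<xi> V \<gamma>"
    and com: "\<And>x. x \<in> V \<Longrightarrow> \<xi> (f x) = f (\<xi> x)"
    and adj: "\<And>x y. x \<in> V \<Longrightarrow> y \<in> V \<Longrightarrow> \<gamma> (f x) y = \<gamma> x (f y)"
  shows "(\<exists>n. \<forall>x\<in>V. (f ^^ n) x = 0) \<or> (\<exists>u. \<forall>x\<in>V. papp u f (f x) = x)"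
proof -
  obtain n u I where F: "inv_sum \<xi> \<gamma> V {x \<in> V. (f ^^ n) x = 0} I"
    "\<And>x. x \<in> I \<Longrightarrow> papp u f (f x) = x"
    using fitting_inv_sum[OF space com, of 1] adj by (metis mult_1 one_neq_zero)
  then consider "{x \<in> V. (f ^^ n) x = 0} = {0}" | "I = {0}"
    using ind unfolding indecomposable_space_def by blast
  then show ?thesis
  proof cases
    case 1
    then have "I = V" using inv_sum_zero_left F(1) by metis
    then show ?thesis using F(2) by blast
  next
    case 2
    then have "{x \<in> V. (f ^^ n) x = 0} = V" using inv_sum_zero_right F(1) by metis
    then show ?thesis by blast
  qed
qed

lemma (in endo) nilpotent_kernel:
  assumes "V \<noteq> {0}" "\<And>x. x \<in> V \<Longrightarrow> (f ^^ n) x = 0"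
  obtains x where "x \<in> V" "x \<noteq> 0" "f x = 0"
proof -
  obtain w where w: "w \<in> V" "w \<noteq> 0" using assms(1) subspace_0[OF sub] by auto
  define m where "m = (LEAST m. (f ^^ m) w = 0)"
  have m: "(f ^^ m) w = 0" unfolding m_def using LeastI[of "\<lambda>m. (f ^^ m) w = 0" n] assms(2)[OF w(1)] .
  then obtain l where l: "m = Suc l" using w(2) by (cases m) auto
  then have "(f ^^ l) w \<noteq> 0" using not_less_Least[of l "\<lambda>m. (f ^^ m) w = 0"] by (simp add: m_def)
  then show thesis using that[of "(f ^^ l) w"] m l funpow_in[OF w(1)] by simp
qed

locale two_sums = W: sum_decomp \<xi> \<gamma> V W1 W2 + U: sum_decomp \<xi> \<gamma> V U1 U2
  for \<xi> :: "'a::real_vector \<Rightarrow> 'a" and \<gamma> V W1 W2 U1 U2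
begin

definition B where "B x = proj W1 W2 (proj U1 U2 x)"

lemma W1V: "x \<in> W1 \<Longrightarrow> x \<in> V" using W.sumD(5) by blast

lemma U1V: "x \<in> U1 \<Longrightarrow> x \<in> V" using U.sumD(5) by blast

lemma linear_B: "linear_on W1 W1 B"
  unfolding B_def
  by (rule linear_on_subset[OF linear_on_comp[OF linear_on_subset[OF U.linear_proj order_refl U.sumD(5)]
          W.linear_proj] W.sumD(5) order_refl])

sublocale B: endo W1 B
  by unfold_locales (rule W.sumD(1), rule linear_B)

lemma B_commute: "x \<in> W1 \<Longrightarrow> \<xi> (B x) = B (\<xi> x)"
  unfolding B_def by (simp add: W.proj_commute U.proj_commute W1V U.proj_in_space)

lemma B_adjoint:
  assumes "x \<in> W1" "y \<in> W1"
  shows "\<gamma> (B x) y = \<gamma> x (B y)"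
proof -
  have V: "x \<in> V" "y \<in> V" "proj U1 U2 x \<in> V" "proj U1 U2 y \<in> V"
    and U: "proj U1 U2 x \<in> U1" "proj U1 U2 y \<in> U1"
    using assms by (simp_all add: W1V U.proj_in_space U.proj_in)
  show ?thesis
    unfolding B_def
    using W.proj_form(1)[OF V(3) assms(2)] W.proj_form(2)[OF V(4) assms(1)]
      U.proj_form(2)[OF V(2) U(1)] U.proj_form(1)[OF V(1) U(2)] by simp
qed

lemma W1_space: "skew_space \<xi> W1 \<gamma>"
  using inv_sum_skew_space[OF W.space W.sum] by simp

lemma lin\<xi>: "linear_on W1 W1 \<xi>"
  using skew_spaceD(4)[OF W1_space] .

lemma papp_B_commute: "x \<in> W1 \<Longrightarrow> \<xi> (papp r B x) = papp r B (\<xi> x)"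
  by (rule B.papp_commute[OF lin\<xi> B_commute])

lemma papp_B_adjoint: "x \<in> W1 \<Longrightarrow> y \<in> W1 \<Longrightarrow> \<gamma> (papp r B x) y = \<gamma> x (papp r B y)"
  by (rule B.papp_self_adjoint[OF skew_spaceD(3)[OF W1_space] B_adjoint])

lemma endo_papp_B: "endo W1 (papp r B)"
  by unfold_locales (rule W.sumD(1), rule B.linear_papp)

text \<open>\<open>C\<close> and \<open>D\<close> are polynomials in \<open>B\<close>, and
  \<open>E\<close> is one in \<open>1 + C\<close>; hence they commute with \<open>\<xi>\<close> and
  are self-adjoint, as the locale \<open>exchange\<close> demands.\<close>

lemma exchange_poly:
  assumes c: "\<And>x. x \<in> W1 \<Longrightarrow> papp c B (papp c B x) = B x"
    and cd: "\<And>x. x \<in> W1 \<Longrightarrow> papp c B (papp d B x) = x"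
    and dc: "\<And>x. x \<in> W1 \<Longrightarrow> papp d B (papp c B x) = x"
    and e: "\<And>x. x \<in> W1 \<Longrightarrow> papp e (papp (1 + c) B) (papp (1 + c) B x) = x"
    and onto: "U1 \<subseteq> proj U1 U2 ` W1"
    and nondeg: "nondegenerate_on W2 \<gamma>"
  shows "isometry_between W1 \<xi> \<gamma> U1 \<xi> \<gamma> (\<lambda>x. proj U1 U2 (papp d B x))"
    and "\<exists>\<phi>. isometry_between W2 \<xi> \<gamma> U2 \<xi> \<gamma> \<phi>"
proof -
  interpret f: endo W1 "papp (1 + c) B" by (rule endo_papp_B)
  let ?E = "papp e (papp (1 + c) B)"
  have e': "papp (1 + c) B (?E x) = x" if "x \<in> W1" for x
    using f.papp_commute[OF f.lin refl that] e[OF that] by simp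
  have 1: "papp (1 + c) B x = x + papp c B x" for x by (simp add: papp_add)
  interpret exchange \<xi> \<gamma> V W1 W2 U1 U2 "papp c B" "papp d B" ?E
  proof unfold_locales
    show "\<xi> (?E x) = ?E (\<xi> x)" if "x \<in> W1" for x
      by (rule f.papp_commute[OF lin\<xi> papp_B_commute that])
    show "\<gamma> (?E x) y = \<gamma> x (?E y)" if "x \<in> W1" "y \<in> W1" for x y
      by (rule f.papp_self_adjoint[OF skew_spaceD(3)[OF W1_space] papp_B_adjoint that])
    show "?E x + papp c B (?E x) = x" if "x \<in> W1" for x
      using e'[OF that] 1 by metis
    show "?E (x + papp c B x) = x" if "x \<in> W1" for x
      using e[OF that] 1 by metis
  qed (use assms papp_B_commute papp_B_adjoint B.linear_papp f.linear_papp in \<open>simp_all add: B_def\<close>)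
  show "isometry_between W1 \<xi> \<gamma> U1 \<xi> \<gamma> (\<lambda>x. proj U1 U2 (papp d B x))"
    by (rule isometry_first)
  show "\<exists>\<phi>. isometry_between W2 \<xi> \<gamma> U2 \<xi> \<gamma> \<phi>"
    using isometry_second by blast
qed

end

section \<open>Types and decompositions\<close>

lemma isometry_betweenD:
  assumes "isometry_between V \<xi> \<gamma> V' \<xi>' \<gamma>' P"
  shows "linear_on V V' P" "inj_on P V" "P ` V = V'"
    and "u \<in> V \<Longrightarrow> v \<in> V \<Longrightarrow> \<gamma>' (P u) (P v) = \<gamma> u v"
    and "u \<in> V \<Longrightarrow> \<xi>' (P u) = P (\<xi> u)"
  using assms by (simp_all add: isometry_between_def bij_betw_def)

lemma isometry_between_refl: "isometry_between V \<xi> \<gamma> V \<xi> \<gamma> (\<lambda>x. x)"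
  unfolding isometry_between_def by (simp add: linear_on_ident bij_betw_def)

lemma isometry_between_trans:
  assumes "isometry_between V \<xi> \<gamma> V' \<xi>' \<gamma>' P" "isometry_between V' \<xi>' \<gamma>' V'' \<xi>'' \<gamma>'' Q"
  shows "isometry_between V \<xi> \<gamma> V'' \<xi>'' \<gamma>'' (\<lambda>x. Q (P x))"
  unfolding isometry_between_def
proof (intro conjI ballI)
  note P = isometry_betweenD[OF assms(1)] and Q = isometry_betweenD[OF assms(2)]
  show "linear_on V V'' (\<lambda>x. Q (P x))" by (rule linear_on_comp[OF P(1) Q(1)])
  show "bij_betw (\<lambda>x. Q (P x)) V V''"
    using assms bij_betw_trans[of P V V' Q V''] by (simp add: isometry_between_def comp_def)
  have PV: "P u \<in> V'" if "u \<in> V" for u using P(3) that by blast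
  show "\<gamma>'' (Q (P u)) (Q (P v)) = \<gamma> u v" if "u \<in> V" "v \<in> V" for u v
    using P(4) Q(4) PV that by simp
  show "\<xi>'' (Q (P u)) = Q (P (\<xi> u))" if "u \<in> V" for u
    using P(5) Q(5) PV that by simp
qed

lemma isometry_between_inv:
  assumes P: "isometry_between V \<xi> \<gamma> V' \<xi>' \<gamma>' P"
    and V: "subspace V" "linear_on V V \<xi>"
  shows "isometry_between V' \<xi>' \<gamma>' V \<xi> \<gamma> (inv_into V P)"
  unfolding isometry_between_def
proof (intro conjI ballI)
  let ?Q = "inv_into V P"
  note PD = isometry_betweenD[OF P]
  have Q: "?Q v \<in> V" "P (?Q v) = v" if "v \<in> V'" for v
    using that PD(3) by (auto simp: inv_into_into f_inv_into_f)
  have QP: "?Q (P u) = u" if "u \<in> V" for u using PD(2) that by simp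
  have eq: "?Q w = u" if "u \<in> V" "P u = w" for u w using QP that by auto
  show "linear_on V' V ?Q"
    unfolding linear_on_def
  proof (intro conjI ballI allI)
    fix u v c assume u: "u \<in> V'"
    show "?Q u \<in> V" by (rule Q(1)[OF u])
    show "?Q (c *\<^sub>R u) = c *\<^sub>R ?Q u"
      using Q[OF u] linear_onD(3)[OF PD(1)] subspace_scale[OF V(1)] by (intro eq) simp_all
  next
    fix u v assume u: "u \<in> V'" and v: "v \<in> V'"
    show "?Q (u + v) = ?Q u + ?Q v"
      using Q[OF u] Q[OF v] linear_onD(2)[OF PD(1)] subspace_add[OF V(1)] by (intro eq) simp_all
  qed
  show "bij_betw ?Q V' V" using P bij_betw_inv_into unfolding isometry_between_def by blast
  show "\<gamma> (?Q u) (?Q v) = \<gamma>' u v" if "u \<in> V'" "v \<in> V'" for u v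
    using PD(4)[OF Q(1)[OF that(1)] Q(1)[OF that(2)]] Q(2) that by simp
  show "\<xi> (?Q u) = ?Q (\<xi>' u)" if "u \<in> V'" for u
    using PD(5)[OF Q(1)[OF that]] Q(2)[OF that] linear_onD(1)[OF V(2) Q(1)[OF that]]
    by (intro eq[symmetric]) simp_all
qed

lemma isometry_between_subset:
  assumes "isometry_between V \<xi> \<gamma> V' \<xi>' \<gamma>' P" "W \<subseteq> V"
  shows "isometry_between W \<xi> \<gamma> (P ` W) \<xi>' \<gamma>' P"
proof -
  note P = isometry_betweenD[OF assms(1)]
  have "linear_on W (P ` W) P"
    by (rule linear_on_range[OF linear_on_subset[OF P(1) assms(2) order_refl] order_refl])
  moreover have "inj_on P W" using P(2) assms(2) by (rule inj_on_subset)
  ultimately show ?thesis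
    unfolding isometry_between_def bij_betw_def using P(4,5) assms(2) by (simp add: subsetD)
qed

lemma isometry_between_0:
  assumes "isometry_between V \<xi> \<gamma> V' \<xi>' \<gamma>' P" "subspace V" "W \<subseteq> V" "0 \<in> W"
  shows "P 0 = 0" "P ` W = {0} \<longleftrightarrow> W = {0}"
proof -
  note P = isometry_betweenD[OF assms(1)]
  show P0: "P 0 = 0" using linear_on_0[OF P(1) assms(2)] .
  have "x = 0" if "P ` W = {0}" "x \<in> W" for x
  proof -
    have "P x \<in> P ` W" using that(2) by (rule imageI)
    then have "P x = P 0" using that(1) P0 by simp
    then show ?thesis by (rule inj_onD[OF P(2)]) (use that(2) assms(3,4) in auto)
  qed
  then have "P ` W = {0} \<Longrightarrow> W = {0}" using assms(4) by blast
  then show "P ` W = {0} \<longleftrightarrow> W = {0}" using P0 by auto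
qed

lemma isometry_between_inv_sum:
  assumes P: "isometry_between V \<xi> \<gamma> V' \<xi>' \<gamma>' P" and V: "skew_space \<xi> V \<gamma>"
    and sum: "inv_sum \<xi> \<gamma> V W1 W2"
  shows "inv_sum \<xi>' \<gamma>' V' (P ` W1) (P ` W2)"
proof -
  note PD = isometry_betweenD[OF P] and S = inv_sumD[OF sum]
  have V1: "x \<in> V" if "x \<in> W1" for x using S(5) that by blast
  have V2: "x \<in> V" if "x \<in> W2" for x using S(6) that by blast
  have "subspace (P ` W1)" "subspace (P ` W2)"
    using subspace_image_on[OF linear_on_subset[OF PD(1) S(5) order_refl] S(1)]
      subspace_image_on[OF linear_on_subset[OF PD(1) S(6) order_refl] S(2)] .
  moreover have "V' = {x + y |x y. x \<in> P ` W1 \<and> y \<in> P ` W2}"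
  proof -
    have "P (x + y) = P x + P y" if "x \<in> W1" "y \<in> W2" for x y
      by (rule linear_onD(2)[OF PD(1) V1[OF that(1)] V2[OF that(2)]])
    then have "P ` {x + y |x y. x \<in> W1 \<and> y \<in> W2} = {x + y |x y. x \<in> P ` W1 \<and> y \<in> P ` W2}"
      by (auto simp: image_iff) metis+
    then show ?thesis using PD(3) S(3) by simp
  qed
  moreover have "P ` W1 \<inter> P ` W2 = {0}"
  proof -
    have "P ` W1 \<inter> P ` W2 = P ` (W1 \<inter> W2)"
      by (rule inj_on_image_Int[OF PD(2) S(5,6), symmetric])
    then show ?thesis using S(4) linear_on_0[OF PD(1) skew_spaceD(2)[OF V]] by simp
  qed
  moreover have "\<forall>x\<in>P ` W1. \<forall>y\<in>P ` W2. \<gamma>' x y = 0"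
    using PD(4) V1 V2 S(7) by simp
  moreover have "invariant_under \<xi>' (P ` W1)" "invariant_under \<xi>' (P ` W2)"
    unfolding invariant_under_def using PD(5) V1 V2 S(8,9) by auto
  ultimately show ?thesis unfolding inv_sum_def orthogonal_sum_def by simp
qed

definition nondegenerate_space where
  "nondegenerate_space \<xi> W \<gamma> \<longleftrightarrow> skew_space \<xi> W \<gamma> \<and> nondegenerate_on W \<gamma>"

lemma pairs_iff: "(\<xi>, W, \<gamma>) \<in> pairs \<longleftrightarrow> nondegenerate_space \<xi> W \<gamma> \<and> W \<noteq> {0}"
  unfolding pairs_def nondegenerate_space_def skew_space_def by auto

lemma triples_iff:
  "(V, \<xi>, v0, \<gamma>) \<in> triples \<longleftrightarrow>
    skew_space \<xi> V \<gamma> \<and> v0 \<in> V \<and> v0 \<noteq> 0 \<and> form_kernel V \<gamma> = span {v0} \<and> \<xi> v0 = 0"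
  unfolding triples_def skew_space_def by auto

lemma nondegenerate_space_summands:
  assumes "nondegenerate_space \<xi> W \<gamma>" "inv_sum \<xi> \<gamma> W W1 W2"
  shows "nondegenerate_space \<xi> W1 \<gamma>" "nondegenerate_space \<xi> W2 \<gamma>"
proof -
  have W: "skew_space \<xi> W \<gamma>" "form_kernel W \<gamma> = {0}"
    using assms(1) unfolding nondegenerate_space_def nondegenerate_on_def by simp_all
  have sum': "inv_sum \<xi> \<gamma> W W2 W1" by (rule inv_sum_commute[OF W(1) assms(2)])
  have "0 \<in> W1" "0 \<in> W2" using inv_sumD(1,2)[OF assms(2)] subspace_0 by blast+
  then show "nondegenerate_space \<xi> W1 \<gamma>" "nondegenerate_space \<xi> W2 \<gamma>"
    unfolding nondegenerate_space_def nondegenerate_on_def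
    using inv_sum_kernel[OF W(1) assms(2)] inv_sum_kernel[OF W(1) sum']
      inv_sum_skew_space[OF W(1) assms(2)] W(2) by simp_all
qed

text \<open>The kernel of the form is the line through \<open>v0\<close>, which lies in
  \<open>W1\<close> and meets \<open>W2\<close> only in 0.\<close>

lemma triple_summands:
  assumes T: "(V, \<xi>, v0, \<gamma>) \<in> triples" and sum: "inv_sum \<xi> \<gamma> V W1 W2" and v0: "v0 \<in> W1"
  shows "(W1, \<xi>, v0, \<gamma>) \<in> triples" "nondegenerate_space \<xi> W2 \<gamma>"
proof -
  have V: "skew_space \<xi> V \<gamma>" "form_kernel V \<gamma> = span {v0}" "\<xi> v0 = 0" "v0 \<noteq> 0"
    using T unfolding triples_iff by simp_all
  note S = inv_sumD[OF sum]
  have sum': "inv_sum \<xi> \<gamma> V W2 W1" by (rule inv_sum_commute[OF V(1) sum])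
  have span: "span {v0} \<subseteq> W1" using v0 S(1) by (simp add: span_minimal)
  have "form_kernel W1 \<gamma> = span {v0}"
    using inv_sum_kernel[OF V(1) sum] V(2) span by blast
  then show "(W1, \<xi>, v0, \<gamma>) \<in> triples"
    unfolding triples_iff using V v0 inv_sum_skew_space[OF V(1) sum] by simp
  have "form_kernel W2 \<gamma> = {0}"
    using inv_sum_kernel[OF V(1) sum'] V(2) span S(4) subspace_0[OF S(2)] span_zero by blast
  then show "nondegenerate_space \<xi> W2 \<gamma>"
    unfolding nondegenerate_space_def nondegenerate_on_def
    using inv_sum_skew_space[OF V(1) sum] by simp
qed

section \<open>Equivalence classes and their representatives\<close>

lemma equiv_pair_equiv: "equiv pairs (pair_equiv :: ('a::real_vector pair \<times> 'a pair) set)"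
proof (rule equivI)
  show "(pair_equiv :: ('a pair \<times> 'a pair) set) \<subseteq> pairs \<times> pairs" unfolding pair_equiv_def by auto
  show "refl_on pairs (pair_equiv :: ('a pair \<times> 'a pair) set)"
    unfolding refl_on_def pair_equiv_def using isometry_between_refl by auto
  show "sym (pair_equiv :: ('a pair \<times> 'a pair) set)"
  proof (rule symI)
    fix p p' :: "'a pair" assume pp: "(p, p') \<in> pair_equiv"
    obtain \<xi> W \<gamma> \<xi>' W' \<gamma>' where p_def: "p = (\<xi>, W, \<gamma>)" "p' = (\<xi>', W', \<gamma>')" by (cases p, cases p') auto
    then obtain P where p: "(\<xi>, W, \<gamma>) \<in> pairs" "(\<xi>', W', \<gamma>') \<in> pairs"
      and P: "isometry_between W \<xi> \<gamma> W' \<xi>' \<gamma>' P" using pp unfolding pair_equiv_def by auto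
    then have "skew_space \<xi> W \<gamma>" unfolding pairs_iff nondegenerate_space_def by simp
    from isometry_between_inv[OF P skew_spaceD(2,4)[OF this]] p
    show "(p', p) \<in> pair_equiv" unfolding pair_equiv_def p_def by auto
  qed
  show "trans (pair_equiv :: ('a pair \<times> 'a pair) set)"
    unfolding pair_equiv_def by (rule transI) (auto intro: isometry_between_trans)
qed

lemma equiv_triple_equiv:
  "equiv triples (triple_equiv :: ('a::real_vector triple \<times> 'a triple) set)"
proof (rule equivI)
  show "(triple_equiv :: ('a triple \<times> 'a triple) set) \<subseteq> triples \<times> triples" unfolding triple_equiv_def by auto
  show "refl_on triples (triple_equiv :: ('a triple \<times> 'a triple) set)"
    unfolding refl_on_def triple_equiv_def using isometry_between_refl by auto
  show "sym (triple_equiv :: ('a triple \<times> 'a triple) set)"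
  proof (rule symI)
    fix t t' :: "'a triple" assume tt: "(t, t') \<in> triple_equiv"
    obtain V \<xi> v0 \<gamma> V' \<xi>' v0' \<gamma>' where t_def: "t = (V, \<xi>, v0, \<gamma>)" "t' = (V', \<xi>', v0', \<gamma>')"
      by (cases t, cases t') auto
    then obtain P where p: "(V, \<xi>, v0, \<gamma>) \<in> triples" "(V', \<xi>', v0', \<gamma>') \<in> triples"
      and P: "isometry_between V \<xi> \<gamma> V' \<xi>' \<gamma>' P" "P v0 = v0'"
      using tt unfolding triple_equiv_def by auto
    then have V: "skew_space \<xi> V \<gamma>" "v0 \<in> V" unfolding triples_iff by simp_all
    have "inv_into V P v0' = v0" using isometry_betweenD(2)[OF P(1)] P(2) V(2) by auto
    with isometry_between_inv[OF P(1) skew_spaceD(2,4)[OF V(1)]] p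
    show "(t', t) \<in> triple_equiv" unfolding triple_equiv_def t_def by auto
  qed
  show "trans (triple_equiv :: ('a triple \<times> 'a triple) set)"
  proof (rule transI)
    fix t t' t'' :: "'a triple" assume tt: "(t, t') \<in> triple_equiv" "(t', t'') \<in> triple_equiv"
    obtain V \<xi> v0 \<gamma> V' \<xi>' v0' \<gamma>' V'' \<xi>'' v0'' \<gamma>'' where t_def:
      "t = (V, \<xi>, v0, \<gamma>)" "t' = (V', \<xi>', v0', \<gamma>')" "t'' = (V'', \<xi>'', v0'', \<gamma>'')"
      by (cases t, cases t', cases t'') auto
    then obtain P Q where t: "(V, \<xi>, v0, \<gamma>) \<in> triples" "(V'', \<xi>'', v0'', \<gamma>'') \<in> triples"
      and P: "isometry_between V \<xi> \<gamma> V' \<xi>' \<gamma>' P" "P v0 = v0'"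
      and Q: "isometry_between V' \<xi>' \<gamma>' V'' \<xi>'' \<gamma>'' Q" "Q v0' = v0''"
      using tt unfolding triple_equiv_def by auto
    have "isometry_between V \<xi> \<gamma> V'' \<xi>'' \<gamma>'' (\<lambda>x. Q (P x)) \<and> Q (P v0) = v0''"
      using isometry_between_trans[OF P(1) Q(1)] P(2) Q(2) by simp
    then show "(t, t'') \<in> triple_equiv"
      using t unfolding triple_equiv_def t_def by auto
  qed
qed

lemma type_of_eq_iff:
  assumes "(\<xi>, W, \<gamma>) \<in> pairs" "(\<xi>', W', \<gamma>') \<in> pairs"
  shows "type_of (\<xi>, W, \<gamma>) = type_of (\<xi>', W', \<gamma>') \<longleftrightarrow> (\<exists>P. isometry_between W \<xi> \<gamma> W' \<xi>' \<gamma>' P)"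
  unfolding type_of_def eq_equiv_class_iff[OF equiv_pair_equiv assms]
  using assms by (simp add: pair_equiv_def)

lemma special_type_of_eq_iff:
  assumes "(V, \<xi>, v0, \<gamma>) \<in> triples" "(V', \<xi>', v0', \<gamma>') \<in> triples"
  shows "special_type_of (V, \<xi>, v0, \<gamma>) = special_type_of (V', \<xi>', v0', \<gamma>') \<longleftrightarrow>
    (\<exists>P. isometry_between V \<xi> \<gamma> V' \<xi>' \<gamma>' P \<and> P v0 = v0')"
  unfolding special_type_of_def eq_equiv_class_iff[OF equiv_triple_equiv assms]
  using assms by (simp add: triple_equiv_def)

lemma type_of_in: "p \<in> pairs \<Longrightarrow> type_of p \<in> pair_types"
  unfolding type_of_def pair_types_def by (rule quotientI)

lemma special_type_of_in: "t \<in> triples \<Longrightarrow> special_type_of t \<in> special_types"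
  unfolding special_type_of_def special_types_def by (rule quotientI)

lemma type_of_image:
  assumes P: "isometry_between V \<xi> \<gamma> V' \<xi>' \<gamma>' P" and W: "W \<subseteq> V"
    and "(\<xi>, W, \<gamma>) \<in> pairs" "(\<xi>', P ` W, \<gamma>') \<in> pairs"
  shows "type_of (\<xi>', P ` W, \<gamma>') = type_of (\<xi>, W, \<gamma>)"
  using type_of_eq_iff[OF assms(3,4)] isometry_between_subset[OF P W] by metis

text \<open>The definition of a sum speaks of some representative; carrying its summands along an
  isometry shows that any given representative splits in the same way.\<close>

lemma is_type_sum_iff:
  assumes W: "(\<xi>, W, \<gamma>) \<in> pairs"
  shows "is_type_sum (type_of (\<xi>, W, \<gamma>)) \<tau>1 \<tau>2 \<longleftrightarrow>
    (\<exists>W1 W2. inv_sum \<xi> \<gamma> W W1 W2 \<and> W1 \<noteq> {0} \<and> W2 \<noteq> {0} \<and>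
      \<tau>1 = type_of (\<xi>, W1, \<gamma>) \<and> \<tau>2 = type_of (\<xi>, W2, \<gamma>))" (is "?L \<longleftrightarrow> ?R")
proof
  assume ?L
  then obtain \<xi>' V \<gamma>' V1 V2 where V: "(\<xi>', V, \<gamma>') \<in> pairs" and sum: "inv_sum \<xi>' \<gamma>' V V1 V2"
    and ne: "V1 \<noteq> {0}" "V2 \<noteq> {0}" and eq: "type_of (\<xi>, W, \<gamma>) = type_of (\<xi>', V, \<gamma>')"
    and \<tau>: "\<tau>1 = type_of (\<xi>', V1, \<gamma>')" "\<tau>2 = type_of (\<xi>', V2, \<gamma>')"
    unfolding is_type_sum_def inv_sum_def by blast
  obtain P where P: "isometry_between V \<xi>' \<gamma>' W \<xi> \<gamma> P"
    using type_of_eq_iff[OF V W] eq by auto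
  have ndV: "nondegenerate_space \<xi>' V \<gamma>'" and ndW: "nondegenerate_space \<xi> W \<gamma>"
    using V W unfolding pairs_iff by simp_all
  then have skV: "skew_space \<xi>' V \<gamma>'" unfolding nondegenerate_space_def by simp
  note S = inv_sumD[OF sum]
  have sum': "inv_sum \<xi> \<gamma> W (P ` V1) (P ` V2)" by (rule isometry_between_inv_sum[OF P skV sum])
  have ne': "P ` V1 \<noteq> {0}" "P ` V2 \<noteq> {0}"
    using isometry_between_0(2)[OF P skew_spaceD(2)[OF skV]] S(5,6) ne
      subspace_0[OF S(1)] subspace_0[OF S(2)] by simp_all
  have "type_of (\<xi>, P ` V1, \<gamma>) = \<tau>1" "type_of (\<xi>, P ` V2, \<gamma>) = \<tau>2"
    unfolding \<tau> using ne ne' nondegenerate_space_summands[OF ndV sum]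
      nondegenerate_space_summands[OF ndW sum'] S(5,6)
    by (intro type_of_image[OF P]; simp add: pairs_iff)+
  then show ?R using sum' ne' by blast
next
  assume ?R
  then obtain W1 W2 where R: "inv_sum \<xi> \<gamma> W W1 W2" "W1 \<noteq> {0}" "W2 \<noteq> {0}"
    "\<tau>1 = type_of (\<xi>, W1, \<gamma>)" "\<tau>2 = type_of (\<xi>, W2, \<gamma>)" by blast
  have "nondegenerate_on W1 \<gamma>" "nondegenerate_on W2 \<gamma>"
    using nondegenerate_space_summands[OF _ R(1)] W
    unfolding pairs_iff nondegenerate_space_def by simp_all
  then show ?L unfolding is_type_sum_def using W R unfolding inv_sum_def by blast
qed

lemma indecomposable_type_iff:
  assumes "(\<xi>, W, \<gamma>) \<in> pairs"
  shows "indecomposable_type (type_of (\<xi>, W, \<gamma>)) \<longleftrightarrow> indecomposable_space \<xi> W \<gamma>"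
  unfolding indecomposable_type_def indecomposable_space_def is_type_sum_iff[OF assms]
  using type_of_in[OF assms] by blast

lemma is_special_sum_iff:
  assumes T: "(V, \<xi>, v0, \<gamma>) \<in> triples"
  shows "is_special_sum (special_type_of (V, \<xi>, v0, \<gamma>)) \<Delta> \<tau> \<longleftrightarrow>
    (\<exists>W1 W2. inv_sum \<xi> \<gamma> V W1 W2 \<and> v0 \<in> W1 \<and> W2 \<noteq> {0} \<and>
      \<Delta> = special_type_of (W1, \<xi>, v0, \<gamma>) \<and> \<tau> = type_of (\<xi>, W2, \<gamma>))" (is "?L \<longleftrightarrow> ?R")
proof
  assume ?L
  then obtain \<xi>' U u0 \<gamma>' U1 U2 where U: "(U, \<xi>', u0, \<gamma>') \<in> triples" and sum: "inv_sum \<xi>' \<gamma>' U U1 U2"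
    and ne: "U2 \<noteq> {0}" and u0: "u0 \<in> U1"
    and eq: "special_type_of (V, \<xi>, v0, \<gamma>) = special_type_of (U, \<xi>', u0, \<gamma>')"
    and \<tau>: "\<Delta> = special_type_of (U1, \<xi>', u0, \<gamma>')" "\<tau> = type_of (\<xi>', U2, \<gamma>')"
    unfolding is_special_sum_def inv_sum_def by blast
  obtain P where P: "isometry_between U \<xi>' \<gamma>' V \<xi> \<gamma> P" "P u0 = v0"
    using special_type_of_eq_iff[OF U T] eq by auto
  have skU: "skew_space \<xi>' U \<gamma>'" using U unfolding triples_iff by simp
  note S = inv_sumD[OF sum]
  have sum': "inv_sum \<xi> \<gamma> V (P ` U1) (P ` U2)" by (rule isometry_between_inv_sum[OF P(1) skU sum])
  have v0: "v0 \<in> P ` U1" using u0 P(2) by blast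
  have ne': "P ` U2 \<noteq> {0}"
    using isometry_between_0(2)[OF P(1) skew_spaceD(2)[OF skU] S(6) subspace_0[OF S(2)]] ne by simp
  have "type_of (\<xi>, P ` U2, \<gamma>) = \<tau>"
    unfolding \<tau> using triple_summands(2)[OF U sum u0] triple_summands(2)[OF T sum' v0] ne ne'
    by (intro type_of_image[OF P(1) S(6)]; simp add: pairs_iff)
  moreover have "\<Delta> = special_type_of (P ` U1, \<xi>, v0, \<gamma>)"
    unfolding \<tau> special_type_of_eq_iff[OF triple_summands(1)[OF U sum u0] triple_summands(1)[OF T sum' v0]]
    using isometry_between_subset[OF P(1) S(5)] P(2) by blast
  ultimately show ?R using sum' ne' v0 by blast
next
  assume ?R
  then obtain W1 W2 where R: "inv_sum \<xi> \<gamma> V W1 W2" "v0 \<in> W1" "W2 \<noteq> {0}"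
    "\<Delta> = special_type_of (W1, \<xi>, v0, \<gamma>)" "\<tau> = type_of (\<xi>, W2, \<gamma>)" by blast
  have "form_kernel W1 \<gamma> = span {v0}"
    using triple_summands(1)[OF T R(1,2)] unfolding triples_iff by simp
  then show ?L unfolding is_special_sum_def using T R unfolding inv_sum_def by blast
qed

definition special_indecomposable_space where
  "special_indecomposable_space \<xi> V v0 \<gamma> \<longleftrightarrow>
     (\<forall>W1 W2. inv_sum \<xi> \<gamma> V W1 W2 \<and> v0 \<in> W1 \<longrightarrow> W2 = {0})"

lemma indecomposable_special_type_iff:
  assumes "(V, \<xi>, v0, \<gamma>) \<in> triples"
  shows "indecomposable_special_type (special_type_of (V, \<xi>, v0, \<gamma>)) \<longleftrightarrow>
    special_indecomposable_space \<xi> V v0 \<gamma>"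
  unfolding indecomposable_special_type_def special_indecomposable_space_def is_special_sum_iff[OF assms]
  using special_type_of_in[OF assms] by blast

text \<open>Counterpart of \<open>is_type_sum_list\<close> inside one fixed space. The empty list
  stands for the zero space, so that summands can be removed one at a time until nothing is
  left.\<close>

fun decomposes ::
  "('a::real_vector \<Rightarrow> 'a) \<Rightarrow> ('a \<Rightarrow> 'a \<Rightarrow> real) \<Rightarrow> 'a set \<Rightarrow> 'a pair set list \<Rightarrow> bool" where
  "decomposes \<xi> \<gamma> W [] \<longleftrightarrow> W = {0}"
| "decomposes \<xi> \<gamma> W (\<tau> # \<tau>s) \<longleftrightarrow>
     (\<exists>W1 W2. inv_sum \<xi> \<gamma> W W1 W2 \<and> (\<xi>, W1, \<gamma>) \<in> pairs \<and> type_of (\<xi>, W1, \<gamma>) = \<tau> \<and>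
       decomposes \<xi> \<gamma> W2 \<tau>s)"

lemma decomposes_isometry:
  assumes "decomposes \<xi> \<gamma> W \<tau>s" "isometry_between W \<xi> \<gamma> W' \<xi>' \<gamma>' P"
    "nondegenerate_space \<xi> W \<gamma>" "nondegenerate_space \<xi>' W' \<gamma>'"
  shows "decomposes \<xi>' \<gamma>' W' \<tau>s"
  using assms
proof (induction \<tau>s arbitrary: W W' P)
  case Nil
  have "subspace W" using Nil.prems(3) skew_spaceD(2) unfolding nondegenerate_space_def by blast
  then show ?case
    using Nil.prems(1) isometry_betweenD(3)[OF Nil.prems(2)]
      isometry_between_0(1)[OF Nil.prems(2) _ order_refl] by (auto simp: subspace_0)
next
  case (Cons \<tau> \<tau>s)
  note P = Cons.prems(2)
  obtain W1 W2 where W: "inv_sum \<xi> \<gamma> W W1 W2" "(\<xi>, W1, \<gamma>) \<in> pairs" "type_of (\<xi>, W1, \<gamma>) = \<tau>"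
    "decomposes \<xi> \<gamma> W2 \<tau>s" using Cons.prems(1) by auto
  note S = inv_sumD[OF W(1)]
  have skW: "skew_space \<xi> W \<gamma>" using Cons.prems(3) unfolding nondegenerate_space_def by simp
  have sum': "inv_sum \<xi>' \<gamma>' W' (P ` W1) (P ` W2)" by (rule isometry_between_inv_sum[OF P skW W(1)])
  have "P ` W1 \<noteq> {0}"
    using isometry_between_0(2)[OF P skew_spaceD(2)[OF skW] S(5) subspace_0[OF S(1)]] W(2)
    unfolding pairs_iff by simp
  then have p: "(\<xi>', P ` W1, \<gamma>') \<in> pairs"
    unfolding pairs_iff using nondegenerate_space_summands(1)[OF Cons.prems(4) sum'] by simp
  have "decomposes \<xi>' \<gamma>' (P ` W2) \<tau>s"
    by (rule Cons.IH[OF W(4) isometry_between_subset[OF P S(6)]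
          nondegenerate_space_summands(2)[OF Cons.prems(3) W(1)]
          nondegenerate_space_summands(2)[OF Cons.prems(4) sum']])
  then show ?case
    unfolding decomposes.simps using sum' p type_of_image[OF P S(5) W(2) p] W(3) by blast
qed

lemma decomposes_nonzero:
  assumes "decomposes \<xi> \<gamma> W (\<tau> # \<tau>s)"
  shows "W \<noteq> {0}"
proof -
  obtain W1 W2 where W: "inv_sum \<xi> \<gamma> W W1 W2" "(\<xi>, W1, \<gamma>) \<in> pairs"
    using assms by auto
  have "W1 \<subseteq> W" "0 \<in> W1" using inv_sumD(5)[OF W(1)] subspace_0[OF inv_sumD(1)[OF W(1)]] .
  then show ?thesis using W(2) unfolding pairs_iff by blast
qed

lemma is_type_sum_list_iff:
  assumes "(\<xi>, W, \<gamma>) \<in> pairs"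
  shows "is_type_sum_list (type_of (\<xi>, W, \<gamma>)) \<tau>s \<longleftrightarrow> \<tau>s \<noteq> [] \<and> decomposes \<xi> \<gamma> W \<tau>s"
  using assms
proof (induction \<tau>s arbitrary: W)
  case (Cons \<tau> \<tau>s)
  have nd: "nondegenerate_space \<xi> W \<gamma>" using Cons.prems unfolding pairs_iff by simp
  then have sk: "skew_space \<xi> W \<gamma>" unfolding nondegenerate_space_def by simp
  show ?case
  \<comment> \<open>A one-element list ends with a type in \<open>is_type_sum_list\<close> but with
    the zero space in \<open>decomposes\<close>, so it is compared separately.\<close>
  proof (cases \<tau>s)
    case Nil
    have "decomposes \<xi> \<gamma> W [\<tau>] \<longleftrightarrow> type_of (\<xi>, W, \<gamma>) = \<tau>"
    proof
      assume "decomposes \<xi> \<gamma> W [\<tau>]"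
      then obtain W1 where "inv_sum \<xi> \<gamma> W W1 {0}" "type_of (\<xi>, W1, \<gamma>) = \<tau>" by auto
      then show "type_of (\<xi>, W, \<gamma>) = \<tau>" using inv_sum_zero_right by metis
    qed (use inv_sum_trivial[OF sk] Cons.prems in auto)
    then show ?thesis using Nil type_of_in[OF Cons.prems] by simp
  next
    case \<tau>s: (Cons \<tau>' \<tau>s')
    have IH: "is_type_sum_list (type_of (\<xi>, W2, \<gamma>)) \<tau>s \<longleftrightarrow> decomposes \<xi> \<gamma> W2 \<tau>s"
      if "inv_sum \<xi> \<gamma> W W1 W2" "W2 \<noteq> {0}" for W1 W2
      using Cons.IH[of W2] nondegenerate_space_summands(2)[OF nd that(1)] that(2)
      by (simp add: pairs_iff \<tau>s)
    have pair: "(\<xi>, W1, \<gamma>) \<in> pairs \<longleftrightarrow> W1 \<noteq> {0}" if "inv_sum \<xi> \<gamma> W W1 W2" for W1 W2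
      using nondegenerate_space_summands(1)[OF nd that] by (simp add: pairs_iff)
    have nonzero: "W2 \<noteq> {0}" if "decomposes \<xi> \<gamma> W2 \<tau>s" for W2
      using decomposes_nonzero that unfolding \<tau>s by blast
    have "is_type_sum_list (type_of (\<xi>, W, \<gamma>)) (\<tau> # \<tau>s) \<longleftrightarrow>
        (\<exists>W1 W2. inv_sum \<xi> \<gamma> W W1 W2 \<and> W1 \<noteq> {0} \<and> W2 \<noteq> {0} \<and> type_of (\<xi>, W1, \<gamma>) = \<tau> \<and>
          is_type_sum_list (type_of (\<xi>, W2, \<gamma>)) \<tau>s)"
      unfolding \<tau>s is_type_sum_list.simps(3) is_type_sum_iff[OF Cons.prems] by blast
    also have "\<dots> \<longleftrightarrow> decomposes \<xi> \<gamma> W (\<tau> # \<tau>s)"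
      unfolding decomposes.simps(2) using IH pair nonzero by blast
    finally show ?thesis by simp
  qed
qed simp

section \<open>Existence\<close>

lemma inv_sum_dim_less:
  assumes V: "skew_space \<xi> V \<gamma>" and sum: "inv_sum \<xi> \<gamma> V W1 W2" and "W2 \<noteq> {0}"
  shows "dim W1 < dim V"
proof -
  note S = inv_sumD[OF sum]
  have "W1 \<noteq> V"
  proof
    assume "W1 = V"
    then have "W2 \<subseteq> {0}" using S(4,6) by blast
    then show False using assms(3) subspace_0[OF S(2)] by blast
  qed
  then show ?thesis using dim_less[OF skew_spaceD(1)[OF V] S(1)] S(5) by blast
qed

lemma decomposes_indecomposable_exists:
  assumes "nondegenerate_space \<xi> W \<gamma>"
  shows "\<exists>\<tau>s. (\<forall>\<tau>\<in>set \<tau>s. indecomposable_type \<tau>) \<and> decomposes \<xi> \<gamma> W \<tau>s"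
  using assms
proof (induction "dim W" arbitrary: W rule: less_induct)
  case less
  have sk: "skew_space \<xi> W \<gamma>" using less.prems unfolding nondegenerate_space_def by simp
  show ?case
  proof (cases "W = {0}")
    case True
    then show ?thesis by (intro exI[of _ "[]"]) simp
  next
    case False
    let ?P = "\<lambda>W1. W1 \<noteq> {0} \<and> (\<exists>W2. inv_sum \<xi> \<gamma> W W1 W2)"
    have "?P W" using False inv_sum_trivial[OF sk] by blast
    then obtain W1 where W1: "?P W1" and min: "\<And>A. ?P A \<Longrightarrow> dim W1 \<le> dim A"
      using ex_has_least_nat[of ?P W dim] by blast
    then obtain W2 where sum: "inv_sum \<xi> \<gamma> W W1 W2" by blast
    have sum': "inv_sum \<xi> \<gamma> W W2 W1" by (rule inv_sum_commute[OF sk sum])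
    note sk1 = inv_sum_skew_space(1)[OF sk sum]
    have "indecomposable_space \<xi> W1 \<gamma>"
      unfolding indecomposable_space_def
    proof (intro allI impI)
      fix A A' assume A: "inv_sum \<xi> \<gamma> W1 A A'"
      show "A = {0} \<or> A' = {0}"
      proof (rule ccontr)
        assume ne: "\<not> (A = {0} \<or> A' = {0})"
        then have "dim A < dim W1" using inv_sum_dim_less[OF sk1 A] by simp
        moreover have "dim W1 \<le> dim A" by (rule min) (use inv_sum_assoc(1)[OF sk sum A] ne in blast)
        ultimately show False by simp
      qed
    qed
    moreover have p: "(\<xi>, W1, \<gamma>) \<in> pairs"
      using nondegenerate_space_summands(1)[OF less.prems sum] W1 unfolding pairs_iff by blast
    ultimately have ind: "indecomposable_type (type_of (\<xi>, W1, \<gamma>))"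
      using indecomposable_type_iff by blast
    have "dim W2 < dim W" using inv_sum_dim_less[OF sk sum'] W1 by blast
    from less.hyps[OF this nondegenerate_space_summands(2)[OF less.prems sum]]
    obtain \<tau>s where "\<forall>\<tau>\<in>set \<tau>s. indecomposable_type \<tau>" "decomposes \<xi> \<gamma> W2 \<tau>s" by blast
    then show ?thesis using sum p ind by (intro exI[of _ "type_of (\<xi>, W1, \<gamma>) # \<tau>s"]) auto
  qed
qed

lemma special_indecomposable_summand_exists:
  assumes T: "(V, \<xi>, v0, \<gamma>) \<in> triples"
  obtains W1 W2 where "inv_sum \<xi> \<gamma> V W1 W2" "v0 \<in> W1" "special_indecomposable_space \<xi> W1 v0 \<gamma>"
proof -
  have sk: "skew_space \<xi> V \<gamma>" and v0: "v0 \<in> V" using T unfolding triples_iff by simp_all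
  let ?P = "\<lambda>W1. v0 \<in> W1 \<and> (\<exists>W2. inv_sum \<xi> \<gamma> V W1 W2)"
  have "?P V" using v0 inv_sum_trivial[OF sk] by blast
  then obtain W1 where W1: "?P W1" and min: "\<And>A. ?P A \<Longrightarrow> dim W1 \<le> dim A"
    using ex_has_least_nat[of ?P V dim] by blast
  then obtain W2 where sum: "inv_sum \<xi> \<gamma> V W1 W2" by blast
  note sk1 = inv_sum_skew_space(1)[OF sk sum]
  have "special_indecomposable_space \<xi> W1 v0 \<gamma>"
    unfolding special_indecomposable_space_def
  proof (intro allI impI)
    fix A A' assume A: "inv_sum \<xi> \<gamma> W1 A A' \<and> v0 \<in> A"
    show "A' = {0}"
    proof (rule ccontr)
      assume ne: "A' \<noteq> {0}"
      then have "dim A < dim W1" using inv_sum_dim_less[OF sk1 conjunct1[OF A]] by simp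
      moreover have "dim W1 \<le> dim A" by (rule min) (use inv_sum_assoc(1)[OF sk sum conjunct1[OF A]] A in blast)
      ultimately show False by simp
    qed
  qed
  then show thesis using that sum W1 by blast
qed

lemma endo_skew_space: "skew_space \<xi> V \<gamma> \<Longrightarrow> linear_on V V f \<Longrightarrow> endo V f"
  by (simp add: endo_def skew_spaceD(2))

text \<open>\<open>v0\<close> lies in the Fitting kernel of \<open>f\<close>, so the complementary
  part could be split off as a type and must vanish. Applied with \<open>\<epsilon> = -1\<close> to
  \<open>\<xi>\<close> and with \<open>\<epsilon> = 1\<close> to \<open>B - 1\<close>.\<close>

lemma special_indecomposable_nilpotent:
  assumes T: "(V, \<xi>, v0, \<gamma>) \<in> triples" and ind: "special_indecomposable_space \<xi> V v0 \<gamma>"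
    and f: "linear_on V V f" and com: "\<And>x. x \<in> V \<Longrightarrow> \<xi> (f x) = f (\<xi> x)"
    and adj: "\<And>x y. x \<in> V \<Longrightarrow> y \<in> V \<Longrightarrow> \<gamma> (f x) y = \<epsilon> * \<gamma> x (f y)" "\<epsilon> \<noteq> 0"
    and v0: "f v0 = 0"
  shows "\<exists>n. \<forall>x\<in>V. (f ^^ n) x = 0"
proof -
  have sk: "skew_space \<xi> V \<gamma>" and v0V: "v0 \<in> V" using T unfolding triples_iff by simp_all
  interpret endo V f by (rule endo_skew_space[OF sk f])
  obtain n u I where n: "n > 0" and sum: "inv_sum \<xi> \<gamma> V {x \<in> V. (f ^^ n) x = 0} I"
    by (rule fitting_inv_sum[OF sk com adj])
  have "(f ^^ n) v0 = 0"
  proof -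
    have f0: "f 0 = 0" by (rule linear_on_0[OF f sub])
    obtain m where m: "n = Suc m" using n by (cases n) auto
    have "(f ^^ k) 0 = 0" for k by (induction k) (simp_all add: f0)
    then show ?thesis unfolding m funpow_Suc_right comp_def v0 .
  qed
  then have "I = {0}"
    using ind sum v0V unfolding special_indecomposable_space_def by blast
  then have "{x \<in> V. (f ^^ n) x = 0} = V" using inv_sum_zero_right sum by metis
  then show ?thesis by blast
qed

text \<open>Here \<open>v0\<close> lies in the other Fitting part: \<open>f ^^ n\<close> kills its
  component in the kernel, so the nonzero multiple \<open>c ^ n\<close> of \<open>v0\<close> is the
  image of the component in \<open>I\<close>. Now the kernel is the part that could be split
  off.\<close>

lemma special_indecomposable_invertible:
  assumes T: "(V, \<xi>, v0, \<gamma>) \<in> triples" and ind: "special_indecomposable_space \<xi> V v0 \<gamma>"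
    and f: "linear_on V V f" and com: "\<And>x. x \<in> V \<Longrightarrow> \<xi> (f x) = f (\<xi> x)"
    and adj: "\<And>x y. x \<in> V \<Longrightarrow> y \<in> V \<Longrightarrow> \<gamma> (f x) y = \<gamma> x (f y)"
    and v0: "f v0 = c *\<^sub>R v0" "c \<noteq> 0"
  shows "\<exists>u. \<forall>x\<in>V. papp u f (f x) = x"
proof -
  have sk: "skew_space \<xi> V \<gamma>" and v0V: "v0 \<in> V" using T unfolding triples_iff by simp_all
  interpret endo V f by (rule endo_skew_space[OF sk f])
  have adj1: "\<And>x y. x \<in> V \<Longrightarrow> y \<in> V \<Longrightarrow> \<gamma> (f x) y = 1 * \<gamma> x (f y)" using adj by simp
  obtain n u I where sum: "inv_sum \<xi> \<gamma> V {x \<in> V. (f ^^ n) x = 0} I"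
    and u: "\<And>x. x \<in> I \<Longrightarrow> papp u f (f x) = x" and fI: "\<And>x. x \<in> I \<Longrightarrow> f x \<in> I"
  proof (rule fitting_inv_sum[OF sk com adj1])
    fix n u I
    assume *: "inv_sum \<xi> \<gamma> V {x \<in> V. (f ^^ n) x = 0} I"
      "\<And>x. x \<in> I \<Longrightarrow> papp u f (f x) = x" "\<And>x. x \<in> I \<Longrightarrow> f x \<in> I"
    show thesis by (rule that[OF *])
  qed simp_all
  let ?K = "{x \<in> V. (f ^^ n) x = 0}"
  note S = inv_sumD[OF sum]
  obtain k i where ki: "v0 = k + i" "k \<in> ?K" "i \<in> I" using v0V S(3) by blast
  have "(f ^^ m) v0 = c ^ m *\<^sub>R v0" for m
    using v0V by (induction m) (simp_all add: v0(1) linear_onD(3)[OF f] mult.commute)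
  moreover have "(f ^^ n) v0 = (f ^^ n) i"
  proof -
    have kV: "k \<in> V" "i \<in> V" "(f ^^ n) k = 0" using ki S(6) by auto
    have "(f ^^ n) x = papp ([:0, 1:] ^ n) f x" if "x \<in> V" for x using papp_X_power[OF that] by simp
    then show ?thesis
      using linear_onD(2)[OF linear_papp kV(1,2), of "[:0, 1:] ^ n"] kV ki(1) v0V by simp
  qed
  moreover have "(f ^^ m) i \<in> I" for m using ki(3) fI by (induction m) simp_all
  ultimately have "c ^ n *\<^sub>R v0 \<in> I" by metis
  then have "(1 / c ^ n) *\<^sub>R c ^ n *\<^sub>R v0 \<in> I" by (rule subspace_scale[OF S(2)])
  then have "v0 \<in> I" using v0(2) by simp
  then have "?K = {0}"
    using ind inv_sum_commute[OF sk sum] unfolding special_indecomposable_space_def by blast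
  then have "I = V" using inv_sum_zero_left sum by metis
  then show ?thesis using u by blast
qed

lemma special_indecomposable_decomposition_exists:
  assumes T: "(V, \<xi>, v0, \<gamma>) \<in> triples"
  shows "\<exists>\<Delta>0 \<tau>s. indecomposable_decomposition (special_type_of (V, \<xi>, v0, \<gamma>)) \<Delta>0 \<tau>s"
proof -
  obtain W1 W2 where sum: "inv_sum \<xi> \<gamma> V W1 W2" and v0: "v0 \<in> W1"
    and ind: "special_indecomposable_space \<xi> W1 v0 \<gamma>"
    by (rule special_indecomposable_summand_exists[OF T])
  note T1 = triple_summands(1)[OF T sum v0] and nd2 = triple_summands(2)[OF T sum v0]
  have sk1: "skew_space \<xi> W1 \<gamma>" and \<xi>0: "\<xi> v0 = 0" using T1 unfolding triples_iff by simp_all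
  have "\<exists>n. \<forall>x\<in>W1. (\<xi> ^^ n) x = 0"
    using skew_spaceD(6)[OF sk1] \<xi>0
    by (intro special_indecomposable_nilpotent[OF T1 ind skew_spaceD(4)[OF sk1], of "-1"]) simp_all
  then have nil: "nilpotent_special_type (special_type_of (W1, \<xi>, v0, \<gamma>))"
    unfolding nilpotent_special_type_def
    using special_type_of_in[OF T1] equiv_class_self[OF equiv_triple_equiv T1]
    unfolding special_type_of_def by blast
  have ind1: "indecomposable_special_type (special_type_of (W1, \<xi>, v0, \<gamma>))"
    using indecomposable_special_type_iff[OF T1] ind by simp
  obtain \<tau>s where \<tau>s: "\<forall>\<tau>\<in>set \<tau>s. indecomposable_type \<tau>" "decomposes \<xi> \<gamma> W2 \<tau>s"
    using decomposes_indecomposable_exists[OF nd2] by blast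
  have "is_special_sum_list (special_type_of (V, \<xi>, v0, \<gamma>)) (special_type_of (W1, \<xi>, v0, \<gamma>)) \<tau>s"
  proof (cases \<tau>s)
    case Nil
    then have "W1 = V" using inv_sum_zero_right sum \<tau>s(2) by (metis decomposes.simps(1))
    then show ?thesis unfolding is_special_sum_list_def using Nil by simp
  next
    case (Cons \<tau> \<tau>s')
    then have ne: "W2 \<noteq> {0}" using decomposes_nonzero \<tau>s(2) by blast
    then have "(\<xi>, W2, \<gamma>) \<in> pairs" using nd2 unfolding pairs_iff by simp
    then have "is_type_sum_list (type_of (\<xi>, W2, \<gamma>)) \<tau>s"
      using is_type_sum_list_iff \<tau>s(2) Cons by blast
    moreover have "is_special_sum (special_type_of (V, \<xi>, v0, \<gamma>)) (special_type_of (W1, \<xi>, v0, \<gamma>))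
        (type_of (\<xi>, W2, \<gamma>))"
      unfolding is_special_sum_iff[OF T] using sum v0 ne by blast
    ultimately show ?thesis unfolding is_special_sum_list_def using Cons by auto
  qed
  then show ?thesis unfolding indecomposable_decomposition_def using ind1 nil \<tau>s(1) by blast
qed

lemma indecomposable_decompositionD:
  assumes T: "(V, \<xi>, v0, \<gamma>) \<in> triples"
    and dec: "indecomposable_decomposition (special_type_of (V, \<xi>, v0, \<gamma>)) \<Delta>0 \<tau>s"
  obtains W1 W2 where "inv_sum \<xi> \<gamma> V W1 W2" "v0 \<in> W1" "special_indecomposable_space \<xi> W1 v0 \<gamma>"
    "\<Delta>0 = special_type_of (W1, \<xi>, v0, \<gamma>)" "decomposes \<xi> \<gamma> W2 \<tau>s"
    "\<And>\<tau>. \<tau> \<in> set \<tau>s \<Longrightarrow> indecomposable_type \<tau>"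
proof -
  have sk: "skew_space \<xi> V \<gamma>" and v0: "v0 \<in> V" using T unfolding triples_iff by simp_all
  have d: "indecomposable_special_type \<Delta>0" "\<And>\<tau>. \<tau> \<in> set \<tau>s \<Longrightarrow> indecomposable_type \<tau>"
    "is_special_sum_list (special_type_of (V, \<xi>, v0, \<gamma>)) \<Delta>0 \<tau>s"
    using dec unfolding indecomposable_decomposition_def by blast+
  show thesis
  proof (cases "\<tau>s = []")
    case True
    then have \<Delta>0: "\<Delta>0 = special_type_of (V, \<xi>, v0, \<gamma>)"
      using d(3) unfolding is_special_sum_list_def by simp
    then have "special_indecomposable_space \<xi> V v0 \<gamma>"
      using indecomposable_special_type_iff[OF T] d(1) by simp
    then show thesis
      by (intro that[OF inv_sum_trivial[OF sk] v0 _ \<Delta>0 _ d(2)]) (simp_all add: True)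
  next
    case False
    then obtain \<tau> where \<tau>: "is_type_sum_list \<tau> \<tau>s" "is_special_sum (special_type_of (V, \<xi>, v0, \<gamma>)) \<Delta>0 \<tau>"
      using d(3) unfolding is_special_sum_list_def by auto
    then obtain W1 W2 where W: "inv_sum \<xi> \<gamma> V W1 W2" "v0 \<in> W1" "W2 \<noteq> {0}"
      "\<Delta>0 = special_type_of (W1, \<xi>, v0, \<gamma>)" "\<tau> = type_of (\<xi>, W2, \<gamma>)"
      unfolding is_special_sum_iff[OF T] by blast
    have "(\<xi>, W2, \<gamma>) \<in> pairs" using triple_summands(2)[OF T W(1,2)] W(3) unfolding pairs_iff by simp
    then have "decomposes \<xi> \<gamma> W2 \<tau>s" using is_type_sum_list_iff \<tau>(1) W(5) by blast
    moreover have "special_indecomposable_space \<xi> W1 v0 \<gamma>"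
      using indecomposable_special_type_iff[OF triple_summands(1)[OF T W(1,2)]] d(1) W(4) by simp
    ultimately show thesis by (intro that[OF W(1,2) _ W(4) _ d(2)])
  qed
qed

section \<open>Uniqueness\<close>

text \<open>\<open>N j\<close> realises the \<open>j\<close>-th type, and \<open>N' j\<close> is the
  sum of the other summands, so it decomposes into the list with the \<open>j\<close>-th entry
  removed.\<close>

lemma decomposes_projections:
  assumes "decomposes \<xi> \<gamma> W \<tau>s" "skew_space \<xi> W \<gamma>"
  shows "\<exists>N N'. (\<forall>j<length \<tau>s. inv_sum \<xi> \<gamma> W (N j) (N' j) \<and> (\<xi>, N j, \<gamma>) \<in> pairs \<and>
      type_of (\<xi>, N j, \<gamma>) = \<tau>s ! j \<and> decomposes \<xi> \<gamma> (N' j) (take j \<tau>s @ drop (Suc j) \<tau>s)) \<and>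
    (\<forall>x\<in>W. (\<Sum>j<length \<tau>s. proj (N j) (N' j) x) = x)"
  using assms
proof (induction \<tau>s arbitrary: W)
  case Nil
  then show ?case by simp
next
  case (Cons \<tau> \<tau>s)
  obtain W1 W2 where sum: "inv_sum \<xi> \<gamma> W W1 W2" and p: "(\<xi>, W1, \<gamma>) \<in> pairs"
    and \<tau>: "type_of (\<xi>, W1, \<gamma>) = \<tau>" and dec: "decomposes \<xi> \<gamma> W2 \<tau>s"
    using Cons.prems(1) by auto
  note sk = Cons.prems(2)
  have sum': "inv_sum \<xi> \<gamma> W W2 W1" by (rule inv_sum_commute[OF sk sum])
  note sk2 = inv_sum_skew_space(2)[OF sk sum]
  obtain M M' where M: "\<And>j. j < length \<tau>s \<Longrightarrow> inv_sum \<xi> \<gamma> W2 (M j) (M' j)"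
    "\<And>j. j < length \<tau>s \<Longrightarrow> (\<xi>, M j, \<gamma>) \<in> pairs"
    "\<And>j. j < length \<tau>s \<Longrightarrow> type_of (\<xi>, M j, \<gamma>) = \<tau>s ! j"
    "\<And>j. j < length \<tau>s \<Longrightarrow> decomposes \<xi> \<gamma> (M' j) (take j \<tau>s @ drop (Suc j) \<tau>s)"
    and M_sum: "\<And>x. x \<in> W2 \<Longrightarrow> (\<Sum>j<length \<tau>s. proj (M j) (M' j) x) = x"
    using Cons.IH[OF dec sk2] by blast
  \<comment> \<open>The complement of \<open>M j\<close> in all of \<open>W\<close>: what remains of
    \<open>W2\<close>, together with the head summand \<open>W1\<close>.\<close>
  define R where "R j = {x + y |x y. x \<in> M' j \<and> y \<in> W1}" for j
  define N where "N = case_nat W1 M"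
  define N' where "N' = case_nat W2 R"
  have R: "inv_sum \<xi> \<gamma> W (M j) (R j)" "inv_sum \<xi> \<gamma> (R j) W1 (M' j)" if "j < length \<tau>s" for j
  proof -
    show 1: "inv_sum \<xi> \<gamma> W (M j) (R j)"
      unfolding R_def by (rule inv_sum_assoc(1)[OF sk sum' M(1)[OF that]])
    have "inv_sum \<xi> \<gamma> (R j) (M' j) W1"
      unfolding R_def by (rule inv_sum_assoc(2)[OF sk sum' M(1)[OF that]])
    then show "inv_sum \<xi> \<gamma> (R j) W1 (M' j)"
      by (rule inv_sum_commute[OF inv_sum_skew_space(2)[OF sk 1]])
  qed
  have "inv_sum \<xi> \<gamma> W (N j) (N' j) \<and> (\<xi>, N j, \<gamma>) \<in> pairs \<and> type_of (\<xi>, N j, \<gamma>) = (\<tau> # \<tau>s) ! j \<and>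
      decomposes \<xi> \<gamma> (N' j) (take j (\<tau> # \<tau>s) @ drop (Suc j) (\<tau> # \<tau>s))"
    if "j < length (\<tau> # \<tau>s)" for j
  proof (cases j)
    case 0
    then show ?thesis unfolding N_def N'_def using sum p \<tau> dec by simp
  next
    case (Suc i)
    then have i: "i < length \<tau>s" using that by simp
    have "decomposes \<xi> \<gamma> (R i) (\<tau> # (take i \<tau>s @ drop (Suc i) \<tau>s))"
      unfolding decomposes.simps using R(2)[OF i] p \<tau> M(4)[OF i] by blast
    then show ?thesis unfolding N_def N'_def Suc using R(1)[OF i] M(2,3)[OF i] by simp
  qed
  moreover have "(\<Sum>j<length (\<tau> # \<tau>s). proj (N j) (N' j) x) = x" if x: "x \<in> W" for x
  proof -
    interpret W: sum_decomp \<xi> \<gamma> W W1 W2 by unfold_locales (rule sk, rule sum)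
    let ?x1 = "proj W1 W2 x"
    let ?x2 = "x - ?x1"
    have x1: "?x1 \<in> W1" and x2: "?x2 \<in> W2" using W.proj_in[OF x] .
    \<comment> \<open>The \<open>W1\<close> component of \<open>x\<close> lies in the complement
      \<open>R j\<close> and drops out.\<close>
    have "proj (M j) (R j) x = proj (M j) (M' j) ?x2" if j: "j < length \<tau>s" for j
    proof -
      interpret M: sum_decomp \<xi> \<gamma> W2 "M j" "M' j" by unfold_locales (rule sk2, rule M(1)[OF j])
      interpret R: sum_decomp \<xi> \<gamma> W "M j" "R j" by unfold_locales (rule sk, rule R(1)[OF j])
      let ?m = "proj (M j) (M' j) ?x2"
      have "(?x2 - ?m) + ?x1 \<in> R j" unfolding R_def using M.proj_in(2)[OF x2] x1 by blast
      from R.proj_eq[OF M.proj_in(1)[OF x2] this] show ?thesis by simp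
    qed
    then have "(\<Sum>j<length \<tau>s. proj (N (Suc j)) (N' (Suc j)) x) = ?x2"
      using M_sum[OF x2] by (simp add: N_def N'_def)
    then show ?thesis
      unfolding length_Cons sum.lessThan_Suc_shift by (simp add: N_def N'_def)
  qed
  ultimately show ?case by blast
qed

section \<open>Exchange of indecomposable summands\<close>

context two_sums
begin

lemma swap: "two_sums \<xi> \<gamma> V U1 U2 W1 W2"
  by unfold_locales

text \<open>With the roles exchanged, \<open>B\<close> becomes first \<open>q\<close>, then
  \<open>p\<close>, on \<open>U1\<close>; a right inverse exhibits each \<open>y\<close> as
  \<open>p\<close> of a vector of \<open>W1\<close>.\<close>

lemma onto_of_polynomial_inverse:
  assumes "\<And>y. y \<in> U1 \<Longrightarrow> two_sums.B U1 U2 W1 W2 (papp r (two_sums.B U1 U2 W1 W2) y) = y"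
  shows "U1 \<subseteq> proj U1 U2 ` W1"
proof
  interpret S: two_sums \<xi> \<gamma> V U1 U2 W1 W2 by (rule swap)
  fix y assume y: "y \<in> U1"
  let ?z = "proj W1 W2 (papp r S.B y)"
  have "?z \<in> W1" by (rule W.proj_in(1)[OF U1V[OF S.B.papp_in[OF y]]])
  moreover have "y = proj U1 U2 ?z" using assms[OF y] S.B_def[of "papp r S.B y"] by simp
  ultimately show "y \<in> proj U1 U2 ` W1" by blast
qed

text \<open>\<open>(q p)^(n+1) = q (p q)^n p\<close>; thus nilpotency of \<open>p q\<close> on
  \<open>U1\<close> forces nilpotency of \<open>q p\<close> on \<open>W1\<close>.\<close>

lemma B_pow_swap:
  "x \<in> W1 \<Longrightarrow> (B ^^ Suc n) x = proj W1 W2 ((two_sums.B U1 U2 W1 W2 ^^ n) (proj U1 U2 x))"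
proof -
  interpret S: two_sums \<xi> \<gamma> V U1 U2 W1 W2 by (rule swap)
  show ?thesis by (induction n) (simp_all add: B_def S.B_def)
qed

text \<open>On an indecomposable space \<open>B\<close> has a single real eigenvalue or a single pair of complex conjugate
  ones; the last hypothesis only excludes a real eigenvalue \<open>c \<le> 0\<close>, which has no invertible real
  square root.\<close>

lemma exchange_indecomposable:
  assumes ne: "W1 \<noteq> {0}" and ind: "indecomposable_space \<xi> W1 \<gamma>" "indecomposable_space \<xi> U1 \<gamma>"
    and nondeg: "nondegenerate_on W2 \<gamma>"
    and B: "\<not> (\<exists>c n. c \<le> 0 \<and> (\<forall>x\<in>W1. ((\<lambda>x. B x - c *\<^sub>R x) ^^ n) x = 0))"
  shows "\<exists>\<sigma>. isometry_between W1 \<xi> \<gamma> U1 \<xi> \<gamma> \<sigma>" "\<exists>\<phi>. isometry_between W2 \<xi> \<gamma> U2 \<xi> \<gamma> \<phi>"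
proof -
  have dichotomy: "(\<exists>n. \<forall>x\<in>W1. (papp r B ^^ n) x = 0) \<or> (\<exists>u. \<forall>x\<in>W1. papp u (papp r B) (papp r B x) = x)"
    for r
  proof -
    interpret f: endo W1 "papp r B" by (rule endo_papp_B)
    show ?thesis
    proof (rule f.nilpotent_or_invertible[OF W1_space ind(1)])
      show "\<xi> (papp r B x) = papp r B (\<xi> x)" if "x \<in> W1" for x
        by (rule papp_B_commute[OF that])
      show "\<gamma> (papp r B x) y = \<gamma> x (papp r B y)" if "x \<in> W1" "y \<in> W1" for x y
        by (rule papp_B_adjoint[OF that])
    qed
  qed
  obtain a b w where w: "w \<in> W1" "w \<noteq> 0" "papp [:a\<^sup>2 + b\<^sup>2, - 2 * a, 1:] B w = 0"
    by (rule B.quadratic_kernel[OF skew_spaceD(1)[OF W1_space] ne])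
  let ?Q = "[:a\<^sup>2 + b\<^sup>2, - 2 * a, 1:]"
  \<comment> \<open>The nonzero \<open>w\<close> is killed by the quadratic in \<open>B\<close>, so
    that map has no left inverse, and the dichotomy makes it nilpotent.\<close>
  have "papp u (papp ?Q B) (papp ?Q B w) \<noteq> w" for u
  proof -
    interpret f: endo W1 "papp ?Q B" by (rule endo_papp_B)
    show ?thesis using w linear_on_0[OF f.linear_papp W.sumD(1), of u] by simp
  qed
  then obtain n where "\<forall>x\<in>W1. (papp ?Q B ^^ n) x = 0" using dichotomy[of ?Q] w(1) by blast
  then have Qn: "\<forall>x\<in>W1. papp (?Q ^ n) B x = 0" by (simp add: B.papp_power)
  \<comment> \<open>Otherwise the quadratic is \<open>(X - a)^2\<close> with \<open>a <= 0\<close>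
    and \<open>B - a\<close> is nilpotent, the case ruled out by hypothesis.\<close>
  have ab: "b \<noteq> 0 \<or> a > 0"
  proof (rule ccontr)
    assume "\<not> (b \<noteq> 0 \<or> a > 0)"
    then have b: "b = 0" and a: "a \<le> 0" by simp_all
    have "?Q = [:- a, 1:] ^ 2" using b by (simp add: power2_eq_square)
    then have eq: "?Q ^ n = [:- a, 1:] ^ (2 * n)" by (simp only: power_mult)
    have "papp [:- a, 1:] B = (\<lambda>x. B x - a *\<^sub>R x)" by (rule ext) (simp add: papp_def)
    then have "((\<lambda>x. B x - a *\<^sub>R x) ^^ (2 * n)) x = 0" if "x \<in> W1" for x
      using bspec[OF Qn that] B.papp_power[OF that, of "[:- a, 1:]" "2 * n"] unfolding eq by simp
    then show False using B a by blast
  qed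
  obtain c0 d0 where c0: "\<And>x. x \<in> W1 \<Longrightarrow> papp c0 B (papp c0 B x) = B x"
    and cd0: "\<And>x. x \<in> W1 \<Longrightarrow> papp c0 B (papp d0 B x) = x"
    and dc0: "\<And>x. x \<in> W1 \<Longrightarrow> papp d0 B (papp c0 B x) = x"
    using B.sqrt_operator[OF ab Qn] by blast
  have neg: "papp r B (- x) = - papp r B x" if "x \<in> W1" for r x
    using linear_onD(3)[OF B.linear_papp that, of r "-1"] by simp
  \<comment> \<open>Choice of sign. If \<open>1 + C\<close> is not invertible, it is nilpotent and
    \<open>C\<close> has an eigenvector for -1. On it \<open>1 - C\<close> acts as 2, so
    \<open>1 - C\<close> is not nilpotent, hence invertible, and \<open>- C\<close> is the root to
    use.\<close>
  have "\<exists>c d e. (\<forall>x\<in>W1. papp c B (papp c B x) = B x) \<and> (\<forall>x\<in>W1. papp c B (papp d B x) = x) \<and>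
      (\<forall>x\<in>W1. papp d B (papp c B x) = x) \<and> (\<forall>x\<in>W1. papp e (papp (1 + c) B) (papp (1 + c) B x) = x)"
  proof (cases "\<exists>e. \<forall>x\<in>W1. papp e (papp (1 + c0) B) (papp (1 + c0) B x) = x")
    case True
    then show ?thesis using c0 cd0 dc0 by blast
  next
    case False
    then obtain k where k: "\<And>x. x \<in> W1 \<Longrightarrow> (papp (1 + c0) B ^^ k) x = 0"
      using dichotomy[of "1 + c0"] by blast
    obtain x where x: "x \<in> W1" "x \<noteq> 0" "papp (1 + c0) B x = 0"
      by (rule endo.nilpotent_kernel[OF endo_papp_B ne k])
    then have "papp c0 B x = - x" by (simp add: papp_add add_eq_0_iff)
    then have "papp (1 - c0) B x = 2 *\<^sub>R x" by (simp add: papp_diff scaleR_2)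
    then have "(papp (1 - c0) B ^^ m) x = 2 ^ m *\<^sub>R x" for m
      by (induction m) (simp_all add: linear_onD(3)[OF B.linear_papp x(1)])
    then have "\<not> (\<exists>m. \<forall>x\<in>W1. (papp (1 - c0) B ^^ m) x = 0)" using x(1,2) by force
    then obtain e where "\<forall>x\<in>W1. papp e (papp (1 - c0) B) (papp (1 - c0) B x) = x"
      using dichotomy[of "1 - c0"] by blast
    then have "\<forall>x\<in>W1. papp e (papp (1 + - c0) B) (papp (1 + - c0) B x) = x" by simp
    moreover have "\<forall>x\<in>W1. papp (- c0) B (papp (- c0) B x) = B x"
      "\<forall>x\<in>W1. papp (- c0) B (papp (- d0) B x) = x" "\<forall>x\<in>W1. papp (- d0) B (papp (- c0) B x) = x"
      using c0 cd0 dc0 by (simp_all add: papp_minus neg B.papp_in)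
    ultimately show ?thesis by blast
  qed
  then obtain c d e where c: "\<And>x. x \<in> W1 \<Longrightarrow> papp c B (papp c B x) = B x"
    and cd: "\<And>x. x \<in> W1 \<Longrightarrow> papp c B (papp d B x) = x"
    and dc: "\<And>x. x \<in> W1 \<Longrightarrow> papp d B (papp c B x) = x"
    and e: "\<And>x. x \<in> W1 \<Longrightarrow> papp e (papp (1 + c) B) (papp (1 + c) B x) = x" by blast
  interpret S: two_sums \<xi> \<gamma> V U1 U2 W1 W2 by (rule swap)
  \<comment> \<open>If the swapped map were nilpotent, so would be \<open>B\<close>; but
    \<open>B\<close> is the square of an invertible map on a nonzero space.\<close>
  have "\<not> (\<exists>n. \<forall>y\<in>U1. (S.B ^^ n) y = 0)"
  proof
    assume "\<exists>n. \<forall>y\<in>U1. (S.B ^^ n) y = 0"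
    then obtain n where n: "\<And>y. y \<in> U1 \<Longrightarrow> (S.B ^^ n) y = 0" by blast
    have "(B ^^ Suc n) x = 0" if "x \<in> W1" for x
      using B_pow_swap[OF that] n[OF U.proj_in(1)[OF W1V[OF that]]]
        W.proj_0[OF subspace_0[OF W.sumD(2)]] by simp
    then obtain x where x: "x \<in> W1" "x \<noteq> 0" "B x = 0"
      by (rule B.nilpotent_kernel[OF ne])
    have "papp d B (papp d B (B x)) = x"
      using c[OF x(1)] dc[OF x(1)] dc[OF B.papp_in[OF x(1)], of c] by simp
    then show False using x linear_on_0[OF B.linear_papp W.sumD(1)] by simp
  qed
  then obtain u where u: "\<And>y. y \<in> U1 \<Longrightarrow> papp u S.B (S.B y) = y"
    using S.B.nilpotent_or_invertible[OF S.W1_space ind(2) S.B_commute S.B_adjoint] by blast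
  have "S.B (papp u S.B y) = y" if "y \<in> U1" for y
    using S.B.papp_commute[OF S.B.lin refl that] u[OF that] by simp
  then have onto: "U1 \<subseteq> proj U1 U2 ` W1" by (rule onto_of_polynomial_inverse)
  show "\<exists>\<sigma>. isometry_between W1 \<xi> \<gamma> U1 \<xi> \<gamma> \<sigma>" "\<exists>\<phi>. isometry_between W2 \<xi> \<gamma> U2 \<xi> \<gamma> \<phi>"
    using exchange_poly[OF c cd dc e onto nondeg] by blast+
qed

end

lemma decomposes_exchange:
  assumes nd: "nondegenerate_space \<xi> V \<gamma>" and sum: "inv_sum \<xi> \<gamma> V W1 W2"
    and p: "(\<xi>, W1, \<gamma>) \<in> pairs" and ind: "indecomposable_type (type_of (\<xi>, W1, \<gamma>))"
    and dec: "decomposes \<xi> \<gamma> V \<tau>s" and \<tau>s: "\<And>\<tau>. \<tau> \<in> set \<tau>s \<Longrightarrow> indecomposable_type \<tau>"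
  shows "\<exists>j<length \<tau>s. type_of (\<xi>, W1, \<gamma>) = \<tau>s ! j \<and>
    (\<exists>U1 U2 \<phi>. inv_sum \<xi> \<gamma> V U1 U2 \<and> isometry_between W2 \<xi> \<gamma> U2 \<xi> \<gamma> \<phi> \<and>
      decomposes \<xi> \<gamma> U2 (take j \<tau>s @ drop (Suc j) \<tau>s))"
proof -
  have sk: "skew_space \<xi> V \<gamma>" using nd unfolding nondegenerate_space_def by simp
  note sk1 = inv_sum_skew_space(1)[OF sk sum]
  obtain N N' where N: "\<And>j. j < length \<tau>s \<Longrightarrow> inv_sum \<xi> \<gamma> V (N j) (N' j)"
    "\<And>j. j < length \<tau>s \<Longrightarrow> (\<xi>, N j, \<gamma>) \<in> pairs"
    "\<And>j. j < length \<tau>s \<Longrightarrow> type_of (\<xi>, N j, \<gamma>) = \<tau>s ! j"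
    "\<And>j. j < length \<tau>s \<Longrightarrow> decomposes \<xi> \<gamma> (N' j) (take j \<tau>s @ drop (Suc j) \<tau>s)"
    and N_sum: "\<And>x. x \<in> V \<Longrightarrow> (\<Sum>j<length \<tau>s. proj (N j) (N' j) x) = x"
    using decomposes_projections[OF dec sk] by blast
  have two: "two_sums \<xi> \<gamma> V W1 W2 (N j) (N' j)" if "j < length \<tau>s" for j
    by unfold_locales (rule sk, rule sum, rule N(1)[OF that])
  interpret W: sum_decomp \<xi> \<gamma> V W1 W2 by unfold_locales (rule sk, rule sum)
  let ?B = "\<lambda>j. two_sums.B W1 W2 (N j) (N' j)"
  have "\<exists>j\<in>{..<length \<tau>s}. \<not> (\<exists>c n. c \<le> 0 \<and> (\<forall>x\<in>W1. ((\<lambda>x. ?B j x - c *\<^sub>R x) ^^ n) x = 0))"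
  proof (rule identity_not_sum_nonpositive)
    show "fin_dim_space W1" by (rule skew_spaceD(1)[OF sk1])
    show "W1 \<noteq> {0}" using p unfolding pairs_iff by simp
    show "finite {..<length \<tau>s}" by simp
    show "linear_on W1 W1 (?B j)" if "j \<in> {..<length \<tau>s}" for j
      using two_sums.linear_B[OF two] that by simp
    fix x assume x: "x \<in> W1"
    then have xV: "x \<in> V" using W.sumD(5) by blast
    have "(\<Sum>j<length \<tau>s. ?B j x) = (\<Sum>j<length \<tau>s. proj W1 W2 (proj (N j) (N' j) x))"
      by (intro sum.cong refl) (simp add: two_sums.B_def[OF two])
    also have "\<dots> = proj W1 W2 (\<Sum>j<length \<tau>s. proj (N j) (N' j) x)"
    proof (rule linear_on_sum[OF W.linear_proj skew_spaceD(2)[OF sk], symmetric])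
      fix j assume "j \<in> {..<length \<tau>s}"
      then interpret two_sums \<xi> \<gamma> V W1 W2 "N j" "N' j" using two by simp
      show "proj (N j) (N' j) x \<in> V" by (rule U.proj_in_space[OF xV])
    qed
    also have "\<dots> = x" using N_sum[OF xV] W.proj_id[OF x] by simp
    finally show "(\<Sum>j<length \<tau>s. ?B j x) = x" .
  qed
  then obtain j where j: "j < length \<tau>s"
    and B: "\<not> (\<exists>c n. c \<le> 0 \<and> (\<forall>x\<in>W1. ((\<lambda>x. ?B j x - c *\<^sub>R x) ^^ n) x = 0))" by blast
  interpret two_sums \<xi> \<gamma> V W1 W2 "N j" "N' j" by (rule two[OF j])
  have ne: "W1 \<noteq> {0}" using p unfolding pairs_iff by simp
  have ind1: "indecomposable_space \<xi> W1 \<gamma>" using ind indecomposable_type_iff[OF p] by simp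
  have ind2: "indecomposable_space \<xi> (N j) \<gamma>"
    using \<tau>s[of "\<tau>s ! j"] j indecomposable_type_iff[OF N(2)[OF j]] N(3)[OF j] by simp
  have nd2: "nondegenerate_on W2 \<gamma>"
    using nondegenerate_space_summands(2)[OF nd sum] unfolding nondegenerate_space_def by simp
  obtain \<sigma> \<phi> where \<sigma>: "isometry_between W1 \<xi> \<gamma> (N j) \<xi> \<gamma> \<sigma>"
    and \<phi>: "isometry_between W2 \<xi> \<gamma> (N' j) \<xi> \<gamma> \<phi>"
    using exchange_indecomposable[OF ne ind1 ind2 nd2 B] by blast
  have "type_of (\<xi>, W1, \<gamma>) = \<tau>s ! j"
    using type_of_eq_iff[OF p N(2)[OF j]] \<sigma> N(3)[OF j] by auto
  then show ?thesis using j N(1,4)[OF j] \<phi> by blast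
qed

text \<open>After the exchange, \<open>U2\<close> carries two decompositions: that of
  \<open>W2\<close>, moved by the isometry, and the second list without its \<open>j\<close>-th
  entry. The induction hypothesis compares them.\<close>

lemma decomposes_unique:
  assumes "nondegenerate_space \<xi> V \<gamma>" "decomposes \<xi> \<gamma> V \<tau>s" "decomposes \<xi> \<gamma> V \<tau>s'"
    and "\<And>\<tau>. \<tau> \<in> set \<tau>s \<Longrightarrow> indecomposable_type \<tau>"
    and "\<And>\<tau>. \<tau> \<in> set \<tau>s' \<Longrightarrow> indecomposable_type \<tau>"
  shows "mset \<tau>s = mset \<tau>s'"
  using assms
proof (induction \<tau>s arbitrary: V \<tau>s')
  case Nil
  have "V = {0}" using Nil.prems(2) by simp
  then have "\<tau>s' = []" using Nil.prems(3) decomposes_nonzero by (metis neq_Nil_conv)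
  then show ?case by simp
next
  case (Cons \<tau> \<tau>s)
  note nd = Cons.prems(1)
  obtain W1 W2 where sum: "inv_sum \<xi> \<gamma> V W1 W2" and p: "(\<xi>, W1, \<gamma>) \<in> pairs"
    and \<tau>: "type_of (\<xi>, W1, \<gamma>) = \<tau>" and dec: "decomposes \<xi> \<gamma> W2 \<tau>s"
    using Cons.prems(2) by auto
  have ind: "indecomposable_type (type_of (\<xi>, W1, \<gamma>))" using Cons.prems(4) \<tau> by simp
  let ?rest = "\<lambda>j. take j \<tau>s' @ drop (Suc j) \<tau>s'"
  obtain j U1 U2 \<phi> where j: "j < length \<tau>s'" "\<tau> = \<tau>s' ! j"
    and U: "inv_sum \<xi> \<gamma> V U1 U2" and \<phi>: "isometry_between W2 \<xi> \<gamma> U2 \<xi> \<gamma> \<phi>"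
    and dec': "decomposes \<xi> \<gamma> U2 (?rest j)"
    using decomposes_exchange[OF nd sum p ind Cons.prems(3,5)] \<tau> by blast
  have decU: "decomposes \<xi> \<gamma> U2 \<tau>s"
    by (rule decomposes_isometry[OF dec \<phi> nondegenerate_space_summands(2)[OF nd sum]
          nondegenerate_space_summands(2)[OF nd U]])
  have "mset \<tau>s = mset (?rest j)"
  proof (rule Cons.IH[OF nondegenerate_space_summands(2)[OF nd U] decU dec'])
    show "indecomposable_type \<tau>" if "\<tau> \<in> set \<tau>s" for \<tau> using Cons.prems(4) that by simp
    show "indecomposable_type \<tau>" if "\<tau> \<in> set (?rest j)" for \<tau>
      using Cons.prems(5) that by (auto dest: in_set_takeD in_set_dropD)
  qed
  moreover have "mset \<tau>s' = add_mset (\<tau>s' ! j) (mset (?rest j))"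
    by (subst id_take_nth_drop[OF j(1)]) simp
  ultimately show ?case using j(2) by simp
qed

text \<open>Both projections fix \<open>v0\<close>, so \<open>B - 1\<close> kills it. The quadratic
  is \<open>(X - 1)^2\<close>, written with \<open>a = 1\<close> and \<open>b = 0\<close> in the
  shape that \<open>sqrt_operator\<close> expects.\<close>

lemma (in two_sums) special_unipotent:
  assumes T: "(V, \<xi>, v0, \<gamma>) \<in> triples" and v0: "v0 \<in> W1" "v0 \<in> U1"
    and ind: "special_indecomposable_space \<xi> W1 v0 \<gamma>"
  shows "B v0 = v0" "\<exists>n. \<forall>x\<in>W1. papp ([:1\<^sup>2 + 0\<^sup>2, - 2 * 1, 1:] ^ n) B x = 0"
proof -
  note T1 = triple_summands(1)[OF T W.sum v0(1)]
  show B0: "B v0 = v0" unfolding B_def using W.proj_id[OF v0(1)] U.proj_id[OF v0(2)] by simp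
  have "\<exists>n. \<forall>x\<in>W1. (papp [:- 1, 1:] B ^^ n) x = 0"
  proof (rule special_indecomposable_nilpotent[OF T1 ind B.linear_papp, where \<epsilon> = 1])
    show "\<xi> (papp [:- 1, 1:] B x) = papp [:- 1, 1:] B (\<xi> x)" if "x \<in> W1" for x
      by (rule papp_B_commute[OF that])
    show "\<gamma> (papp [:- 1, 1:] B x) y = 1 * \<gamma> x (papp [:- 1, 1:] B y)" if "x \<in> W1" "y \<in> W1" for x y
      using papp_B_adjoint[OF that] by simp
    show "papp [:- 1, 1:] B v0 = 0" by (simp add: papp_def B0)
  qed simp
  then obtain n where n: "\<And>x. x \<in> W1 \<Longrightarrow> (papp [:- 1, 1:] B ^^ n) x = 0" by blast
  have eq: "[:1\<^sup>2 + 0\<^sup>2, - 2 * 1, 1 :: real:] = [:- 1, 1:] * [:- 1, 1:]" by simp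
  have "papp ([:1\<^sup>2 + 0\<^sup>2, - 2 * 1, 1:] ^ n) B x = 0" if "x \<in> W1" for x
  proof -
    have "papp ([:- 1, 1:] ^ n) B x = 0" using n[OF that] B.papp_power[OF that] by simp
    then show ?thesis
      unfolding eq power_mult_distrib by (rule B.papp_dvd_0[OF dvd_triv_left that])
  qed
  then show "\<exists>n. \<forall>x\<in>W1. papp ([:1\<^sup>2 + 0\<^sup>2, - 2 * 1, 1:] ^ n) B x = 0" by blast
qed

lemma (in two_sums) exchange_special:
  assumes T: "(V, \<xi>, v0, \<gamma>) \<in> triples" and v0: "v0 \<in> W1" "v0 \<in> U1"
    and ind: "special_indecomposable_space \<xi> W1 v0 \<gamma>" "special_indecomposable_space \<xi> U1 v0 \<gamma>"
  shows "\<exists>\<sigma>. isometry_between W1 \<xi> \<gamma> U1 \<xi> \<gamma> \<sigma> \<and> \<sigma> v0 = v0"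
    "\<exists>\<phi>. isometry_between W2 \<xi> \<gamma> U2 \<xi> \<gamma> \<phi>"
proof -
  interpret S: two_sums \<xi> \<gamma> V U1 U2 W1 W2 by (rule swap)
  have pos: "(0::real) \<noteq> 0 \<or> (1::real) > 0" by simp
  note T1 = triple_summands(1)[OF T W.sum v0(1)]
  have v0ne: "v0 \<noteq> 0" using T unfolding triples_iff by simp
  note B0 = special_unipotent(1)[OF T v0 ind(1)]
  obtain n where n: "\<forall>x\<in>W1. papp ([:1\<^sup>2 + 0\<^sup>2, - 2 * 1, 1:] ^ n) B x = 0"
    using special_unipotent(2)[OF T v0 ind(1)] by blast
  obtain c0 d0 where c0: "\<And>x. x \<in> W1 \<Longrightarrow> papp c0 B (papp c0 B x) = B x"
    and cd0: "\<And>x. x \<in> W1 \<Longrightarrow> papp c0 B (papp d0 B x) = x"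
    and dc0: "\<And>x. x \<in> W1 \<Longrightarrow> papp d0 B (papp c0 B x) = x"
    using B.sqrt_operator[OF pos n] by blast
  obtain m where m: "\<forall>y\<in>U1. papp ([:1\<^sup>2 + 0\<^sup>2, - 2 * 1, 1:] ^ m) S.B y = 0"
    using S.special_unipotent(2)[OF T v0(2,1) ind(2)] by blast
  obtain c' d' where c': "\<And>x. x \<in> U1 \<Longrightarrow> papp c' S.B (papp c' S.B x) = S.B x"
    and cd': "\<And>x. x \<in> U1 \<Longrightarrow> papp c' S.B (papp d' S.B x) = x"
    and dc': "\<And>x. x \<in> U1 \<Longrightarrow> papp d' S.B (papp c' S.B x) = x"
    using S.B.sqrt_operator[OF pos m] by blast
  \<comment> \<open>The swapped map is the square of \<open>c'\<close>, so the square of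
    \<open>d'\<close> inverts it; this yields surjectivity of \<open>p\<close> from
    \<open>W1\<close> onto \<open>U1\<close>.\<close>
  have "S.B (papp (d' * d') S.B y) = y" if y: "y \<in> U1" for y
  proof -
    have "S.B (papp (d' * d') S.B y) = papp c' S.B (papp c' S.B (papp d' S.B (papp d' S.B y)))"
      using c' y by (simp add: S.B.papp_mult S.B.papp_in)
    then show ?thesis using cd' y by (simp add: S.B.papp_in)
  qed
  then have onto: "U1 \<subseteq> proj U1 U2 ` W1" by (rule onto_of_polynomial_inverse)
  have eigen: "papp r B v0 = poly r 1 *\<^sub>R v0" for r
    using B.papp_eigen[OF v0(1), of 1] B0 by simp
  \<comment> \<open>The eigenvalue of the root on \<open>v0\<close>; its square is 1. Multiplying
    the root by it makes \<open>C\<close> fix \<open>v0\<close>. Then \<open>1 + C\<close> acts on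
    \<open>v0\<close> as 2, which forces it to be invertible, and the resulting isometry fixes
    \<open>v0\<close>.\<close>
  define s where "s = poly c0 1"
  have "(s * s) *\<^sub>R v0 = v0"
    using c0[OF v0(1)] B0 eigen linear_onD(3)[OF B.linear_papp v0(1)] by (simp add: s_def)
  then have "s * s = 1" using v0ne by (metis scaleR_one scaleR_right_imp_eq)
  define c where "c = smult s c0"
  define d where "d = smult s d0"
  have c: "papp c B (papp c B x) = B x" and cd: "papp c B (papp d B x) = x"
    and dc: "papp d B (papp c B x) = x" if x: "x \<in> W1" for x
    unfolding c_def d_def papp_smult
    using \<open>s * s = 1\<close> c0[OF x] cd0[OF x] dc0[OF x] linear_onD(3)[OF B.linear_papp B.papp_in[OF x]]
    by simp_all
  have c_v0: "papp c B v0 = v0" using eigen[of c] \<open>s * s = 1\<close> by (simp add: c_def s_def)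
  have f_v0: "papp (1 + c) B v0 = 2 *\<^sub>R v0" by (simp add: papp_add c_v0 scaleR_2)
  have "\<exists>e. \<forall>x\<in>W1. papp e (papp (1 + c) B) (papp (1 + c) B x) = x"
  proof (rule special_indecomposable_invertible[OF T1 ind(1) B.linear_papp])
    show "\<xi> (papp (1 + c) B x) = papp (1 + c) B (\<xi> x)" if "x \<in> W1" for x
      by (rule papp_B_commute[OF that])
    show "\<gamma> (papp (1 + c) B x) y = \<gamma> x (papp (1 + c) B y)" if "x \<in> W1" "y \<in> W1" for x y
      by (rule papp_B_adjoint[OF that])
    show "papp (1 + c) B v0 = 2 *\<^sub>R v0" by (rule f_v0)
  qed simp
  then obtain e where e: "\<And>x. x \<in> W1 \<Longrightarrow> papp e (papp (1 + c) B) (papp (1 + c) B x) = x" by blast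
  have nondeg: "nondegenerate_on W2 \<gamma>"
    using triple_summands(2)[OF T W.sum v0(1)] unfolding nondegenerate_space_def by simp
  have "papp d B v0 = v0" using dc[OF v0(1)] c_v0 by simp
  then have "proj U1 U2 (papp d B v0) = v0" using U.proj_id[OF v0(2)] by simp
  then show "\<exists>\<sigma>. isometry_between W1 \<xi> \<gamma> U1 \<xi> \<gamma> \<sigma> \<and> \<sigma> v0 = v0"
    using exchange_poly(1)[OF c cd dc e onto nondeg] by blast
  show "\<exists>\<phi>. isometry_between W2 \<xi> \<gamma> U2 \<xi> \<gamma> \<phi>"
    using exchange_poly(2)[OF c cd dc e onto nondeg] .
qed

theorem theorem7:
  fixes \<Delta> :: "'a::real_vector triple set"
  assumes "\<Delta> \<in> special_types"
  shows "(\<exists>\<Delta>0 \<tau>s. indecomposable_decomposition \<Delta> \<Delta>0 \<tau>s) \<and>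
    (\<forall>\<Delta>0 \<tau>s \<Delta>0' \<tau>s'.
       indecomposable_decomposition \<Delta> \<Delta>0 \<tau>s \<and> indecomposable_decomposition \<Delta> \<Delta>0' \<tau>s' \<longrightarrow>
       \<Delta>0 = \<Delta>0' \<and> mset \<tau>s = mset \<tau>s')"
proof -
  obtain t where "t \<in> triples" "\<Delta> = special_type_of t"
    using assms unfolding special_types_def special_type_of_def by (rule quotientE)
  then obtain V \<xi> v0 \<gamma> where T: "(V, \<xi>, v0, \<gamma>) \<in> triples" and \<Delta>: "\<Delta> = special_type_of (V, \<xi>, v0, \<gamma>)"
    by (cases t) auto
  have sk: "skew_space \<xi> V \<gamma>" using T unfolding triples_iff by simp
  have "\<Delta>0 = \<Delta>0' \<and> mset \<tau>s = mset \<tau>s'"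
    if dec: "indecomposable_decomposition \<Delta> \<Delta>0 \<tau>s" "indecomposable_decomposition \<Delta> \<Delta>0' \<tau>s'"
    for \<Delta>0 \<tau>s \<Delta>0' \<tau>s'
  proof -
    \<comment> \<open>Both decompositions are realised inside the same representative
      \<open>V\<close>, so that their projections can be composed.\<close>
    obtain W1 W2 where W: "inv_sum \<xi> \<gamma> V W1 W2" "v0 \<in> W1" "special_indecomposable_space \<xi> W1 v0 \<gamma>"
      "\<Delta>0 = special_type_of (W1, \<xi>, v0, \<gamma>)" "decomposes \<xi> \<gamma> W2 \<tau>s"
      and \<tau>s: "\<And>\<tau>. \<tau> \<in> set \<tau>s \<Longrightarrow> indecomposable_type \<tau>"
      using indecomposable_decompositionD[OF T dec(1)[unfolded \<Delta>]] by metis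
    obtain U1 U2 where U: "inv_sum \<xi> \<gamma> V U1 U2" "v0 \<in> U1" "special_indecomposable_space \<xi> U1 v0 \<gamma>"
      "\<Delta>0' = special_type_of (U1, \<xi>, v0, \<gamma>)" "decomposes \<xi> \<gamma> U2 \<tau>s'"
      and \<tau>s': "\<And>\<tau>. \<tau> \<in> set \<tau>s' \<Longrightarrow> indecomposable_type \<tau>"
      using indecomposable_decompositionD[OF T dec(2)[unfolded \<Delta>]] by metis
    interpret two_sums \<xi> \<gamma> V W1 W2 U1 U2
      by unfold_locales (rule sk, rule W(1), rule U(1))
    note ex = exchange_special[OF T W(2) U(2) W(3) U(3)]
    have "\<Delta>0 = \<Delta>0'"
      unfolding W(4) U(4)
        special_type_of_eq_iff[OF triple_summands(1)[OF T W(1,2)] triple_summands(1)[OF T U(1,2)]]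
      by (rule ex(1))
    moreover obtain \<phi> where \<phi>: "isometry_between W2 \<xi> \<gamma> U2 \<xi> \<gamma> \<phi>" using ex(2) by blast
    have "decomposes \<xi> \<gamma> U2 \<tau>s"
      by (rule decomposes_isometry[OF W(5) \<phi> triple_summands(2)[OF T W(1,2)]
            triple_summands(2)[OF T U(1,2)]])
    then have "mset \<tau>s = mset \<tau>s'"
      using decomposes_unique[OF triple_summands(2)[OF T U(1,2)] _ U(5) \<tau>s \<tau>s'] by blast
    ultimately show ?thesis by blast
  qed
  then show ?thesis
    using special_indecomposable_decomposition_exists[OF T] unfolding \<Delta> by blast
qed

end
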